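(* Suppose that $\mathcal A$ and $\mathcal B$ are weak* closed unital operator algebras, acting on Hilbert spaces $H_1$ and $H_2$, respectively. (i) Suppose that $\mathcal A$ is spatially embedded in $\mathcal B$. If $\mathcal B$ has property $S_\sigma$ then so does $\mathcal A$. (ii) Suppose that $\mathcal A$ and $\mathcal B$ are spatially Morita equivalent. Then $\mathcal A$ has property $S_\sigma$ precisely when $\mathcal B$ does so.
   Context: For subspaces $\mathcal X,\mathcal Y$ of operators, $[\mathcal X\mathcal Y]$ denotes the weak* closure of the set of finite sums $\sum_{i=1}^kX_iY_i$, $X_i\in\mathcal X$, $Y_i\in\mathcal Y$. $\mathcal A\subseteq\mathcal B(H_1)$ is spatially embedded in $\mathcal B\subseteq\mathcal B(H_2)$ if there exist a $\mathcal B,\mathcal A$-bimodule $\mathcal X\subseteq\mathcal B(H_1,H_2)$ and an $\mathcal A,\mathcal B$-bimodule $\mathcal Y\subseteq\mathcal B(H_2,H_1)$ such that $[\mathcal X\mathcal Y]\subseteq\mathcal B$ and $[\mathcal Y\mathcal X]=\mathcal A$. If, moreover, $\mathcal X,\mathcal Y$ can be chosen so that $\mathcal B=[\mathcal X\mathcal Y]$, then $\mathcal A$ and $\mathcal B$ are spatially Morita equivalent. (A $\mathcal B,\mathcal A$-bimodule is a linear subspace $\mathcal X$ with $BXA\in\mathcal X$ for $B\in\mathcal B$, $X\in\mathcal X$, $A\in\mathcal A$.) For weak* closed subspaces $\mathcal V\subseteq\mathcal B(H)$ and $\mathcal U\subseteq\mathcal B(K_1,K_2)$, $\mathcal V\bar\otimes\mathcal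 U$ is the weak* closed linear span of $\{S\otimes T:S\in\mathcal V,T\in\mathcal U\}$. For a weak* continuous functional $\omega\in\mathcal V_*$, $R_\omega:\mathcal V\bar\otimes\mathcal B(K_1,K_2)\to\mathcal B(K_1,K_2)$ is the weak* continuous linear map with $R_\omega(A\otimes B)=\omega(A)B$; $\mathcal F(\mathcal V,\mathcal U)=\{T\in\mathcal V\bar\otimes\mathcal B(K_1,K_2):R_\omega(T)\in\mathcal U\ \forall\omega\in\mathcal V_*\}$. $\mathcal V$ has property $S_\sigma$ if $\mathcal F(\mathcal V,\mathcal U)=\mathcal V\bar\otimes\mathcal U$ for all Hilbert spaces $K_1,K_2$ and all weak* closed subspaces $\mathcal U\subseteq\mathcal B(K_1,K_2)$. *)

theory Defs
  imports "HOL-Analysis.Analysis" "HOL-Library.Function_Algebras"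
begin

section \<open>Complex Hilbert spaces\<close>

class complex_vector = ab_group_add +
  fixes scaleC :: "complex \<Rightarrow> 'a \<Rightarrow> 'a" (infixr \<open>*\<^sub>C\<close> 75)
  assumes scaleC_add_right: "a *\<^sub>C (x + y) = a *\<^sub>C x + a *\<^sub>C y"
    and scaleC_add_left: "(a + b) *\<^sub>C x = a *\<^sub>C x + b *\<^sub>C x"
    and scaleC_scaleC: "a *\<^sub>C b *\<^sub>C x = (a * b) *\<^sub>C x"
    and scaleC_one: "1 *\<^sub>C x = x"

global_interpretation cvec: vector_space "scaleC :: complex \<Rightarrow> 'a \<Rightarrow> 'a::complex_vector"
  by standard (fact scaleC_add_right scaleC_add_left scaleC_scaleC scaleC_one)+

instantiation "fun" :: (type, complex_vector) complex_vector
begin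

definition scaleC_fun_def: "c *\<^sub>C f = (\<lambda>x. c *\<^sub>C f x)"

instance
  by standard (simp_all add: scaleC_fun_def fun_eq_iff scaleC_add_right scaleC_add_left
      scaleC_scaleC scaleC_one)

end

instantiation complex :: complex_vector
begin

definition scaleC_complex_def [simp]: "c *\<^sub>C (z::complex) = c * z"

instance
  by standard (simp_all add: algebra_simps)

end

text \<open>The norm, the metric and the topology are those of the underlying real inner product space.
  The complex inner product is conjugate-linear in the first argument.\<close>

class chilbert_space = complex_vector + real_inner + complete_space +
  fixes cinner :: "'a \<Rightarrow> 'a \<Rightarrow> complex"
  assumes scaleR_scaleC: "r *\<^sub>R x = complex_of_real r *\<^sub>C x"
    and inner_eq_Re_cinner: "inner x y = Re (cinner x y)"
    and cinner_commute: "cinner x y = cnj (cinner y x)"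
    and cinner_add_right: "cinner x (y + z) = cinner x y + cinner x z"
    and cinner_scaleC_right: "cinner x (c *\<^sub>C y) = c * cinner x y"
begin

subclass banach ..

end

lemma cinner_add_left: "cinner (x + y) z = cinner x z + cinner y (z::'a::chilbert_space)"
  by (metis cinner_commute cinner_add_right complex_cnj_add)

lemma cinner_scaleC_left: "cinner (c *\<^sub>C x) y = cnj c * cinner x (y::'a::chilbert_space)"
  by (metis cinner_commute cinner_scaleC_right complex_cnj_mult)

lemma cinner_zero_right [simp]: "cinner x 0 = (0::complex)"
  using cinner_add_right[of x 0 0] by simp

lemma cinner_zero_left [simp]: "cinner 0 x = (0::complex)"
  using cinner_add_left[of 0 0 x] by simp

lemma cinner_minus_right [simp]: "cinner x (- y) = - cinner x (y::'a::chilbert_space)"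
  using cinner_add_right[of x y "- y"] by (simp add: eq_neg_iff_add_eq_0 add.commute)

lemma cinner_diff_right: "cinner x (y - z) = cinner x y - cinner x (z::'a::chilbert_space)"
  using cinner_add_right[of x y "- z"] by simp

lemma cinner_diff_left: "cinner (x - y) z = cinner x z - cinner y (z::'a::chilbert_space)"
  by (metis cinner_commute cinner_diff_right complex_cnj_diff)

lemma cinner_sum_right: "cinner x (sum f A) = (\<Sum>i\<in>A. cinner x (f i :: 'a::chilbert_space))"
  by (induction A rule: infinite_finite_induct) (auto simp: cinner_add_right)

lemma cinner_sum_left: "cinner (sum f A) x = (\<Sum>i\<in>A. cinner (f i :: 'a::chilbert_space) x)"
  by (induction A rule: infinite_finite_induct) (auto simp: cinner_add_left)

lemma cinner_self: "cinner x x = complex_of_real ((norm (x::'a::chilbert_space))\<^sup>2)"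
proof -
  have "Im (cinner x x) = 0"
    using arg_cong[OF cinner_commute[of x x], of Im] by simp
  moreover have "Re (cinner x x) = (norm x)\<^sup>2"
    by (simp flip: inner_eq_Re_cinner add: power2_norm_eq_inner)
  ultimately show ?thesis by (simp add: complex_eq_iff)
qed

lemma cnj_mult_self: "cnj z * z = complex_of_real ((cmod z)\<^sup>2)"
  by (metis complex_norm_square mult.commute)

lemma norm_scaleC: "norm (c *\<^sub>C x) = cmod c * norm (x::'a::chilbert_space)"
proof -
  have "complex_of_real ((norm (c *\<^sub>C x))\<^sup>2) = cnj c * c * complex_of_real ((norm x)\<^sup>2)"
    by (simp only: cinner_self[symmetric] cinner_scaleC_left cinner_scaleC_right ac_simps)
  also have "\<dots> = complex_of_real ((cmod c * norm x)\<^sup>2)"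
    unfolding cnj_mult_self by (simp add: power_mult_distrib)
  finally show ?thesis
    by (simp only: of_real_eq_iff power2_eq_iff_nonneg norm_ge_zero mult_nonneg_nonneg)
qed

lemma cinner_cauchy_schwarz: "cmod (cinner x y) \<le> norm x * norm (y::'a::chilbert_space)"
proof (cases "cinner x y = 0")
  case False
  define u where "u = cnj (cinner x y) / cmod (cinner x y)"
  have u: "cmod u = 1" using False by (simp add: u_def norm_divide)
  have "cinner x (u *\<^sub>C y) = complex_of_real (cmod (cinner x y))"
    using False
    by (simp add: cinner_scaleC_right u_def field_simps power2_eq_square flip: complex_norm_square)
  then have "cmod (cinner x y) = inner x (u *\<^sub>C y)"
    by (simp add: inner_eq_Re_cinner)
  also have "\<dots> \<le> norm x * norm (u *\<^sub>C y)" by (rule norm_cauchy_schwarz)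
  finally show ?thesis by (simp add: norm_scaleC u)
qed simp

lemma bounded_linear_cinner_right: "bounded_linear (cinner (x::'a::chilbert_space))"
  by (rule bounded_linear_intro[where K="norm x"])
     (auto simp: cinner_add_right scaleR_scaleC cinner_scaleC_right cinner_cauchy_schwarz
       scaleR_conv_of_real mult.commute[of "norm _" "norm x"])

section \<open>Square-summable families\<close>

typedef 'i ell2 = "{f :: 'i \<Rightarrow> complex. (\<lambda>i. (cmod (f i))\<^sup>2) summable_on UNIV}"
  by (rule exI[of _ "\<lambda>_. 0"]) simp

setup_lifting type_definition_ell2

lemma ell2_product_summable:
  fixes f g :: "'i \<Rightarrow> complex"
  assumes "(\<lambda>i. (cmod (f i))\<^sup>2) summable_on A" "(\<lambda>i. (cmod (g i))\<^sup>2) summable_on A"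
  shows "(\<lambda>i. norm (cnj (f i) * g i)) summable_on A"
  using abs_summable_product[of "\<lambda>i. cnj (f i)" A g] assms
  by (simp add: norm_mult power2_eq_square)

lemma ell2_self_infsum:
  fixes f :: "'i \<Rightarrow> complex"
  assumes "(\<lambda>i. (cmod (f i))\<^sup>2) summable_on A"
  shows "(\<Sum>\<^sub>\<infinity>i\<in>A. cnj (f i) * f i) = complex_of_real (\<Sum>\<^sub>\<infinity>i\<in>A. (cmod (f i))\<^sup>2)"
proof -
  have "((\<lambda>i. complex_of_real ((cmod (f i))\<^sup>2)) has_sum
      complex_of_real (\<Sum>\<^sub>\<infinity>i\<in>A. (cmod (f i))\<^sup>2)) A"
    by (intro has_sum_of_real has_sum_infsum assms)
  then show ?thesis
    by (simp only: infsumI cnj_mult_self)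
qed

lemma ell2_infsum_commute:
  "(\<Sum>\<^sub>\<infinity>i\<in>A. cnj (f i) * g i) = cnj (\<Sum>\<^sub>\<infinity>i\<in>A. cnj (g i) * f i)"
proof -
  have "(\<Sum>\<^sub>\<infinity>i\<in>A. cnj (f i) * g i) = (\<Sum>\<^sub>\<infinity>i\<in>A. cnj (cnj (g i) * f i))"
    by (rule infsum_cong) simp
  also have "\<dots> = cnj (\<Sum>\<^sub>\<infinity>i\<in>A. cnj (g i) * f i)"
    by (rule infsum_cnj)
  finally show ?thesis .
qed

lemma ell2_add_summable:
  fixes f g :: "'i \<Rightarrow> complex"
  assumes "(\<lambda>i. (cmod (f i))\<^sup>2) summable_on A" "(\<lambda>i. (cmod (g i))\<^sup>2) summable_on A"
  shows "(\<lambda>i. (cmod (f i + g i))\<^sup>2) summable_on A"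
proof (rule summable_on_comparison_test)
  show "(\<lambda>i. 2 * (cmod (f i))\<^sup>2 + 2 * (cmod (g i))\<^sup>2) summable_on A"
    by (intro summable_on_add summable_on_cmult_right assms)
  show "(cmod (f i + g i))\<^sup>2 \<le> 2 * (cmod (f i))\<^sup>2 + 2 * (cmod (g i))\<^sup>2" for i
  proof -
    have "(cmod (f i + g i))\<^sup>2 \<le> (cmod (f i) + cmod (g i))\<^sup>2"
      by (intro power_mono norm_triangle_ineq) simp
    also have "\<dots> \<le> 2 * (cmod (f i))\<^sup>2 + 2 * (cmod (g i))\<^sup>2"
      using sum_squares_bound[of "cmod (f i)" "cmod (g i)"] by (simp add: power2_sum)
    finally show ?thesis .
  qed
qed simp

instantiation ell2 :: (type) complex_vector
begin

lift_definition zero_ell2 :: "'a ell2" is "\<lambda>_. 0" by simp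
lift_definition plus_ell2 :: "'a ell2 \<Rightarrow> 'a ell2 \<Rightarrow> 'a ell2" is "\<lambda>f g i. f i + g i"
  by (rule ell2_add_summable)
lift_definition uminus_ell2 :: "'a ell2 \<Rightarrow> 'a ell2" is "\<lambda>f i. - f i" by simp
lift_definition minus_ell2 :: "'a ell2 \<Rightarrow> 'a ell2 \<Rightarrow> 'a ell2" is "\<lambda>f g i. f i - g i"
  subgoal for f g using ell2_add_summable[of f UNIV "\<lambda>i. - g i"] by simp
  done
lift_definition scaleC_ell2 :: "complex \<Rightarrow> 'a ell2 \<Rightarrow> 'a ell2" is "\<lambda>c f i. c * f i"
  by (simp add: norm_mult power_mult_distrib summable_on_cmult_right)

instance
  by (standard; transfer) (auto simp: fun_eq_iff algebra_simps)

end

instantiation ell2 :: (type) real_inner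
begin

definition scaleR_ell2 :: "real \<Rightarrow> 'a ell2 \<Rightarrow> 'a ell2"
  where "scaleR_ell2 r x = complex_of_real r *\<^sub>C x"
lift_definition inner_ell2 :: "'a ell2 \<Rightarrow> 'a ell2 \<Rightarrow> real"
  is "\<lambda>f g. Re (\<Sum>\<^sub>\<infinity>i. cnj (f i) * g i)" .
definition norm_ell2 :: "'a ell2 \<Rightarrow> real" where "norm_ell2 x = sqrt (inner x x)"
definition sgn_ell2 :: "'a ell2 \<Rightarrow> 'a ell2" where "sgn_ell2 x = inverse (norm x) *\<^sub>R x"
definition dist_ell2 :: "'a ell2 \<Rightarrow> 'a ell2 \<Rightarrow> real" where "dist_ell2 x y = norm (x - y)"
definition uniformity_ell2 :: "('a ell2 \<times> 'a ell2) filter"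
  where "uniformity_ell2 = (INF e\<in>{0 <..}. principal {(x, y). dist x y < e})"
definition open_ell2 :: "'a ell2 set \<Rightarrow> bool"
  where "open_ell2 U = (\<forall>x\<in>U. \<forall>\<^sub>F (x', y) in uniformity. x' = x \<longrightarrow> y \<in> U)"

instance
proof
  fix a b r :: real and x y z :: "'a ell2" and U :: "'a ell2 set"
  show "a *\<^sub>R (x + y) = a *\<^sub>R x + a *\<^sub>R y" "(a + b) *\<^sub>R x = a *\<^sub>R x + b *\<^sub>R x"
    "a *\<^sub>R b *\<^sub>R x = (a * b) *\<^sub>R x" "1 *\<^sub>R x = x"
    by (simp_all add: scaleR_ell2_def scaleC_add_right scaleC_add_left scaleC_scaleC scaleC_one)
  show "dist x y = norm (x - y)" "sgn x = inverse (norm x) *\<^sub>R x"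
    "norm x = sqrt (inner x x)"
    "uniformity = (INF e\<in>{0 <..}. principal {(x, y::'a ell2). dist x y < e})"
    "open U = (\<forall>x\<in>U. \<forall>\<^sub>F (x', y) in uniformity. x' = x \<longrightarrow> y \<in> U)"
    by (fact dist_ell2_def sgn_ell2_def norm_ell2_def uniformity_ell2_def open_ell2_def)+
  show "inner x y = inner y x"
  proof transfer
    fix f g :: "'a \<Rightarrow> complex"
    show "Re (\<Sum>\<^sub>\<infinity>i. cnj (f i) * g i) = Re (\<Sum>\<^sub>\<infinity>i. cnj (g i) * f i)"
      by (subst ell2_infsum_commute) simp
  qed
  show "inner (x + y) z = inner x z + inner y z"
  proof transfer
    fix f g h :: "'a \<Rightarrow> complex"
    assume "(\<lambda>i. (cmod (f i))\<^sup>2) summable_on UNIV" "(\<lambda>i. (cmod (g i))\<^sup>2) summable_on UNIV"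
      "(\<lambda>i. (cmod (h i))\<^sup>2) summable_on UNIV"
    then have "(\<lambda>i. cnj (f i) * h i) summable_on UNIV" "(\<lambda>i. cnj (g i) * h i) summable_on UNIV"
      by (simp_all only: abs_summable_summable[OF ell2_product_summable])
    then have "(\<Sum>\<^sub>\<infinity>i. cnj (f i) * h i + cnj (g i) * h i)
        = (\<Sum>\<^sub>\<infinity>i. cnj (f i) * h i) + (\<Sum>\<^sub>\<infinity>i. cnj (g i) * h i)"
      by (rule infsum_add)
    then show "Re (\<Sum>\<^sub>\<infinity>i. cnj (f i + g i) * h i)
        = Re (\<Sum>\<^sub>\<infinity>i. cnj (f i) * h i) + Re (\<Sum>\<^sub>\<infinity>i. cnj (g i) * h i)"
      by (simp add: algebra_simps)
  qed
  show "inner (r *\<^sub>R x) y = r * inner x y"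
    unfolding scaleR_ell2_def
  proof transfer
    fix r and f g :: "'a \<Rightarrow> complex"
    have "(\<Sum>\<^sub>\<infinity>i. complex_of_real r * (cnj (f i) * g i)) = complex_of_real r * (\<Sum>\<^sub>\<infinity>i. cnj (f i) * g i)"
      by (rule infsum_cmult_right')
    then show "Re (\<Sum>\<^sub>\<infinity>i. cnj (complex_of_real r * f i) * g i) = r * Re (\<Sum>\<^sub>\<infinity>i. cnj (f i) * g i)"
      by (simp add: mult.assoc)
  qed
  show "0 \<le> inner x x"
    by transfer (simp add: ell2_self_infsum infsum_nonneg)
  show "inner x x = 0 \<longleftrightarrow> x = 0"
  proof transfer
    fix f :: "'a \<Rightarrow> complex"
    assume s: "(\<lambda>i. (cmod (f i))\<^sup>2) summable_on UNIV"
    show "Re (\<Sum>\<^sub>\<infinity>i. cnj (f i) * f i) = 0 \<longleftrightarrow> f = (\<lambda>_. 0)"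
    proof
      assume "Re (\<Sum>\<^sub>\<infinity>i. cnj (f i) * f i) = 0"
      then have "(\<Sum>\<^sub>\<infinity>i. (cmod (f i))\<^sup>2) \<le> 0" by (simp add: ell2_self_infsum s)
      then have "(cmod (f i))\<^sup>2 = 0" for i
        using s by (rule nonneg_infsum_le_0D) auto
      then show "f = (\<lambda>_. 0)" by auto
    qed simp
  qed
qed

end

lemma norm_ell2_power2: "(norm x)\<^sup>2 = (\<Sum>\<^sub>\<infinity>i. (cmod (Rep_ell2 x i))\<^sup>2)"
  unfolding power2_norm_eq_inner[of x] inner_ell2.rep_eq
  using Rep_ell2[of x] by (simp add: ell2_self_infsum)

lemma finite_sum_le_norm_ell2:
  "finite F \<Longrightarrow> (\<Sum>i\<in>F. (cmod (Rep_ell2 x i))\<^sup>2) \<le> (norm x)\<^sup>2"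
  unfolding norm_ell2_power2 by (rule finite_sum_le_infsum) (use Rep_ell2[of x] in auto)

instance ell2 :: (type) complete_space
proof
  fix X :: "nat \<Rightarrow> 'a ell2" assume X: "Cauchy X"
  have "Cauchy (\<lambda>n. Rep_ell2 (X n) i)" for i
  proof (rule metric_CauchyI)
    fix e :: real assume "e > 0"
    with X obtain N where N: "\<And>m n. m \<ge> N \<Longrightarrow> n \<ge> N \<Longrightarrow> dist (X m) (X n) < e"
      unfolding Cauchy_def by blast
    have "dist (Rep_ell2 (X m) i) (Rep_ell2 (X n) i) \<le> dist (X m) (X n)" for m n
      using finite_sum_le_norm_ell2[of "{i}" "X m - X n"]
      by (simp add: dist_norm minus_ell2.rep_eq)
    with N show "\<exists>M. \<forall>m\<ge>M. \<forall>n\<ge>M. dist (Rep_ell2 (X m) i) (Rep_ell2 (X n) i) < e"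
      by (meson le_less_trans)
  qed
  then obtain L where L: "\<And>i. (\<lambda>n. Rep_ell2 (X n) i) \<longlonglongrightarrow> L i"
    unfolding Cauchy_convergent_iff convergent_def by metis
  have bound: "(\<Sum>i\<in>F. (cmod (Rep_ell2 (X m) i - L i))\<^sup>2) \<le> e\<^sup>2"
    if F: "finite F" and N: "\<And>m n. m \<ge> N \<Longrightarrow> n \<ge> N \<Longrightarrow> dist (X m) (X n) < e" and m: "m \<ge> N"
    for F e N m
  proof (rule tendsto_upperbound)
    show "(\<lambda>n. \<Sum>i\<in>F. (cmod (Rep_ell2 (X m) i - Rep_ell2 (X n) i))\<^sup>2)
        \<longlonglongrightarrow> (\<Sum>i\<in>F. (cmod (Rep_ell2 (X m) i - L i))\<^sup>2)"
      by (intro tendsto_intros L)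
    have "(\<Sum>i\<in>F. (cmod (Rep_ell2 (X m) i - Rep_ell2 (X n) i))\<^sup>2) \<le> e\<^sup>2" if "n \<ge> N" for n
    proof -
      have "(\<Sum>i\<in>F. (cmod (Rep_ell2 (X m) i - Rep_ell2 (X n) i))\<^sup>2) \<le> (norm (X m - X n))\<^sup>2"
        using finite_sum_le_norm_ell2[OF F, of "X m - X n"] by (simp add: minus_ell2.rep_eq)
      also have "\<dots> \<le> e\<^sup>2"
        using N[OF m that] by (intro power_mono) (auto simp: dist_norm)
      finally show ?thesis .
    qed
    then show "\<forall>\<^sub>F n in sequentially. (\<Sum>i\<in>F. (cmod (Rep_ell2 (X m) i - Rep_ell2 (X n) i))\<^sup>2) \<le> e\<^sup>2"
      by (auto simp: eventually_sequentially)
  qed simp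
  have diff: "(\<lambda>i. (cmod (Rep_ell2 (X m) i - L i))\<^sup>2) summable_on UNIV"
    if N: "\<And>m n. m \<ge> N \<Longrightarrow> n \<ge> N \<Longrightarrow> dist (X m) (X n) < e" and m: "m \<ge> N" for e N m
    by (rule nonneg_bdd_above_summable_on) (auto intro!: bdd_aboveI2 bound[OF _ N m])
  obtain N1 where N1: "\<And>m n. m \<ge> N1 \<Longrightarrow> n \<ge> N1 \<Longrightarrow> dist (X m) (X n) < 1"
    using X unfolding Cauchy_def by (metis zero_less_one)
  have "(\<lambda>i. (cmod (- (Rep_ell2 (X N1) i - L i)))\<^sup>2) summable_on UNIV"
    using diff[OF N1, of N1] by (simp only: norm_minus_cancel order_refl)
  from ell2_add_summable[OF this, of "Rep_ell2 (X N1)"] Rep_ell2[of "X N1"]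
  have "(\<lambda>i. (cmod (L i))\<^sup>2) summable_on UNIV" by simp
  then have repL: "Rep_ell2 (Abs_ell2 L) = L" by (simp add: Abs_ell2_inverse)
  have "X \<longlonglongrightarrow> Abs_ell2 L"
  proof (rule metric_LIMSEQ_I)
    fix r :: real assume r: "r > 0"
    then obtain N where N: "\<And>m n. m \<ge> N \<Longrightarrow> n \<ge> N \<Longrightarrow> dist (X m) (X n) < r / 2"
      using X unfolding Cauchy_def by (meson half_gt_zero)
    have "dist (X m) (Abs_ell2 L) < r" if m: "m \<ge> N" for m
    proof -
      have "(norm (X m - Abs_ell2 L))\<^sup>2 \<le> (r / 2)\<^sup>2"
        unfolding norm_ell2_power2
        by (rule infsum_le_finite_sums)
           (auto simp: minus_ell2.rep_eq repL intro!: diff[OF N m] bound[OF _ N m])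
      then have "norm (X m - Abs_ell2 L) \<le> r / 2"
        by (rule power2_le_imp_le) (use r in simp)
      then show ?thesis using r by (simp add: dist_norm)
    qed
    then show "\<exists>N. \<forall>n\<ge>N. dist (X n) (Abs_ell2 L) < r" by blast
  qed
  then show "convergent X" by (rule convergentI)
qed

instantiation ell2 :: (type) chilbert_space
begin

lift_definition cinner_ell2 :: "'a ell2 \<Rightarrow> 'a ell2 \<Rightarrow> complex"
  is "\<lambda>f g. \<Sum>\<^sub>\<infinity>i. cnj (f i) * g i" .

instance
proof
  fix r :: real and c :: complex and x y z :: "'a ell2"
  show "r *\<^sub>R x = complex_of_real r *\<^sub>C x" by (fact scaleR_ell2_def)
  show "inner x y = Re (cinner x y)" by transfer simp
  show "cinner x y = cnj (cinner y x)"
    unfolding cinner_ell2.rep_eq by (fact ell2_infsum_commute)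
  show "cinner x (y + z) = cinner x y + cinner x z"
  proof transfer
    fix f g h :: "'a \<Rightarrow> complex"
    assume "(\<lambda>i. (cmod (f i))\<^sup>2) summable_on UNIV" "(\<lambda>i. (cmod (g i))\<^sup>2) summable_on UNIV"
      "(\<lambda>i. (cmod (h i))\<^sup>2) summable_on UNIV"
    then have "(\<lambda>i. cnj (f i) * g i) summable_on UNIV" "(\<lambda>i. cnj (f i) * h i) summable_on UNIV"
      by (simp_all only: abs_summable_summable[OF ell2_product_summable])
    from infsum_add[OF this] show "(\<Sum>\<^sub>\<infinity>i. cnj (f i) * (g i + h i))
        = (\<Sum>\<^sub>\<infinity>i. cnj (f i) * g i) + (\<Sum>\<^sub>\<infinity>i. cnj (f i) * h i)"
      by (simp add: algebra_simps)
  qed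
  show "cinner x (c *\<^sub>C y) = c * cinner x y"
  proof -
    have "cinner x (c *\<^sub>C y) = (\<Sum>\<^sub>\<infinity>i. c * (cnj (Rep_ell2 x i) * Rep_ell2 y i))"
      unfolding cinner_ell2.rep_eq scaleC_ell2.rep_eq by (rule infsum_cong) simp
    also have "\<dots> = c * cinner x y"
      unfolding cinner_ell2.rep_eq by (rule infsum_cmult_right')
    finally show ?thesis .
  qed
qed

end

section \<open>Orthonormal bases\<close>

definition orthonormal :: "'a::chilbert_space set \<Rightarrow> bool" where
  "orthonormal E \<longleftrightarrow> (\<forall>e\<in>E. \<forall>f\<in>E. cinner e f = (if e = f then 1 else 0))"

lemma maximal_orthonormal_exists:
  obtains E :: "'a::chilbert_space set"
  where "orthonormal E" "\<And>x. (\<And>e. e \<in> E \<Longrightarrow> cinner e x = 0) \<Longrightarrow> x = 0"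
proof -
  have "\<exists>M\<in>{E::'a set. orthonormal E}. \<forall>X\<in>{E. orthonormal E}. M \<subseteq> X \<longrightarrow> X = M"
  proof (rule Zorn_Lemma2, rule ballI)
    fix C :: "'a set set" assume C: "C \<in> chains {E. orthonormal E}"
    have "orthonormal (\<Union>C)"
      unfolding orthonormal_def
    proof (intro ballI)
      fix e f assume "e \<in> \<Union>C" "f \<in> \<Union>C"
      then obtain X Y where XY: "X \<in> C" "e \<in> X" "Y \<in> C" "f \<in> Y" by blast
      then have "X \<subseteq> Y \<or> Y \<subseteq> X" using C by (auto simp: chains_def chain_subset_def)
      then obtain Z where "Z \<in> C" "e \<in> Z" "f \<in> Z" using XY by blast
      moreover from this have "orthonormal Z" using C by (auto simp: chains_def)
      ultimately show "cinner e f = (if e = f then 1 else 0)" by (simp add: orthonormal_def)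
    qed
    then show "\<exists>U\<in>{E. orthonormal E}. \<forall>X\<in>C. X \<subseteq> U" by blast
  qed
  then obtain E :: "'a set" where E: "orthonormal E"
    and max: "\<And>X. orthonormal X \<Longrightarrow> E \<subseteq> X \<Longrightarrow> X = E" by blast
  have "x = 0" if x: "\<And>e. e \<in> E \<Longrightarrow> cinner e x = 0" for x
  proof (rule ccontr)
    assume "x \<noteq> 0"
    define u where "u = complex_of_real (1 / norm x) *\<^sub>C x"
    have uu: "cinner u u = 1"
      using \<open>x \<noteq> 0\<close>
      by (simp only: cinner_self) (simp add: u_def norm_scaleC norm_divide)
    have eu: "cinner e u = 0" if "e \<in> E" for e
      using x[OF that] by (simp add: u_def cinner_scaleC_right)
    have ue: "cinner u e = 0" if "e \<in> E" for e
      using eu[OF that] by (subst cinner_commute) simp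
    have "u \<notin> E" using eu uu by fastforce
    moreover have "orthonormal (insert u E)"
      using E uu eu ue \<open>u \<notin> E\<close> by (auto simp: orthonormal_def)
    ultimately show False using max[of "insert u E"] by blast
  qed
  with E show ?thesis by (rule that)
qed

lemma norm_orthonormal_sum:
  assumes "orthonormal E" "finite F" "F \<subseteq> E"
  shows "(norm (\<Sum>e\<in>F. c e *\<^sub>C e))\<^sup>2 = (\<Sum>e\<in>F. (cmod (c e))\<^sup>2)"
proof -
  have "complex_of_real ((norm (\<Sum>e\<in>F. c e *\<^sub>C e))\<^sup>2)
      = (\<Sum>e\<in>F. \<Sum>f\<in>F. cnj (c e) * c f * cinner e f)"
    unfolding cinner_self[symmetric] cinner_sum_left
    by (simp add: cinner_sum_right cinner_scaleC_left cinner_scaleC_right mult.assoc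
        mult.left_commute sum_distrib_left)
  also have "\<dots> = (\<Sum>e\<in>F. \<Sum>f\<in>F. if e = f then cnj (c e) * c e else 0)"
    using assms by (intro sum.cong refl) (auto simp: orthonormal_def subset_eq)
  also have "\<dots> = complex_of_real (\<Sum>e\<in>F. (cmod (c e))\<^sup>2)"
    using assms(2) by (simp add: cnj_mult_self)
  finally show ?thesis by (simp only: of_real_eq_iff)
qed

lemma bessel:
  assumes "orthonormal E" "finite F" "F \<subseteq> E"
  shows "(\<Sum>e\<in>F. (cmod (cinner e x))\<^sup>2) \<le> (norm x)\<^sup>2"
proof -
  define p where "p = (\<Sum>e\<in>F. cinner e x *\<^sub>C e)"
  have "cinner p x = complex_of_real (\<Sum>e\<in>F. (cmod (cinner e x))\<^sup>2)"
    by (simp add: p_def cinner_sum_left cinner_scaleC_left cnj_mult_self)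
  then have "inner p x = (norm p)\<^sup>2"
    using norm_orthonormal_sum[OF assms, of "\<lambda>e. cinner e x"] by (simp add: inner_eq_Re_cinner p_def)
  then have "(norm p)\<^sup>2 \<le> norm p * norm x"
    using norm_cauchy_schwarz[of p x] by simp
  then have "norm p \<le> norm x"
    by (cases "norm p = 0") (auto simp: power2_eq_square)
  then have "(norm p)\<^sup>2 \<le> (norm x)\<^sup>2" by (intro power_mono) auto
  then show ?thesis
    using norm_orthonormal_sum[OF assms, of "\<lambda>e. cinner e x"] by (simp add: p_def)
qed

lemma orthonormal_expansion:
  fixes x :: "'a::chilbert_space"
  assumes E: "orthonormal E" and max: "\<And>x. (\<And>e. e \<in> E \<Longrightarrow> cinner e x = 0) \<Longrightarrow> x = 0"
  shows "((\<lambda>e. cinner e x *\<^sub>C e) has_sum x) E"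
proof -
  let ?f = "\<lambda>e. cinner e x *\<^sub>C e" and ?a = "\<lambda>e. (cmod (cinner e x))\<^sup>2"
  have summ: "?a summable_on E"
    by (rule nonneg_bdd_above_summable_on) (auto intro!: bdd_aboveI2 bessel[OF E])
  define L where "L = (\<Sum>\<^sub>\<infinity>e\<in>E. ?a e)"
  have lim: "(sum ?a \<longlongrightarrow> L) (finite_subsets_at_top E)"
    using has_sum_infsum[OF summ] by (simp add: has_sum_def L_def)
  have "\<exists>P. eventually P (finite_subsets_at_top E) \<and>
          (\<forall>F1 F2. P F1 \<and> P F2 \<longrightarrow> dist (sum ?f F1) (sum ?f F2) < e)" if "e > 0" for e
  proof -
    define P where "P F \<longleftrightarrow> finite F \<and> F \<subseteq> E \<and> L - (e / 2)\<^sup>2 < sum ?a F" for F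
    have "eventually (\<lambda>F. L - (e / 2)\<^sup>2 < sum ?a F) (finite_subsets_at_top E)"
      by (rule order_tendstoD(1)[OF lim]) (use that in simp)
    then have "eventually P (finite_subsets_at_top E)"
      unfolding P_def[abs_def]
      by (intro eventually_conj) (auto intro: eventually_finite_subsets_at_top_weakI)
    moreover have "dist (sum ?f F1) (sum ?f F2) < e" if "P F1" "P F2" for F1 F2
    proof -
      have *: "dist (sum ?f (F1 \<union> F2)) (sum ?f G) < e / 2" if "G = F1 \<or> G = F2" for G
      proof -
        have G: "P G" "G \<subseteq> F1 \<union> F2" using that \<open>P F1\<close> \<open>P F2\<close> by auto
        have fin: "finite (F1 \<union> F2)" "F1 \<union> F2 \<subseteq> E" using \<open>P F1\<close> \<open>P F2\<close> by (auto simp: P_def)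
        have "(norm (sum ?f (F1 \<union> F2) - sum ?f G))\<^sup>2 = (norm (sum ?f (F1 \<union> F2 - G)))\<^sup>2"
          using fin G by (simp add: sum_diff)
        also have "\<dots> = sum ?a (F1 \<union> F2 - G)"
          using fin by (intro norm_orthonormal_sum[OF E]) auto
        also have "\<dots> = sum ?a (F1 \<union> F2) - sum ?a G"
          using fin G by (simp add: sum_diff)
        also have "\<dots> < (e / 2)\<^sup>2"
        proof -
          have "sum ?a (F1 \<union> F2) \<le> L"
            unfolding L_def by (rule finite_sum_le_infsum[OF summ]) (use fin in auto)
          then show ?thesis using G(1) by (simp add: P_def)
        qed
        finally show ?thesis
          unfolding dist_norm by (rule power2_less_imp_less) (use \<open>e > 0\<close> in simp)
      qed
      show ?thesis
        using *[of F1] *[of F2] dist_triangle3[of "sum ?f F1" "sum ?f F2" "sum ?f (F1 \<union> F2)"]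
        by simp
    qed
    ultimately show ?thesis by blast
  qed
  then have "cauchy_filter (filtermap (sum ?f) (finite_subsets_at_top E))"
    by (simp add: cauchy_filter_metric_filtermap)
  moreover have "complete (UNIV :: 'a set)"
    by (meson Cauchy_convergent UNIV_I complete_def convergent_def)
  ultimately obtain p where "(sum ?f \<longlongrightarrow> p) (finite_subsets_at_top E)"
    using complete_uniform[where S=UNIV] by (force simp add: filterlim_def)
  then have p: "(?f has_sum p) E" by (simp add: has_sum_def)
  have "cinner e p = cinner e x" if e: "e \<in> E" for e
  proof -
    have "((\<lambda>e'. cinner e (?f e')) has_sum cinner e p) E"
      by (rule has_sum_bounded_linear[OF bounded_linear_cinner_right p])
    moreover have "((\<lambda>e'. cinner e (?f e')) has_sum cinner e x) E"
    proof (rule has_sum_finite_neutralI[of "{e}"])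
      show "cinner e (?f e') = 0" if "e' \<in> E - {e}" for e'
        using that e E by (auto simp: orthonormal_def cinner_scaleC_right)
    qed (use e E in \<open>auto simp: orthonormal_def cinner_scaleC_right\<close>)
    ultimately show ?thesis by (rule has_sum_unique)
  qed
  then have "x - p = 0" by (intro max) (simp add: cinner_diff_right)
  then show ?thesis using p by simp
qed

lemma parseval:
  fixes x y :: "'a::chilbert_space"
  assumes "orthonormal E" and "\<And>x. (\<And>e. e \<in> E \<Longrightarrow> cinner e x = 0) \<Longrightarrow> x = (0::'a)"
  shows "((\<lambda>e. cnj (cinner e x) * cinner e y) has_sum cinner x y) E"
proof -
  have "((\<lambda>e. cinner x (cinner e y *\<^sub>C e)) has_sum cinner x y) E"
    by (rule has_sum_bounded_linear[OF bounded_linear_cinner_right orthonormal_expansion[OF assms]])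
  moreover have "cinner x (cinner e y *\<^sub>C e) = cnj (cinner e x) * cinner e y" for e
    by (simp add: cinner_scaleC_right cinner_commute[of x e] mult.commute)
  ultimately show ?thesis by simp
qed

section \<open>Hilbert space tensor products\<close>

lemma has_sum_product:
  fixes a :: "'i \<Rightarrow> complex" and b :: "'j \<Rightarrow> complex"
  assumes a: "(\<lambda>i. norm (a i)) summable_on I" "(a has_sum s) I"
    and b: "(\<lambda>j. norm (b j)) summable_on J" "(b has_sum t) J"
  shows "((\<lambda>(i, j). a i * b j) has_sum s * t) (I \<times> J)"
proof (rule has_sum_SigmaI)
  show "((\<lambda>j. case (i, j) of (i, j) \<Rightarrow> a i * b j) has_sum a i * t) J" for i
    using has_sum_cmult_right[OF b(2)] by simp
  show "((\<lambda>i. a i * t) has_sum s * t) I"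
    by (rule has_sum_cmult_left[OF a(2)])
  have "(\<lambda>x. norm (case x of (i, j) \<Rightarrow> a i * b j)) summable_on I \<times> J"
    unfolding Infinite_Sum.abs_summable_on_Sigma_iff
    using a(1) b(1)
    by (auto simp: norm_mult infsum_cmult_right' abs_mult infsum_nonneg
        intro!: summable_on_cmult_right summable_on_cmult_left)
  then show "(\<lambda>(i, j). a i * b j) summable_on I \<times> J"
    by (rule abs_summable_summable)
qed

lemma tensor_exists:
  "\<exists>t :: 'h::chilbert_space \<Rightarrow> 'k::chilbert_space \<Rightarrow> ('h \<times> 'k) ell2.
     \<forall>x y x' y'. cinner (t x y) (t x' y') = cinner x x' * cinner y y'"
proof -
  obtain E :: "'h set" where E: "orthonormal E"
    "\<And>x. (\<And>e. e \<in> E \<Longrightarrow> cinner e x = 0) \<Longrightarrow> x = 0"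
    using maximal_orthonormal_exists by blast
  obtain F :: "'k set" where F: "orthonormal F"
    "\<And>x. (\<And>e. e \<in> F \<Longrightarrow> cinner e x = 0) \<Longrightarrow> x = 0"
    using maximal_orthonormal_exists by blast
  define c :: "'h \<Rightarrow> 'k \<Rightarrow> 'h \<times> 'k \<Rightarrow> complex" where
    "c x y = (\<lambda>(e, f). if e \<in> E \<and> f \<in> F then cinner e x * cinner f y else 0)" for x y
  have sq: "(\<lambda>e. (cmod (cinner e x))\<^sup>2) summable_on G"
    if "orthonormal G" for G and x :: "'x::chilbert_space"
    by (rule nonneg_bdd_above_summable_on) (auto intro!: bdd_aboveI2 bessel[OF that])
  have sumc: "((\<lambda>z. cnj (c x y z) * c x' y' z) has_sum cinner x x' * cinner y y') UNIV"
    for x y x' y'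
  proof -
    have "((\<lambda>(e, f). (cnj (cinner e x) * cinner e x') * (cnj (cinner f y) * cinner f y'))
        has_sum cinner x x' * cinner y y') (E \<times> F)"
      by (intro has_sum_product ell2_product_summable sq parseval E F)
    then show ?thesis
      by (rule has_sum_cong_neutral[THEN iffD1, rotated -1]) (auto simp: c_def split: if_splits)
  qed
  have sumc2: "(\<lambda>z. (cmod (c x y z))\<^sup>2) summable_on UNIV" for x y
  proof -
    have "(\<lambda>z. complex_of_real ((cmod (c x y z))\<^sup>2)) summable_on UNIV"
      using sumc[of x y x y] unfolding cnj_mult_self by (rule has_sum_imp_summable)
    from summable_on_bounded_linear[OF bounded_linear_Re this] show ?thesis by simp
  qed
  have "cinner (Abs_ell2 (c x y)) (Abs_ell2 (c x' y')) = cinner x x' * cinner y y'" for x y x' y'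
    using infsumI[OF sumc[of x y x' y']] by (simp add: cinner_ell2.rep_eq Abs_ell2_inverse sumc2)
  then show ?thesis by (intro exI[of _ "\<lambda>x y. Abs_ell2 (c x y)"]) simp
qed

text \<open>Elementary tensors: any map with the inner product identity of the next definition is bilinear, and two such
  maps differ by a unitary between the closed linear spans of their ranges, so the choice made
  below is immaterial.\<close>

definition tensor :: "'h::chilbert_space \<Rightarrow> 'k::chilbert_space \<Rightarrow> ('h \<times> 'k) ell2"
    (infixr \<open>\<otimes>\<^sub>H\<close> 70) where
  "tensor = (SOME t. \<forall>x y x' y'. cinner (t x y) (t x' y') = cinner x x' * cinner y y')"

lemma cinner_tensor: "cinner (x \<otimes>\<^sub>H y) (x' \<otimes>\<^sub>H y') = cinner x x' * cinner y y'"
  using someI_ex[OF tensor_exists] unfolding tensor_def by blast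

text \<open>Throughout, a Hilbert space is a closed linear subspace of a type of class
  \<^class>\<open>chilbert_space\<close>; the whole type (\<^const>\<open>UNIV\<close>) is the main example. This makes it possible
  to quantify over Hilbert spaces inside a formula.\<close>

definition hilbert_space :: "'h::chilbert_space set \<Rightarrow> bool" where
  "hilbert_space H \<longleftrightarrow> cvec.subspace H \<and> closed H"

definition hilbert_tensor ::
    "'h::chilbert_space set \<Rightarrow> 'k::chilbert_space set \<Rightarrow> ('h \<times> 'k) ell2 set" where
  "hilbert_tensor H K = closure (cvec.span {x \<otimes>\<^sub>H y | x y. x \<in> H \<and> y \<in> K})"

section \<open>Bounded operators and the weak* topology\<close>

definition clinear_on :: "'x::complex_vector set \<Rightarrow> ('x \<Rightarrow> 'y::complex_vector) \<Rightarrow> bool" where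
  "clinear_on S f \<longleftrightarrow>
     (\<forall>x\<in>S. \<forall>y\<in>S. f (x + y) = f x + f y) \<and> (\<forall>c. \<forall>x\<in>S. f (c *\<^sub>C x) = c *\<^sub>C f x)"

text \<open>The bounded operators from \<open>H\<close> to \<open>K\<close>, represented by functions that are 0 outside \<open>H\<close>, so
  that operators are equal iff they are equal as functions. Sums and scalar multiples are
  pointwise, and composition is \<^const>\<open>comp\<close>.\<close>

definition bounded_ops ::
    "'h::chilbert_space set \<Rightarrow> 'k::chilbert_space set \<Rightarrow> ('h \<Rightarrow> 'k) set" where
  "bounded_ops H K = {T. T ` H \<subseteq> K \<and> clinear_on H T \<and>
     (\<exists>M. \<forall>x\<in>H. norm (T x) \<le> M * norm x) \<and> (\<forall>x. x \<notin> H \<longrightarrow> T x = 0)}"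

definition id_op :: "'h::chilbert_space set \<Rightarrow> 'h \<Rightarrow> 'h" where
  "id_op H = (\<lambda>x. if x \<in> H then x else 0)"

text \<open>The weak* (ultraweak) topology that \<open>B(H,K)\<close> carries as the dual of the trace class operators:
  every weak* continuous functional has the form \<open>T \<mapsto> \<Sum>n. \<langle>\<eta> n, T (\<xi> n)\<rangle>\<close> with
  square-summable sequences \<open>\<xi>\<close> and \<open>\<eta>\<close>, and the topology is the coarsest one that makes
  these continuous.\<close>

definition square_summable_in :: "'h::chilbert_space set \<Rightarrow> (nat \<Rightarrow> 'h) \<Rightarrow> bool" where
  "square_summable_in H \<xi> \<longleftrightarrow> range \<xi> \<subseteq> H \<and> summable (\<lambda>n. (norm (\<xi> n))\<^sup>2)"

definition weak_star ::
    "'h::chilbert_space set \<Rightarrow> 'k::chilbert_space set \<Rightarrow> ('h \<Rightarrow> 'k) topology" where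
  "weak_star H K = topology_generated_by
     {{T \<in> bounded_ops H K. (\<Sum>n. cinner (\<eta> n) (T (\<xi> n))) \<in> G} | \<xi> \<eta> G.
        square_summable_in H \<xi> \<and> square_summable_in K \<eta> \<and> open G}"

definition weak_star_closed_subspace ::
    "'h::chilbert_space set \<Rightarrow> 'k::chilbert_space set \<Rightarrow> ('h \<Rightarrow> 'k) set \<Rightarrow> bool" where
  "weak_star_closed_subspace H K V \<longleftrightarrow> cvec.subspace V \<and> closedin (weak_star H K) V"

definition weak_star_closed_unital_algebra ::
    "'h::chilbert_space set \<Rightarrow> ('h \<Rightarrow> 'h) set \<Rightarrow> bool" where
  "weak_star_closed_unital_algebra H \<A> \<longleftrightarrow> weak_star_closed_subspace H H \<A> \<and>
     (\<forall>S\<in>\<A>. \<forall>T\<in>\<A>. S \<circ> T \<in> \<A>) \<and> id_op H \<in> \<A>"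

section \<open>Spatial embedding and spatial Morita equivalence\<close>

definition product_span ::
    "'h::chilbert_space set \<Rightarrow> 'k::chilbert_space set \<Rightarrow> ('l \<Rightarrow> 'k) set \<Rightarrow> ('h \<Rightarrow> 'l) set \<Rightarrow> ('h \<Rightarrow> 'k) set"
  where
  "product_span H K \<X> \<Y> = weak_star H K closure_of
     {(\<Sum>i<k. X i \<circ> Y i) | (k::nat) X Y. (\<forall>i<k. X i \<in> \<X> \<and> Y i \<in> \<Y>)}"

text \<open>\<open>bimodule H K \<B> \<A> \<X>\<close>: \<open>\<X> \<subseteq> B(H,K)\<close> is a \<open>\<B>,\<A>\<close>-bimodule, where
  \<open>\<A>\<close> acts on \<open>H\<close> and \<open>\<B>\<close> acts on \<open>K\<close>.\<close>

definition bimodule ::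
    "'h::chilbert_space set \<Rightarrow> 'k::chilbert_space set \<Rightarrow> ('k \<Rightarrow> 'k) set \<Rightarrow> ('h \<Rightarrow> 'h) set \<Rightarrow>
      ('h \<Rightarrow> 'k) set \<Rightarrow> bool" where
  "bimodule H K \<B> \<A> \<X> \<longleftrightarrow> \<X> \<subseteq> bounded_ops H K \<and> cvec.subspace \<X> \<and>
     (\<forall>B\<in>\<B>. \<forall>X\<in>\<X>. \<forall>A\<in>\<A>. B \<circ> X \<circ> A \<in> \<X>)"

definition spatially_embedded ::
    "'h::chilbert_space set \<Rightarrow> ('h \<Rightarrow> 'h) set \<Rightarrow> 'k::chilbert_space set \<Rightarrow> ('k \<Rightarrow> 'k) set \<Rightarrow> bool"
  where
  "spatially_embedded H\<^sub>1 \<A> H\<^sub>2 \<B> \<longleftrightarrow>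
     (\<exists>\<X> \<Y>. bimodule H\<^sub>1 H\<^sub>2 \<B> \<A> \<X> \<and> bimodule H\<^sub>2 H\<^sub>1 \<A> \<B> \<Y> \<and>
       product_span H\<^sub>2 H\<^sub>2 \<X> \<Y> \<subseteq> \<B> \<and> product_span H\<^sub>1 H\<^sub>1 \<Y> \<X> = \<A>)"

definition spatially_Morita_equivalent ::
    "'h::chilbert_space set \<Rightarrow> ('h \<Rightarrow> 'h) set \<Rightarrow> 'k::chilbert_space set \<Rightarrow> ('k \<Rightarrow> 'k) set \<Rightarrow> bool"
  where
  "spatially_Morita_equivalent H\<^sub>1 \<A> H\<^sub>2 \<B> \<longleftrightarrow>
     (\<exists>\<X> \<Y>. bimodule H\<^sub>1 H\<^sub>2 \<B> \<A> \<X> \<and> bimodule H\<^sub>2 H\<^sub>1 \<A> \<B> \<Y> \<and>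
       product_span H\<^sub>2 H\<^sub>2 \<X> \<Y> = \<B> \<and> product_span H\<^sub>1 H\<^sub>1 \<Y> \<X> = \<A>)"

section \<open>Slice maps and property $S_\sigma$\<close>

definition op_tensor ::
    "'h::chilbert_space set \<Rightarrow> 'k::chilbert_space set \<Rightarrow> 'h'::chilbert_space set \<Rightarrow> 'k'::chilbert_space set \<Rightarrow>
      ('h \<Rightarrow> 'h') \<Rightarrow> ('k \<Rightarrow> 'k') \<Rightarrow> ('h \<times> 'k) ell2 \<Rightarrow> ('h' \<times> 'k') ell2" where
  "op_tensor H K H' K' S T =
     (THE R. R \<in> bounded_ops (hilbert_tensor H K) (hilbert_tensor H' K') \<and>
        (\<forall>x\<in>H. \<forall>y\<in>K. R (x \<otimes>\<^sub>H y) = S x \<otimes>\<^sub>H T y))"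

definition weak_star_tensor ::
    "'h::chilbert_space set \<Rightarrow> 'k::chilbert_space set \<Rightarrow> 'k set \<Rightarrow> ('h \<Rightarrow> 'h) set \<Rightarrow> ('k \<Rightarrow> 'k) set \<Rightarrow>
      (('h \<times> 'k) ell2 \<Rightarrow> ('h \<times> 'k) ell2) set" where
  "weak_star_tensor H K\<^sub>1 K\<^sub>2 \<V> \<U> =
     weak_star (hilbert_tensor H K\<^sub>1) (hilbert_tensor H K\<^sub>2) closure_of
       cvec.span {op_tensor H K\<^sub>1 H K\<^sub>2 S T | S T. S \<in> \<V> \<and> T \<in> \<U>}"

definition predual :: "'h::chilbert_space set \<Rightarrow> ('h \<Rightarrow> 'h) set \<Rightarrow> (('h \<Rightarrow> 'h) \<Rightarrow> complex) set" where
  "predual H \<V> = {\<omega>. clinear_on \<V> \<omega> \<and>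
     continuous_map (subtopology (weak_star H H) \<V>) euclidean \<omega>}"

text \<open>\<open>slice_map H K\<^sub>1 K\<^sub>2 \<V> \<omega>\<close> is the right slice map \<open>R\<^sub>\<omega>\<close>. It is determined
  uniquely on its domain \<open>\<V> \<otimes> B(K\<^sub>1,K\<^sub>2)\<close>, and only its values there are used.\<close>

definition slice_map ::
    "'h::chilbert_space set \<Rightarrow> 'k::chilbert_space set \<Rightarrow> 'k set \<Rightarrow> ('h \<Rightarrow> 'h) set \<Rightarrow>
      (('h \<Rightarrow> 'h) \<Rightarrow> complex) \<Rightarrow> (('h \<times> 'k) ell2 \<Rightarrow> ('h \<times> 'k) ell2) \<Rightarrow> 'k \<Rightarrow> 'k" where
  "slice_map H K\<^sub>1 K\<^sub>2 \<V> \<omega> =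
     (let D = weak_star_tensor H K\<^sub>1 K\<^sub>2 \<V> (bounded_ops K\<^sub>1 K\<^sub>2) in
      SOME R. clinear_on D R \<and>
        continuous_map
          (subtopology (weak_star (hilbert_tensor H K\<^sub>1) (hilbert_tensor H K\<^sub>2)) D)
          (weak_star K\<^sub>1 K\<^sub>2) R \<and>
        (\<forall>A\<in>\<V>. \<forall>B\<in>bounded_ops K\<^sub>1 K\<^sub>2. R (op_tensor H K\<^sub>1 H K\<^sub>2 A B) = \<omega> A *\<^sub>C B))"

definition fubini_product ::
    "'h::chilbert_space set \<Rightarrow> 'k::chilbert_space set \<Rightarrow> 'k set \<Rightarrow> ('h \<Rightarrow> 'h) set \<Rightarrow> ('k \<Rightarrow> 'k) set \<Rightarrow>
      (('h \<times> 'k) ell2 \<Rightarrow> ('h \<times> 'k) ell2) set" where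
  "fubini_product H K\<^sub>1 K\<^sub>2 \<V> \<U> =
     {T \<in> weak_star_tensor H K\<^sub>1 K\<^sub>2 \<V> (bounded_ops K\<^sub>1 K\<^sub>2).
        \<forall>\<omega>\<in>predual H \<V>. slice_map H K\<^sub>1 K\<^sub>2 \<V> \<omega> T \<in> \<U>}"

text \<open>HOL cannot quantify over all types inside a formula, so the property is relative to a type
  \<open>'k\<close>: the Hilbert spaces \<open>K\<^sub>1\<close>, \<open>K\<^sub>2\<close> range over all closed subspaces of \<open>'k\<close>. As
  \<open>'k\<close> varies over all types of class \<^class>\<open>chilbert_space\<close> (for instance the types
  \<^typ>\<open>'i ell2\<close>), every pair of Hilbert spaces occurs up to unitary equivalence.\<close>

definition property_S_sigma ::
    "'k::chilbert_space itself \<Rightarrow> 'h::chilbert_space set \<Rightarrow> ('h \<Rightarrow> 'h) set \<Rightarrow> bool" where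
  "property_S_sigma TYPE_k H \<V> \<longleftrightarrow>
     (\<forall>(K\<^sub>1 :: 'k set) (K\<^sub>2 :: 'k set) \<U>.
        hilbert_space K\<^sub>1 \<longrightarrow> hilbert_space K\<^sub>2 \<longrightarrow> weak_star_closed_subspace K\<^sub>1 K\<^sub>2 \<U> \<longrightarrow>
        fubini_product H K\<^sub>1 K\<^sub>2 \<V> \<U> = weak_star_tensor H K\<^sub>1 K\<^sub>2 \<V> \<U>)"

end

theory Submission
  imports Defs
begin

text \<open>
  Let \<open>\<X>\<close> and \<open>\<Y>\<close> implement a spatial embedding of \<open>\<A>\<close> in \<open>\<B>\<close>, and let \<open>T\<close> be in the Fubini product
  \<open>F(\<A>,\<U>)\<close>. For \<open>X \<in> \<X>\<close> and \<open>Y \<in> \<Y>\<close> put \<open>M = (X \<otimes> 1) T (Y \<otimes> 1)\<close>. As \<open>X \<A> Y \<subseteq> \<B>\<close>, this is an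
  element of \<open>\<B> \<otimes> B(K\<^sub>1,K\<^sub>2)\<close>, and its slice by \<open>\<omega>\<close> is the slice of \<open>T\<close> by \<open>A \<mapsto> \<omega> (X A Y)\<close>
  (\<open>slice_op_sandwich\<close>). So all slices of \<open>M\<close> are in \<open>\<U>\<close>, and \<open>M \<in> F(\<B>,\<U>) = \<B> \<otimes> \<U>\<close> by the property
  \<open>S\<^sub>\<sigma>\<close> of \<open>\<B>\<close>. Since \<open>Y' \<B> X' \<subseteq> \<A>\<close> for \<open>Y' \<in> \<Y>\<close> and \<open>X' \<in> \<X>\<close>, it follows that
  \<open>(Y' X \<otimes> 1) T (Y X' \<otimes> 1) \<in> \<A> \<otimes> \<U>\<close> (\<open>weak_star_tensor_sandwich\<close>). Now \<open>\<A>\<close> is the weak* closed span of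
  the products \<open>Y X\<close> and contains the identity, and \<open>\<A> \<otimes> \<U>\<close> is a weak* closed subspace. Hence first
  \<open>Y' X\<close> and then \<open>Y X'\<close> may be replaced by the identity, which shows \<open>T \<in> \<A> \<otimes> \<U>\<close>. The reverse
  inclusion \<open>\<A> \<otimes> \<U> \<subseteq> F(\<A>,\<U>)\<close> always holds (\<open>weak_star_tensor_subset_fubini_product\<close>). Spatially
  Morita equivalent algebras are embedded in each other, so the second part follows from the first.

  The argument rests on the weak* continuity of three maps: \<open>T \<mapsto> P T Q\<close>, the amplification
  \<open>A \<mapsto> A \<otimes> 1\<close> and the slice maps (\<open>continuous_map_sandwich\<close>, \<open>continuous_map_amplification\<close>,
  \<open>continuous_map_slice_op\<close>). In each case a functional \<open>\<Sum>j. \<langle>b j, S (a j)\<rangle>\<close> of the image \<open>S\<close> is rewritten as a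
  functional of the same form of the argument, with square-summable families over another index set.
  Such functionals are weak* continuous for every index set (\<open>continuous_map_vec_functional\<close>), and every weak*
  continuous functional on a subspace is of this form (\<open>predual_representation\<close>), so that slice maps are given
  by an explicit formula (\<open>slice_map_eq_slice_op\<close>).
\<close>

section \<open>Linear maps on subspaces\<close>

lemma clinear_on_add: "clinear_on S f \<Longrightarrow> x \<in> S \<Longrightarrow> y \<in> S \<Longrightarrow> f (x + y) = f x + f y"
  and clinear_on_scale: "clinear_on S f \<Longrightarrow> x \<in> S \<Longrightarrow> f (c *\<^sub>C x) = c *\<^sub>C f x"
  by (simp_all add: clinear_on_def)

lemma clinear_on_zero: "clinear_on S f \<Longrightarrow> 0 \<in> S \<Longrightarrow> f 0 = 0"
  using clinear_on_scale[of S f 0 0] by simp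

lemma clinear_on_diff:
  assumes "cvec.subspace S" "clinear_on S f" "x \<in> S" "y \<in> S"
  shows "f (x - y) = f x - f y"
  using clinear_on_add[OF assms(2) cvec.subspace_diff[OF assms(1,3,4)] assms(4)] by simp

lemma clinear_on_sum:
  assumes "cvec.subspace S" "clinear_on S f" "\<And>i. i \<in> I \<Longrightarrow> g i \<in> S"
  shows "f (\<Sum>i\<in>I. g i) = (\<Sum>i\<in>I. f (g i))"
  using assms(3)
proof (induction I rule: infinite_finite_induct)
  case (insert i I)
  then show ?case
    by (simp add: clinear_on_add[OF assms(2)] cvec.subspace_sum[OF assms(1)])
qed (simp_all add: clinear_on_zero[OF assms(2)] cvec.subspace_0[OF assms(1)])

lemma scaleC_fun_apply: "(c *\<^sub>C f) x = c *\<^sub>C f x"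
  by (simp add: scaleC_fun_def)

lemma bounded_linear_scaleC: "bounded_linear (\<lambda>x. c *\<^sub>C (x :: 'a::chilbert_space))"
  by (rule bounded_linear_intro[where K="cmod c"])
     (auto simp: scaleC_add_right scaleR_scaleC scaleC_scaleC norm_scaleC mult.commute)

lemma subspace_closure:
  fixes S :: "'a::chilbert_space set"
  assumes "cvec.subspace S"
  shows "cvec.subspace (closure S)"
proof (rule cvec.subspaceI)
  show "0 \<in> closure S" using cvec.subspace_0[OF assms] closure_subset by blast
next
  fix x y assume "x \<in> closure S" "y \<in> closure S"
  then obtain f g where "\<And>n. f n \<in> S" "f \<longlonglongrightarrow> x" "\<And>n. g n \<in> S" "g \<longlonglongrightarrow> y"
    unfolding closure_sequential by metis
  then have "\<forall>n. f n + g n \<in> S" "(\<lambda>n. f n + g n) \<longlonglongrightarrow> x + y"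
    by (auto intro: cvec.subspace_add[OF assms] tendsto_add)
  then show "x + y \<in> closure S"
    unfolding closure_sequential by (intro exI[of _ "\<lambda>n. f n + g n"] conjI)
next
  fix c x assume "x \<in> closure S"
  then obtain f where "\<And>n. f n \<in> S" "f \<longlonglongrightarrow> x"
    unfolding closure_sequential by metis
  then have "\<forall>n. c *\<^sub>C f n \<in> S" "(\<lambda>n. c *\<^sub>C f n) \<longlonglongrightarrow> c *\<^sub>C x"
    by (auto intro: cvec.subspace_scale[OF assms] bounded_linear.tendsto[OF bounded_linear_scaleC])
  then show "c *\<^sub>C x \<in> closure S"
    unfolding closure_sequential by (intro exI[of _ "\<lambda>n. c *\<^sub>C f n"] conjI)
qed

lemma bounded_clinear_continuous_on:
  fixes f :: "'a::chilbert_space \<Rightarrow> 'b::{complex_vector, real_normed_vector}"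
  assumes "cvec.subspace S" "clinear_on S f" "\<And>x. x \<in> S \<Longrightarrow> norm (f x) \<le> M * norm x"
  shows "continuous_on S f"
proof -
  have "norm (f x - f y) \<le> \<bar>M\<bar> * norm (x - y)" if "x \<in> S" "y \<in> S" for x y
  proof -
    have "norm (f x - f y) \<le> M * norm (x - y)"
      using assms(3)[OF cvec.subspace_diff[OF assms(1) that]]
      by (simp add: clinear_on_diff[OF assms(1,2) that])
    also have "\<dots> \<le> \<bar>M\<bar> * norm (x - y)" by (intro mult_right_mono) auto
    finally show ?thesis .
  qed
  then have "\<bar>M\<bar>-lipschitz_on S f"
    by (intro lipschitz_onI) (auto simp: dist_norm)
  then show ?thesis by (rule lipschitz_on_continuous_on)
qed

text \<open>Agreement is preserved by linear combinations and by limits. In this way identities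
  between operators on a tensor product are reduced to elementary tensors.\<close>

lemma clinear_on_eq_closure_span:
  fixes f g :: "'a::chilbert_space \<Rightarrow> 'b::{complex_vector, real_normed_vector}"
  assumes f: "clinear_on (closure (cvec.span A)) f" "continuous_on (closure (cvec.span A)) f"
    and g: "clinear_on (closure (cvec.span A)) g" "continuous_on (closure (cvec.span A)) g"
    and eq: "\<And>x. x \<in> A \<Longrightarrow> f x = g x" and x: "x \<in> closure (cvec.span A)"
  shows "f x = g x"
proof -
  have sp: "cvec.span A \<subseteq> closure (cvec.span A)" by (rule closure_subset)
  have "y \<in> cvec.span A \<and> f y - g y = 0" if "y \<in> cvec.span A" for y
    using that
  proof (induction rule: cvec.span_induct_alt)
    case base
    then show ?case
      using clinear_on_zero[OF f(1)] clinear_on_zero[OF g(1)] subsetD[OF sp cvec.span_zero] by (simp add: cvec.span_zero)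
  next
    case (step c x y)
    then have "x \<in> cvec.span A" by (auto intro: cvec.span_base)
    then have *: "x \<in> closure (cvec.span A)" "c *\<^sub>C x \<in> closure (cvec.span A)"
      using sp cvec.span_scale by auto
    have y: "y \<in> closure (cvec.span A)" using step sp by auto
    show ?case
      using step \<open>x \<in> cvec.span A\<close> eq[OF step(1)]
      by (simp add: clinear_on_add[OF f(1) *(2) y] clinear_on_add[OF g(1) *(2) y]
          clinear_on_scale[OF f(1) *(1)] clinear_on_scale[OF g(1) *(1)]
          cvec.span_add cvec.span_scale)
  qed
  then have "f x - g x = 0"
    using continuous_constant_on_closure[OF continuous_on_diff[OF f(2) g(2)] _ x, of 0] by blast
  then show ?thesis by simp
qed

section \<open>Bounded operators between Hilbert spaces\<close>

lemma hilbert_space_zero: "hilbert_space H \<Longrightarrow> 0 \<in> H"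
  and hilbert_space_subspace: "hilbert_space H \<Longrightarrow> cvec.subspace H"
  by (auto simp: hilbert_space_def cvec.subspace_0)

lemma hilbert_space_UNIV: "hilbert_space UNIV"
  by (simp add: hilbert_space_def cvec.subspace_UNIV)

lemma bounded_ops_mem: "T \<in> bounded_ops H K \<Longrightarrow> x \<in> H \<Longrightarrow> T x \<in> K"
  and bounded_ops_clinear: "T \<in> bounded_ops H K \<Longrightarrow> clinear_on H T"
  and bounded_ops_outside: "T \<in> bounded_ops H K \<Longrightarrow> x \<notin> H \<Longrightarrow> T x = 0"
  by (auto simp: bounded_ops_def)

lemma bounded_ops_bound:
  assumes "T \<in> bounded_ops H K"
  obtains M where "M \<ge> 0" "\<And>x. norm (T x) \<le> M * norm x"
proof -
  obtain M where M: "\<And>x. x \<in> H \<Longrightarrow> norm (T x) \<le> M * norm x"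
    using assms by (auto simp: bounded_ops_def)
  have "norm (T x) \<le> \<bar>M\<bar> * norm x" for x
  proof (cases "x \<in> H")
    case True
    have "M * norm x \<le> \<bar>M\<bar> * norm x" by (intro mult_right_mono) auto
    with M[OF True] show ?thesis by simp
  qed (simp add: bounded_ops_outside[OF assms])
  then show ?thesis by (intro that[of "\<bar>M\<bar>"]) auto
qed

lemma bounded_opsI:
  assumes "\<And>x. x \<in> H \<Longrightarrow> T x \<in> K" "clinear_on H T"
    "\<And>x. x \<in> H \<Longrightarrow> norm (T x) \<le> M * norm x" "\<And>x. x \<notin> H \<Longrightarrow> T x = 0"
  shows "T \<in> bounded_ops H K"
  using assms by (auto simp: bounded_ops_def)

lemma bounded_ops_eqI:
  assumes "S \<in> bounded_ops H K" "T \<in> bounded_ops H K'" "\<And>x. x \<in> H \<Longrightarrow> S x = T x"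
  shows "S = T"
  using assms by (metis bounded_ops_outside ext)

lemma bounded_ops_continuous_on:
  assumes "cvec.subspace H" "T \<in> bounded_ops H K"
  shows "continuous_on H T"
  using bounded_ops_bound[OF assms(2)] bounded_clinear_continuous_on[OF assms(1) bounded_ops_clinear[OF assms(2)]]
  by metis

lemma subspace_bounded_ops:
  assumes "cvec.subspace K"
  shows "cvec.subspace (bounded_ops H K)"
proof (rule cvec.subspaceI)
  show "0 \<in> bounded_ops H K"
    by (rule bounded_opsI[where M=0])
       (auto simp: clinear_on_def cvec.subspace_0[OF assms])
next
  fix S T assume ST: "S \<in> bounded_ops H K" "T \<in> bounded_ops H K"
  obtain M N where M: "\<And>x. norm (S x) \<le> M * norm x" and N: "\<And>x. norm (T x) \<le> N * norm x"
    using ST bounded_ops_bound by metis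
  show "S + T \<in> bounded_ops H K"
  proof (rule bounded_opsI[where M="M + N"])
    show "norm ((S + T) x) \<le> (M + N) * norm x" for x
      using norm_triangle_ineq[of "S x" "T x"] M[of x] N[of x] by (simp add: distrib_right)
    show "clinear_on H (S + T)"
      using ST[THEN bounded_ops_clinear] by (auto simp: clinear_on_def scaleC_add_right)
  qed (auto simp: bounded_ops_mem[OF ST(1)] bounded_ops_mem[OF ST(2)]
      bounded_ops_outside[OF ST(1)] bounded_ops_outside[OF ST(2)] cvec.subspace_add[OF assms])
next
  fix c T assume T: "T \<in> bounded_ops H K"
  obtain M where M: "\<And>x. norm (T x) \<le> M * norm x"
    using T bounded_ops_bound by metis
  show "c *\<^sub>C T \<in> bounded_ops H K"
  proof (rule bounded_opsI[where M="cmod c * M"])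
    show "norm ((c *\<^sub>C T) x) \<le> cmod c * M * norm x" for x
      using mult_left_mono[OF M[of x], of "cmod c"] by (simp add: scaleC_fun_def norm_scaleC mult.assoc)
    show "clinear_on H (c *\<^sub>C T)"
      using bounded_ops_clinear[OF T]
      by (auto simp: clinear_on_def scaleC_add_right scaleC_fun_def scaleC_scaleC mult.commute)
  qed (auto simp: scaleC_fun_def bounded_ops_mem[OF T] bounded_ops_outside[OF T]
      cvec.subspace_scale[OF assms])
qed

lemma bounded_ops_comp:
  assumes "hilbert_space L" "S \<in> bounded_ops L K" "T \<in> bounded_ops H L"
  shows "S \<circ> T \<in> bounded_ops H K"
proof -
  obtain M N where M: "M \<ge> 0" "\<And>x. norm (S x) \<le> M * norm x" and N: "\<And>x. norm (T x) \<le> N * norm x"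
    using assms bounded_ops_bound by metis
  have S0: "S 0 = 0"
    by (rule clinear_on_zero[OF bounded_ops_clinear[OF assms(2)] hilbert_space_zero[OF assms(1)]])
  show ?thesis
  proof (rule bounded_opsI[where M="M * N"])
    show "norm ((S \<circ> T) x) \<le> M * N * norm x" for x
      using M(2)[of "T x"] mult_left_mono[OF N[of x] M(1)] by simp
    show "clinear_on H (S \<circ> T)"
      using assms(2,3)[THEN bounded_ops_clinear] bounded_ops_mem[OF assms(3)]
      by (auto simp: clinear_on_def)
  qed (auto simp: bounded_ops_mem[OF assms(2)] bounded_ops_mem[OF assms(3)]
      bounded_ops_outside[OF assms(3)] S0)
qed

lemma id_op_bounded: "hilbert_space H \<Longrightarrow> id_op H \<in> bounded_ops H H"
  by (rule bounded_opsI[where M=1])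
     (auto simp: id_op_def clinear_on_def hilbert_space_def cvec.subspace_add cvec.subspace_scale)

lemma id_op_comp: "T \<in> bounded_ops H K \<Longrightarrow> id_op K \<circ> T = T"
  by (rule ext) (metis bounded_ops_mem bounded_ops_outside comp_apply id_op_def)

lemma comp_id_op: "hilbert_space H \<Longrightarrow> T \<in> bounded_ops H K \<Longrightarrow> T \<circ> id_op H = T"
  by (rule ext)
     (metis bounded_ops_clinear bounded_ops_outside clinear_on_zero comp_apply hilbert_space_zero id_op_def)

section \<open>Riesz representation and adjoints\<close>

text \<open>The representing vector minimises \<open>q x = \<bar>x\<bar>\<^sup>2 - 2 Re (f x)\<close> on \<open>H\<close>: completing the square
  would turn \<open>q\<close> into the squared distance to it, up to a constant. A minimising sequence is
  Cauchy by the parallelogram identity, and at the minimum the derivative of \<open>q\<close> in every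
  direction vanishes.\<close>

lemma riesz_representation:
  fixes H :: "'a::chilbert_space set" and f :: "'a \<Rightarrow> complex"
  assumes H: "hilbert_space H" and f: "clinear_on H f" and M: "\<And>x. x \<in> H \<Longrightarrow> cmod (f x) \<le> M * norm x"
  shows "\<exists>z\<in>H. \<forall>x\<in>H. f x = cinner z x"
proof -
  define q where "q x = (norm x)\<^sup>2 - 2 * Re (f x)" for x
  have sub: "cvec.subspace H" and cl: "closed H" using H by (auto simp: hilbert_space_def)
  have q_add: "q (x + t *\<^sub>R y) = q x + 2 * t * (inner x y - Re (f y)) + t\<^sup>2 * (norm y)\<^sup>2"
    if "x \<in> H" "y \<in> H" for x y t
  proof -
    have "f (x + t *\<^sub>R y) = f x + t * f y"
      using that by (simp add: scaleR_scaleC clinear_on_add[OF f] clinear_on_scale[OF f]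
          cvec.subspace_scale[OF sub])
    moreover have "(norm (x + t *\<^sub>R y))\<^sup>2 = (norm x)\<^sup>2 + 2 * t * inner x y + t\<^sup>2 * (norm y)\<^sup>2"
      unfolding power2_norm_eq_inner
      by (simp add: inner_add_left inner_add_right inner_commute power2_eq_square algebra_simps)
    ultimately show ?thesis by (simp add: q_def algebra_simps)
  qed
  have low: "q x \<ge> - M\<^sup>2" if "x \<in> H" for x
  proof -
    have "Re (f x) \<le> M * norm x" using M[OF that] complex_Re_le_cmod[of "f x"] by linarith
    then have "q x \<ge> (norm x - M)\<^sup>2 - M\<^sup>2" by (simp add: q_def power2_eq_square algebra_simps)
    then show ?thesis using zero_le_power2[of "norm x - M"] by linarith
  qed
  define m where "m = Inf (q ` H)"
  have bdd: "bdd_below (q ` H)" using low by (auto intro!: bdd_belowI2)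
  have m_le: "m \<le> q x" if "x \<in> H" for x
    unfolding m_def using that bdd by (intro cInf_lower) auto
  have "\<exists>x\<in>H. q x < m + 1 / Suc n" for n
  proof -
    have "Inf (q ` H) < m + 1 / Suc n" by (simp add: m_def)
    then show ?thesis
      using cInf_lessD[of "q ` H"] hilbert_space_zero[OF H] by blast
  qed
  then obtain X where X: "\<And>n. X n \<in> H" "\<And>n. q (X n) < m + 1 / Suc n" by metis
  \<comment> \<open>Since the midpoint cannot go below \<open>m\<close>, two almost minimisers are close to each other.\<close>
  have mid: "(norm (x - y))\<^sup>2 \<le> 2 * (q x - m) + 2 * (q y - m)" if xy: "x \<in> H" "y \<in> H" for x y
  proof -
    have d: "y - x \<in> H" using xy by (intro cvec.subspace_diff[OF sub])
    have "q y = q x + 2 * (inner x (y - x) - Re (f (y - x))) + (norm (y - x))\<^sup>2"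
      using q_add[OF xy(1) d, of 1] by simp
    moreover have "q (x + (1/2) *\<^sub>R (y - x)) = q x + (inner x (y - x) - Re (f (y - x))) + (norm (y - x))\<^sup>2 / 4"
      using q_add[OF xy(1) d, of "1/2"] by (simp add: power2_eq_square)
    moreover have "m \<le> q (x + (1/2) *\<^sub>R (y - x))"
      by (intro m_le cvec.subspace_add[OF sub] xy) (simp add: scaleR_scaleC cvec.subspace_scale[OF sub d])
    ultimately show ?thesis by (simp add: norm_minus_commute)
  qed
  have "Cauchy X"
  proof (rule metric_CauchyI)
    fix e :: real assume e: "e > 0"
    obtain N where N: "inverse (Suc N) < e\<^sup>2 / 4" using reals_Archimedean[of "e\<^sup>2 / 4"] e by auto
    have "dist (X i) (X j) < e" if "i \<ge> N" "j \<ge> N" for i j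
    proof -
      have *: "q (X k) - m < e\<^sup>2 / 4" if "k \<ge> N" for k
      proof -
        have "1 / real (Suc k) \<le> inverse (Suc N)" using that by (simp add: field_simps)
        then show ?thesis using X(2)[of k] N by linarith
      qed
      have "(norm (X i - X j))\<^sup>2 \<le> 2 * (q (X i) - m) + 2 * (q (X j) - m)"
        by (rule mid[OF X(1) X(1)])
      also have "\<dots> < 2 * (e\<^sup>2 / 4) + 2 * (e\<^sup>2 / 4)"
        by (intro add_strict_mono mult_strict_left_mono * that) auto
      finally have "(norm (X i - X j))\<^sup>2 < e\<^sup>2" by simp
      then show ?thesis unfolding dist_norm by (rule power2_less_imp_less) (use e in simp)
    qed
    then show "\<exists>N. \<forall>i\<ge>N. \<forall>j\<ge>N. dist (X i) (X j) < e" by blast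
  qed
  then obtain z where z: "X \<longlonglongrightarrow> z" using Cauchy_convergent convergentD by blast
  have zH: "z \<in> H" using closed_sequentially[OF cl _ z] X(1) by blast
  have "continuous_on H f" by (rule bounded_clinear_continuous_on[OF sub f M])
  then have "(\<lambda>n. f (X n)) \<longlonglongrightarrow> f z"
    by (rule continuous_on_tendsto_compose[OF _ z zH]) (simp add: X)
  then have "(\<lambda>n. q (X n)) \<longlonglongrightarrow> q z" unfolding q_def by (intro tendsto_intros z)
  moreover have "(\<lambda>n. q (X n)) \<longlonglongrightarrow> m"
  proof (rule tendsto_sandwich[where f="\<lambda>_. m" and h="\<lambda>n. m + 1 / Suc n"])
    show "(\<lambda>n. m + 1 / Suc n) \<longlonglongrightarrow> m"
      using tendsto_add[OF tendsto_const[of m] LIMSEQ_inverse_real_of_nat] by (simp add: field_simps)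
    show "\<forall>\<^sub>F n in sequentially. m \<le> q (X n)" by (rule always_eventually) (simp add: m_le X(1))
    show "\<forall>\<^sub>F n in sequentially. q (X n) \<le> m + 1 / Suc n"
      by (rule always_eventually) (intro allI less_imp_le X(2))
  qed simp
  ultimately have qz: "q z = m" by (rule LIMSEQ_unique)
  have re: "Re (f x) = inner z x" if x: "x \<in> H" for x
  proof (rule ccontr)
    define d where "d = inner z x - Re (f x)"
    assume "Re (f x) \<noteq> inner z x"
    then have d: "d \<noteq> 0" by (simp add: d_def)
    \<comment> \<open>A step along \<open>x\<close> against the slope \<open>2 d\<close> of \<open>q\<close>, short enough to go below the minimum.\<close>
    define t where "t = - d / ((norm x)\<^sup>2 + 1)"
    have "z + t *\<^sub>R x \<in> H"
      by (simp add: scaleR_scaleC cvec.subspace_add[OF sub zH] cvec.subspace_scale[OF sub x])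
    then have "0 \<le> 2 * t * d + t\<^sup>2 * (norm x)\<^sup>2"
      using m_le q_add[OF zH x, of t] qz by (fastforce simp: d_def)
    then have "0 \<le> 2 * t * d + t\<^sup>2 * ((norm x)\<^sup>2 + 1)"
      by (simp add: distrib_left add.assoc[symmetric] add_nonneg_nonneg)
    moreover have "t\<^sup>2 * ((norm x)\<^sup>2 + 1) = t * (t * ((norm x)\<^sup>2 + 1))"
      by (simp only: power2_eq_square mult.assoc)
    moreover have pos: "(norm x)\<^sup>2 + 1 > 0" by (simp add: add_nonneg_pos)
    then have "t * ((norm x)\<^sup>2 + 1) = - d" by (simp add: t_def)
    ultimately have "0 \<le> t * d" by (simp add: mult.commute)
    also have "t * d = - (d\<^sup>2 / ((norm x)\<^sup>2 + 1))" by (simp add: t_def power2_eq_square)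
    also have "\<dots> < 0" using d pos by simp
    finally show False by simp
  qed
  have "f x = cinner z x" if x: "x \<in> H" for x
  proof (rule complex_eqI)
    show "Re (f x) = Re (cinner z x)" using re[OF x] by (simp add: inner_eq_Re_cinner)
    have "Re (f (\<i> *\<^sub>C x)) = Re (cinner z (\<i> *\<^sub>C x))"
      using re[OF cvec.subspace_scale[OF sub x]] by (simp add: inner_eq_Re_cinner)
    then show "Im (f x) = Im (cinner z x)"
      by (simp add: clinear_on_scale[OF f x] cinner_scaleC_right)
  qed
  then show ?thesis using zH by blast
qed

lemma cinner_eqD:
  assumes "hilbert_space H" "z \<in> H" "w \<in> H" "\<And>x. x \<in> H \<Longrightarrow> cinner x z = cinner x w"
  shows "z = w"
proof -
  have "cinner (z - w) (z - w) = 0"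
    using assms(4)[OF cvec.subspace_diff[OF hilbert_space_subspace[OF assms(1)] assms(2,3)]]
    by (simp add: cinner_diff_right)
  then show ?thesis by (simp add: cinner_self)
qed

text \<open>Adjoints and slices of operators are both obtained as operators of a bounded sesquilinear
  form, so that linearity is checked once and for all here.\<close>

lemma sesquilinear_form_operator:
  fixes H :: "'h::chilbert_space set" and K :: "'k::chilbert_space set"
  assumes H: "hilbert_space H" and K: "hilbert_space K"
    and l: "\<And>y. y \<in> K \<Longrightarrow> clinear_on H (\<lambda>x. s x y)"
    and r: "\<And>x. x \<in> H \<Longrightarrow> clinear_on K (\<lambda>y. cnj (s x y))"
    and M0: "0 \<le> M" and M: "\<And>x y. x \<in> H \<Longrightarrow> y \<in> K \<Longrightarrow> cmod (s x y) \<le> M * norm x * norm y"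
  shows "\<exists>R\<in>bounded_ops H K. \<forall>x\<in>H. \<forall>y\<in>K. cinner y (R x) = s x y"
proof -
  have "\<exists>z\<in>K. \<forall>y\<in>K. cinner y z = s x y" if x: "x \<in> H" for x
  proof -
    obtain z where z: "z \<in> K" "\<And>y. y \<in> K \<Longrightarrow> cnj (s x y) = cinner z y"
      using riesz_representation[OF K r[OF x], of "M * norm x"] M[OF x] by auto
    have "cinner y z = s x y" if "y \<in> K" for y
      using arg_cong[OF z(2)[OF that], of cnj] by (subst cinner_commute) simp
    then show ?thesis using z(1) by blast
  qed
  then obtain R0 where R0: "\<And>x. x \<in> H \<Longrightarrow> R0 x \<in> K"
    "\<And>x y. x \<in> H \<Longrightarrow> y \<in> K \<Longrightarrow> cinner y (R0 x) = s x y" by metis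
  define R where "R x = (if x \<in> H then R0 x else 0)" for x
  have "R \<in> bounded_ops H K"
  proof (rule bounded_opsI[where M=M])
    fix x assume x: "x \<in> H"
    show "R x \<in> K" using R0(1)[OF x] by (simp add: R_def x)
    have "(norm (R0 x))\<^sup>2 = cmod (s x (R0 x))"
      using R0(2)[OF x R0(1)[OF x]] by (metis cinner_self norm_of_real abs_of_nonneg zero_le_power2)
    also have "\<dots> \<le> M * norm x * norm (R0 x)" by (intro M x R0)
    finally have "norm (R0 x) * norm (R0 x) \<le> M * norm x * norm (R0 x)" by (simp add: power2_eq_square)
    then have "norm (R0 x) \<le> M * norm x"
      by (cases "norm (R0 x) = 0") (use M0 in auto)
    then show "norm (R x) \<le> M * norm x" by (simp add: R_def x)
  next
    have "R0 (x + y) = R0 x + R0 y" if x: "x \<in> H" and y: "y \<in> H" for x y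
      by (rule cinner_eqD[OF K])
         (use x y in \<open>simp_all add: R0 cinner_add_right clinear_on_add[OF l]
             cvec.subspace_add[OF hilbert_space_subspace[OF H]]
             cvec.subspace_add[OF hilbert_space_subspace[OF K]]\<close>)
    moreover have "R0 (c *\<^sub>C x) = c *\<^sub>C R0 x" if x: "x \<in> H" for c x
      by (rule cinner_eqD[OF K])
         (use x in \<open>simp_all add: R0 cinner_scaleC_right clinear_on_scale[OF l]
             cvec.subspace_scale[OF hilbert_space_subspace[OF H]]
             cvec.subspace_scale[OF hilbert_space_subspace[OF K]]\<close>)
    ultimately show "clinear_on H R"
      by (auto simp: clinear_on_def R_def cvec.subspace_add[OF hilbert_space_subspace[OF H]]
          cvec.subspace_scale[OF hilbert_space_subspace[OF H]])
  qed (auto simp: R_def)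
  then show ?thesis by (intro bexI[of _ R]) (auto simp: R_def R0)
qed

lemma adjoint_exists:
  fixes H :: "'h::chilbert_space set" and K :: "'k::chilbert_space set"
  assumes H: "hilbert_space H" and K: "hilbert_space K" and T: "T \<in> bounded_ops H K"
  shows "\<exists>S\<in>bounded_ops K H. \<forall>x\<in>H. \<forall>y\<in>K. cinner (S y) x = cinner y (T x)"
proof -
  obtain M where M: "M \<ge> 0" "\<And>x. norm (T x) \<le> M * norm x" using bounded_ops_bound[OF T] by metis
  have "\<exists>S\<in>bounded_ops K H. \<forall>y\<in>K. \<forall>x\<in>H. cinner x (S y) = cinner (T x) y"
  proof (rule sesquilinear_form_operator[OF K H _ _ M(1)])
    show "clinear_on K (cinner (T x))" for x
      by (auto simp: clinear_on_def cinner_add_right cinner_scaleC_right)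
    show "clinear_on H (\<lambda>x. cnj (cinner (T x) y))" for y
      using bounded_ops_clinear[OF T]
      by (auto simp: clinear_on_def cinner_add_left cinner_scaleC_left)
    show "cmod (cinner (T x) y) \<le> M * norm y * norm x" for x y
      using order_trans[OF cinner_cauchy_schwarz mult_right_mono[OF M(2)], of y x]
      by (simp add: mult_ac)
  qed
  then obtain S where "S \<in> bounded_ops K H" "\<And>y x. y \<in> K \<Longrightarrow> x \<in> H \<Longrightarrow> cinner x (S y) = cinner (T x) y"
    by blast
  then show ?thesis by (metis cinner_commute)
qed

section \<open>Elementary tensors\<close>

lemma norm_tensor: "norm (x \<otimes>\<^sub>H y) = norm x * norm y"
proof -
  have "complex_of_real ((norm (x \<otimes>\<^sub>H y))\<^sup>2) = complex_of_real ((norm x * norm y)\<^sup>2)"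
    by (simp only: cinner_self[symmetric] cinner_tensor) (simp add: cinner_self power_mult_distrib)
  then show ?thesis
    by (simp only: of_real_eq_iff power2_eq_iff_nonneg norm_ge_zero mult_nonneg_nonneg)
qed

lemma eq_by_cinner: "cinner (z - w) z = cinner (z - w) w \<Longrightarrow> z = (w :: 'a::chilbert_space)"
  using cinner_self[of "z - w"] by (simp add: cinner_diff_right)

lemma tensor_add_left: "(x + x') \<otimes>\<^sub>H y = x \<otimes>\<^sub>H y + x' \<otimes>\<^sub>H y"
  by (rule eq_by_cinner)
     (simp add: cinner_diff_left cinner_diff_right cinner_add_left cinner_add_right cinner_tensor algebra_simps)

lemma tensor_add_right: "x \<otimes>\<^sub>H (y + y') = x \<otimes>\<^sub>H y + x \<otimes>\<^sub>H y'"
  by (rule eq_by_cinner)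
     (simp add: cinner_diff_left cinner_diff_right cinner_add_left cinner_add_right cinner_tensor algebra_simps)

lemma tensor_scale_left: "(c *\<^sub>C x) \<otimes>\<^sub>H y = c *\<^sub>C (x \<otimes>\<^sub>H y)"
  by (rule eq_by_cinner)
     (simp add: cinner_diff_left cinner_diff_right cinner_scaleC_left cinner_scaleC_right cinner_tensor algebra_simps)

lemma tensor_scale_right: "x \<otimes>\<^sub>H (c *\<^sub>C y) = c *\<^sub>C (x \<otimes>\<^sub>H y)"
  by (rule eq_by_cinner)
     (simp add: cinner_diff_left cinner_diff_right cinner_scaleC_left cinner_scaleC_right cinner_tensor algebra_simps)

lemma hilbert_space_tensor: "hilbert_space (hilbert_tensor H K)"
  by (simp add: hilbert_space_def hilbert_tensor_def subspace_closure cvec.subspace_span)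

lemma tensor_mem: "x \<in> H \<Longrightarrow> y \<in> K \<Longrightarrow> x \<otimes>\<^sub>H y \<in> hilbert_tensor H K"
  unfolding hilbert_tensor_def by (rule subsetD[OF closure_subset]) (auto intro: cvec.span_base)

lemma hilbert_tensor_eqI:
  fixes f g :: "('h::chilbert_space \<times> 'k::chilbert_space) ell2 \<Rightarrow> 'b::{complex_vector, real_normed_vector}"
  assumes "clinear_on (hilbert_tensor H K) f" "continuous_on (hilbert_tensor H K) f"
    and "clinear_on (hilbert_tensor H K) g" "continuous_on (hilbert_tensor H K) g"
    and "\<And>x y. x \<in> H \<Longrightarrow> y \<in> K \<Longrightarrow> f (x \<otimes>\<^sub>H y) = g (x \<otimes>\<^sub>H y)"
    and "z \<in> hilbert_tensor H K"
  shows "f z = g z"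
  by (rule clinear_on_eq_closure_span[OF assms(1-4)[unfolded hilbert_tensor_def] _ assms(6)[unfolded hilbert_tensor_def]])
     (use assms(5) in blast)

lemma bounded_ops_tensor_eqI:
  assumes R: "R \<in> bounded_ops (hilbert_tensor H K) L" and R': "R' \<in> bounded_ops (hilbert_tensor H K) L'"
    and eq: "\<And>x y. x \<in> H \<Longrightarrow> y \<in> K \<Longrightarrow> R (x \<otimes>\<^sub>H y) = R' (x \<otimes>\<^sub>H y)"
  shows "R = R'"
proof (rule bounded_ops_eqI[OF R R'])
  note s = hilbert_space_subspace[OF hilbert_space_tensor]
  show "R z = R' z" if "z \<in> hilbert_tensor H K" for z
    by (rule hilbert_tensor_eqI[OF bounded_ops_clinear[OF R] bounded_ops_continuous_on[OF s R]
          bounded_ops_clinear[OF R'] bounded_ops_continuous_on[OF s R'] eq that])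
qed

section \<open>Tensor products of operators\<close>

text \<open>The Gram matrix of elementary tensors is symmetric in the two legs, so norm estimates for
  the first leg carry over to the second.\<close>

lemma norm_tensor_sum_swap:
  "norm (\<Sum>i\<in>F. x i \<otimes>\<^sub>H y i) = norm (\<Sum>i\<in>F. y i \<otimes>\<^sub>H x i)"
proof -
  have "complex_of_real ((norm (\<Sum>i\<in>F. x i \<otimes>\<^sub>H y i))\<^sup>2) = complex_of_real ((norm (\<Sum>i\<in>F. y i \<otimes>\<^sub>H x i))\<^sup>2)"
    unfolding cinner_self[symmetric] by (simp add: cinner_sum_left cinner_sum_right cinner_tensor mult.commute)
  then show ?thesis
    by (simp only: of_real_eq_iff power2_eq_iff_nonneg norm_ge_zero)
qed

lemma has_sum_finite_sum:
  fixes f :: "'i \<Rightarrow> 'e \<Rightarrow> complex"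
  assumes "\<And>i. i \<in> F \<Longrightarrow> (f i has_sum s i) A"
  shows "((\<lambda>e. \<Sum>i\<in>F. f i e) has_sum (\<Sum>i\<in>F. s i)) A"
  using assms by (induction F rule: infinite_finite_induct) (auto intro: has_sum_add)

text \<open>Expanding the second leg in an orthonormal basis splits the vector into the orthogonal
  pieces \<open>(\<Sum>i\<in>F. \<langle>e, y i\<rangle> x i) \<otimes> e\<close>. On each of them an operator of the first leg acts separately.\<close>

lemma has_sum_norm_tensor_sum:
  assumes E: "orthonormal E" "\<And>x. (\<And>e. e \<in> E \<Longrightarrow> cinner e x = 0) \<Longrightarrow> x = 0"
  shows "((\<lambda>e. (norm (\<Sum>i\<in>F. cinner e (y i) *\<^sub>C x i))\<^sup>2) has_sum (norm (\<Sum>i\<in>F. x i \<otimes>\<^sub>H y i))\<^sup>2) E"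
proof -
  have "((\<lambda>e. \<Sum>i\<in>F. \<Sum>j\<in>F. cinner (x i) (x j) * (cnj (cinner e (y i)) * cinner e (y j)))
      has_sum (\<Sum>i\<in>F. \<Sum>j\<in>F. cinner (x i) (x j) * cinner (y i) (y j))) E"
    by (intro has_sum_finite_sum has_sum_cmult_right parseval E)
  moreover have "(\<Sum>i\<in>F. \<Sum>j\<in>F. cinner (x i) (x j) * cinner (y i) (y j))
      = complex_of_real ((norm (\<Sum>i\<in>F. x i \<otimes>\<^sub>H y i))\<^sup>2)"
    by (simp add: cinner_self[symmetric] cinner_sum_left cinner_sum_right cinner_tensor
        del: of_real_power) (rule sum.swap)
  moreover have "(\<Sum>i\<in>F. \<Sum>j\<in>F. cinner (x i) (x j) * (cnj (cinner e (y i)) * cinner e (y j)))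
      = complex_of_real ((norm (\<Sum>i\<in>F. cinner e (y i) *\<^sub>C x i))\<^sup>2)" for e
    by (simp add: cinner_self[symmetric] cinner_sum_left cinner_sum_right cinner_scaleC_left
        cinner_scaleC_right sum_distrib_left mult_ac del: of_real_power) (rule sum.swap)
  ultimately have "((\<lambda>e. complex_of_real ((norm (\<Sum>i\<in>F. cinner e (y i) *\<^sub>C x i))\<^sup>2))
      has_sum complex_of_real ((norm (\<Sum>i\<in>F. x i \<otimes>\<^sub>H y i))\<^sup>2)) E" by simp
  from has_sum_bounded_linear[OF bounded_linear_Re this] show ?thesis by simp
qed

lemma norm_tensor_sum_left:
  assumes H: "hilbert_space H" and S: "clinear_on H S" "\<And>x. x \<in> H \<Longrightarrow> norm (S x) \<le> M * norm x" and M: "0 \<le> M"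
    and x: "\<And>i. i \<in> F \<Longrightarrow> x i \<in> H"
  shows "norm (\<Sum>i\<in>F. S (x i) \<otimes>\<^sub>H (y i :: 'k::chilbert_space)) \<le> M * norm (\<Sum>i\<in>F. x i \<otimes>\<^sub>H y i)"
proof -
  obtain E :: "'k set" where E: "orthonormal E"
    "\<And>x. (\<And>e. e \<in> E \<Longrightarrow> cinner e x = 0) \<Longrightarrow> x = 0"
    using maximal_orthonormal_exists by blast
  have sub: "cvec.subspace H" by (rule hilbert_space_subspace[OF H])
  have "(norm (\<Sum>i\<in>F. S (x i) \<otimes>\<^sub>H y i))\<^sup>2 \<le> M\<^sup>2 * (norm (\<Sum>i\<in>F. x i \<otimes>\<^sub>H y i))\<^sup>2"
  proof (rule has_sum_mono)
    show "((\<lambda>e. (norm (\<Sum>i\<in>F. cinner e (y i) *\<^sub>C S (x i)))\<^sup>2) has_sum (norm (\<Sum>i\<in>F. S (x i) \<otimes>\<^sub>H y i))\<^sup>2) E"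
      by (rule has_sum_norm_tensor_sum[OF E])
    show "((\<lambda>e. M\<^sup>2 * (norm (\<Sum>i\<in>F. cinner e (y i) *\<^sub>C x i))\<^sup>2) has_sum M\<^sup>2 * (norm (\<Sum>i\<in>F. x i \<otimes>\<^sub>H y i))\<^sup>2) E"
      by (intro has_sum_cmult_right has_sum_norm_tensor_sum[OF E])
    fix e
    have m: "cinner e (y i) *\<^sub>C x i \<in> H" if "i \<in> F" for i by (intro cvec.subspace_scale[OF sub] x that)
    have "(\<Sum>i\<in>F. cinner e (y i) *\<^sub>C S (x i)) = S (\<Sum>i\<in>F. cinner e (y i) *\<^sub>C x i)"
      by (subst clinear_on_sum[OF sub S(1) m]) (auto intro!: sum.cong clinear_on_scale[OF S(1), symmetric] x)
    also have "norm \<dots> \<le> M * norm (\<Sum>i\<in>F. cinner e (y i) *\<^sub>C x i)"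
      by (intro S(2) cvec.subspace_sum[OF sub] m)
    finally show "(norm (\<Sum>i\<in>F. cinner e (y i) *\<^sub>C S (x i)))\<^sup>2 \<le> M\<^sup>2 * (norm (\<Sum>i\<in>F. cinner e (y i) *\<^sub>C x i))\<^sup>2"
      by (metis norm_ge_zero power_mono power_mult_distrib)
  qed
  then have "(norm (\<Sum>i\<in>F. S (x i) \<otimes>\<^sub>H y i))\<^sup>2 \<le> (M * norm (\<Sum>i\<in>F. x i \<otimes>\<^sub>H y i))\<^sup>2"
    by (simp add: power_mult_distrib)
  then show ?thesis by (rule power2_le_imp_le) (simp add: M)
qed

text \<open>The estimate for \<open>S \<otimes> T = (S \<otimes> 1)(1 \<otimes> T)\<close>, one leg after the other.\<close>

lemma norm_tensor_sum_le:
  assumes H: "hilbert_space H" and S: "clinear_on H S" "\<And>x. x \<in> H \<Longrightarrow> norm (S x) \<le> M * norm x" "0 \<le> M"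
    and K: "hilbert_space K" and T: "clinear_on K T" "\<And>y. y \<in> K \<Longrightarrow> norm (T y) \<le> N * norm y" "0 \<le> N"
    and x: "\<And>i. i \<in> F \<Longrightarrow> x i \<in> H" and y: "\<And>i. i \<in> F \<Longrightarrow> y i \<in> K"
  shows "norm (\<Sum>i\<in>F. S (x i) \<otimes>\<^sub>H T (y i)) \<le> M * N * norm (\<Sum>i\<in>F. x i \<otimes>\<^sub>H y i)"
proof -
  have "norm (\<Sum>i\<in>F. S (x i) \<otimes>\<^sub>H T (y i)) \<le> M * norm (\<Sum>i\<in>F. x i \<otimes>\<^sub>H T (y i))"
    by (rule norm_tensor_sum_left[OF H S x])
  also have "norm (\<Sum>i\<in>F. x i \<otimes>\<^sub>H T (y i)) \<le> N * norm (\<Sum>i\<in>F. x i \<otimes>\<^sub>H y i)"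
    unfolding norm_tensor_sum_swap[of x _ F] by (rule norm_tensor_sum_left[OF K T y])
  finally show ?thesis by (simp add: mult.assoc mult_left_mono S(3))
qed

text \<open>The norm estimate makes the linear extension of \<open>t i \<mapsto> t' i\<close> well defined, since a linear
  relation between the \<open>t i\<close> then holds between the \<open>t' i\<close> as well, and it makes the extension
  continuous. Operators on a tensor product are constructed in this way from their values on
  elementary tensors.\<close>

lemma bounded_extension:
  fixes t :: "'i \<Rightarrow> 'x::chilbert_space" and t' :: "'i \<Rightarrow> 'y::chilbert_space"
  assumes M: "\<And>F c. finite F \<Longrightarrow> F \<subseteq> I \<Longrightarrow>
      norm (\<Sum>i\<in>F. c i *\<^sub>C t' i) \<le> M * norm (\<Sum>i\<in>F. c i *\<^sub>C t i)"
  shows "\<exists>R\<in>bounded_ops (closure (cvec.span (t ` I))) (closure (cvec.span (t' ` I))). \<forall>i\<in>I. R (t i) = t' i"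
proof -
  interpret pair: vector_space_pair "scaleC :: complex \<Rightarrow> 'x \<Rightarrow> 'x" "scaleC :: complex \<Rightarrow> 'y \<Rightarrow> 'y" ..
  obtain B where B: "B \<subseteq> t ` I" "cvec.independent B" "t ` I \<subseteq> cvec.span B"
    using cvec.maximal_independent_subset by blast
  have spB: "cvec.span B = cvec.span (t ` I)"
    using B by (metis cvec.span_mono cvec.span_minimal cvec.subspace_span subset_antisym)
  \<comment> \<open>The map \<open>t\<close> may fail to be injective, so each basis vector is given one of its indices.\<close>
  define ix where "ix b = inv_into I t b" for b
  have ix: "ix b \<in> I" "t (ix b) = b" if "b \<in> B" for b
    using that B(1) unfolding ix_def by (auto intro: inv_into_into f_inv_into_f)
  have inj: "inj_on ix A" if "A \<subseteq> B" for A by (rule inj_on_inverseI[where g=t]) (use that ix in blast)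
  obtain g where lin: "Vector_Spaces.linear scaleC scaleC g" and g: "\<And>b. b \<in> B \<Longrightarrow> g b = t' (ix b)"
    using pair.linear_independent_extend[OF B(2), of "\<lambda>b. t' (ix b)"] by blast
  interpret g: Vector_Spaces.linear "scaleC :: complex \<Rightarrow> 'x \<Rightarrow> 'x" "scaleC :: complex \<Rightarrow> 'y \<Rightarrow> 'y" g
    by (rule lin)
  have rep: "\<exists>F c. finite F \<and> F \<subseteq> I \<and> z = (\<Sum>i\<in>F. c i *\<^sub>C t i) \<and> g z = (\<Sum>i\<in>F. c i *\<^sub>C t' i)"
    if "z \<in> cvec.span B" for z
  proof -
    obtain A r where A: "finite A" "A \<subseteq> B" "z = (\<Sum>b\<in>A. r b *\<^sub>C b)"
      using \<open>z \<in> cvec.span B\<close> unfolding cvec.span_explicit by blast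
    have "z = (\<Sum>i\<in>ix ` A. r (t i) *\<^sub>C t i)"
      using A ix by (subst sum.reindex[OF inj[OF A(2)]]) (auto intro!: sum.cong)
    moreover have "g z = (\<Sum>i\<in>ix ` A. r (t i) *\<^sub>C t' i)"
      using A ix g by (subst sum.reindex[OF inj[OF A(2)]]) (auto simp: g.sum g.scale intro!: sum.cong)
    ultimately show ?thesis
      using A ix by (intro exI[of _ "ix ` A"] exI[of _ "\<lambda>i. r (t i)"]) auto
  qed
  have bound: "norm (g z) \<le> M * norm z" if "z \<in> cvec.span B" for z
    using rep[OF that] M by metis
  have gt: "g (t i) = t' i" if i: "i \<in> I" for i
  proof -
    have "t i \<in> cvec.span B" using B(3) i by blast
    from rep[OF this] obtain F c where F: "finite F" "F \<subseteq> I" "t i = (\<Sum>j\<in>F. c j *\<^sub>C t j)"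
      "g (t i) = (\<Sum>j\<in>F. c j *\<^sub>C t' j)" by blast
    \<comment> \<open>The coefficients of the relation \<open>(\<Sum>j\<in>F. c j t j) - t i = 0\<close>, to which the norm estimate is applied.\<close>
    define d where "d j = (if j \<in> F then c j else 0) - (if j = i then 1 else 0)" for j
    have *: "(\<Sum>j\<in>insert i F. d j *\<^sub>C u j) = (\<Sum>j\<in>F. c j *\<^sub>C u j) - u i" for u :: "'i \<Rightarrow> 'z::complex_vector"
    proof -
      have "(\<Sum>j\<in>insert i F. d j *\<^sub>C u j)
          = (\<Sum>j\<in>insert i F. if j \<in> F then c j *\<^sub>C u j else 0) - (\<Sum>j\<in>insert i F. if j = i then u j else 0)"
        unfolding sum_subtractf[symmetric] d_def by (intro sum.cong) (auto simp: cvec.scale_left_diff_distrib)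
      also have "(\<Sum>j\<in>insert i F. if j \<in> F then c j *\<^sub>C u j else 0) = (\<Sum>j\<in>F. c j *\<^sub>C u j)"
        using F(1) by (intro sum.mono_neutral_cong_right) auto
      also have "(\<Sum>j\<in>insert i F. if j = i then u j else 0) = u i"
        using F(1) by (subst sum.delta) auto
      finally show ?thesis .
    qed
    have "norm (g (t i) - t' i) \<le> M * norm (t i - t i)"
      using M[of "insert i F" d] F i unfolding * by simp
    then show ?thesis by simp
  qed
  have lip: "\<bar>M\<bar>-lipschitz_on (cvec.span B) g"
  proof (rule lipschitz_onI)
    fix x y assume "x \<in> cvec.span B" "y \<in> cvec.span B"
    then have "norm (g x - g y) \<le> M * norm (x - y)"
      using bound[of "x - y"] by (simp add: g.diff cvec.span_diff)
    also have "\<dots> \<le> \<bar>M\<bar> * norm (x - y)" by (intro mult_right_mono) auto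
    finally show "dist (g x) (g y) \<le> \<bar>M\<bar> * dist x y" by (simp add: dist_norm)
  qed simp
  obtain h where h: "\<bar>M\<bar>-lipschitz_on (closure (cvec.span B)) h" "\<And>x. x \<in> cvec.span B \<Longrightarrow> h x = g x"
    using lipschitz_extend_closure[OF lip] by metis
  let ?D = "closure (cvec.span B)"
  have sub: "cvec.subspace ?D" by (intro subspace_closure cvec.subspace_span)
  have lim: "(\<lambda>n. g (X n)) \<longlonglongrightarrow> h x" if X: "\<And>n. X n \<in> cvec.span B" "X \<longlonglongrightarrow> x" for X x
  proof -
    have "x \<in> ?D" unfolding closure_sequential by (intro exI[of _ X] conjI allI X)
    have "(\<lambda>n. h (X n)) \<longlonglongrightarrow> h x"
      by (rule continuous_on_tendsto_compose[OF lipschitz_on_continuous_on[OF h(1)] X(2) \<open>x \<in> ?D\<close>])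
         (intro always_eventually allI subsetD[OF closure_subset X(1)])
    then show ?thesis using h(2) X(1) by simp
  qed
  have seq: "\<exists>X. (\<forall>n. X n \<in> cvec.span B) \<and> X \<longlonglongrightarrow> x" if "x \<in> ?D" for x
    by (rule closure_sequential[THEN iffD1, OF that])
  define R where "R x = (if x \<in> ?D then h x else 0)" for x
  have "R \<in> bounded_ops ?D (closure (cvec.span (t' ` I)))"
  proof (rule bounded_opsI[where M="\<bar>M\<bar>"])
    fix x assume x: "x \<in> ?D"
    obtain X where X: "\<And>n. X n \<in> cvec.span B" "X \<longlonglongrightarrow> x" using seq[OF x] by blast
    have "g (X n) \<in> cvec.span (t' ` I)" for n
    proof -
      obtain F c where "F \<subseteq> I" "g (X n) = (\<Sum>i\<in>F. c i *\<^sub>C t' i)" using rep[OF X(1)] by blast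
      then show ?thesis
        by (simp only:) (intro cvec.span_sum cvec.span_scale cvec.span_base imageI, blast)
    qed
    then show "R x \<in> closure (cvec.span (t' ` I))"
      using lim[OF X] x by (simp add: R_def closure_sequential) (intro exI[of _ "\<lambda>n. g (X n)"] conjI allI)
    have "0 \<in> cvec.span B" by (rule cvec.span_zero)
    then have "dist (h x) (h 0) \<le> \<bar>M\<bar> * dist x 0"
      by (intro lipschitz_onD[OF h(1)] x subsetD[OF closure_subset])
    then show "norm (R x) \<le> \<bar>M\<bar> * norm x" using h(2)[OF \<open>0 \<in> cvec.span B\<close>] x by (simp add: R_def g.zero)
  next
    show "clinear_on ?D R"
      unfolding clinear_on_def
    proof (intro conjI ballI allI)
      fix x y assume xy: "x \<in> ?D" "y \<in> ?D"
      obtain X where X: "\<And>n. X n \<in> cvec.span B" "X \<longlonglongrightarrow> x" using seq[OF xy(1)] by blast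
      obtain Y where Y: "\<And>n. Y n \<in> cvec.span B" "Y \<longlonglongrightarrow> y" using seq[OF xy(2)] by blast
      have "(\<lambda>n. g (X n + Y n)) \<longlonglongrightarrow> h (x + y)"
        by (intro lim tendsto_add X Y cvec.span_add)
      moreover have "(\<lambda>n. g (X n + Y n)) \<longlonglongrightarrow> h x + h y"
        unfolding g.add by (intro tendsto_add lim X Y)
      ultimately have "h (x + y) = h x + h y" by (rule LIMSEQ_unique)
      then show "R (x + y) = R x + R y" using xy by (simp add: R_def cvec.subspace_add[OF sub])
    next
      fix c x assume x: "x \<in> ?D"
      obtain X where X: "\<And>n. X n \<in> cvec.span B" "X \<longlonglongrightarrow> x" using seq[OF x] by blast
      have "(\<lambda>n. g (c *\<^sub>C X n)) \<longlonglongrightarrow> h (c *\<^sub>C x)"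
        by (intro lim bounded_linear.tendsto[OF bounded_linear_scaleC] X cvec.span_scale)
      moreover have "(\<lambda>n. g (c *\<^sub>C X n)) \<longlonglongrightarrow> c *\<^sub>C h x"
        unfolding g.scale by (intro bounded_linear.tendsto[OF bounded_linear_scaleC] lim X)
      ultimately have "h (c *\<^sub>C x) = c *\<^sub>C h x" by (rule LIMSEQ_unique)
      then show "R (c *\<^sub>C x) = c *\<^sub>C R x" using x by (simp add: R_def cvec.subspace_scale[OF sub])
    qed
  qed (simp add: R_def)
  moreover have "R (t i) = t' i" if "i \<in> I" for i
  proof -
    have "t i \<in> cvec.span B" using B(3) that by blast
    then show ?thesis using h(2) gt[OF that] subsetD[OF closure_subset, of "t i" "cvec.span B"] by (simp add: R_def)
  qed
  ultimately show ?thesis unfolding spB by blast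
qed

lemma op_tensor_spec:
  assumes H: "hilbert_space H" and K: "hilbert_space K" and S: "S \<in> bounded_ops H H'" and T: "T \<in> bounded_ops K K'"
  shows op_tensor_bounded: "op_tensor H K H' K' S T \<in> bounded_ops (hilbert_tensor H K) (hilbert_tensor H' K')"
    and op_tensor_apply: "x \<in> H \<Longrightarrow> y \<in> K \<Longrightarrow> op_tensor H K H' K' S T (x \<otimes>\<^sub>H y) = S x \<otimes>\<^sub>H T y"
proof -
  let ?P = "\<lambda>R. R \<in> bounded_ops (hilbert_tensor H K) (hilbert_tensor H' K') \<and>
        (\<forall>x\<in>H. \<forall>y\<in>K. R (x \<otimes>\<^sub>H y) = S x \<otimes>\<^sub>H T y)"
  obtain M where M: "M \<ge> 0" "\<And>x. norm (S x) \<le> M * norm x" using bounded_ops_bound[OF S] by metis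
  obtain N where N: "N \<ge> 0" "\<And>x. norm (T x) \<le> N * norm x" using bounded_ops_bound[OF T] by metis
  define t where "t = (\<lambda>(x, y). x \<otimes>\<^sub>H y :: ('a \<times> 'b) ell2)"
  define t' where "t' = (\<lambda>(x, y). S x \<otimes>\<^sub>H T y)"
  have "norm (\<Sum>i\<in>F. c i *\<^sub>C t' i) \<le> M * N * norm (\<Sum>i\<in>F. c i *\<^sub>C t i)"
    if F: "finite F" "F \<subseteq> H \<times> K" for F c
  proof -
    have "(\<Sum>i\<in>F. c i *\<^sub>C t' i) = (\<Sum>i\<in>F. S (c i *\<^sub>C fst i) \<otimes>\<^sub>H T (snd i))"
      using F(2) by (intro sum.cong)
        (auto simp: t'_def tensor_scale_left clinear_on_scale[OF bounded_ops_clinear[OF S]])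
    moreover have "(\<Sum>i\<in>F. c i *\<^sub>C t i) = (\<Sum>i\<in>F. (c i *\<^sub>C fst i) \<otimes>\<^sub>H snd i)"
      by (intro sum.cong) (auto simp: t_def tensor_scale_left)
    moreover have "c i *\<^sub>C fst i \<in> H" "snd i \<in> K" if "i \<in> F" for i
      using subsetD[OF F(2) that] by (auto simp: mem_Times_iff intro: cvec.subspace_scale[OF hilbert_space_subspace[OF H]])
    ultimately show ?thesis
      by (simp only:) (rule norm_tensor_sum_le[OF H bounded_ops_clinear[OF S] M(2,1) K bounded_ops_clinear[OF T] N(2,1)])
  qed
  then obtain R where R: "R \<in> bounded_ops (closure (cvec.span (t ` (H \<times> K)))) (closure (cvec.span (t' ` (H \<times> K))))"
    "\<forall>i\<in>H \<times> K. R (t i) = t' i"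
    using bounded_extension[of "H \<times> K" t' "M * N" t] by blast
  have "t ` (H \<times> K) = {x \<otimes>\<^sub>H y | x y. x \<in> H \<and> y \<in> K}" by (force simp: t_def)
  then have D: "closure (cvec.span (t ` (H \<times> K))) = hilbert_tensor H K" by (simp add: hilbert_tensor_def)
  have "t' ` (H \<times> K) \<subseteq> {x \<otimes>\<^sub>H y | x y. x \<in> H' \<and> y \<in> K'}"
    using bounded_ops_mem[OF S] bounded_ops_mem[OF T] by (force simp: t'_def)
  then have C: "closure (cvec.span (t' ` (H \<times> K))) \<subseteq> hilbert_tensor H' K'"
    unfolding hilbert_tensor_def by (intro closure_mono cvec.span_mono)
  have PR: "?P R" using R C unfolding D by (auto simp: bounded_ops_def t_def t'_def)
  have "\<exists>!R. ?P R"
  proof (rule ex1I[where a=R])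
    show "R' = R" if "?P R'" for R'
      using that PR by (intro bounded_ops_tensor_eqI[where R=R' and R'=R]) auto
  qed (rule PR)
  from theI'[OF this]
  show "op_tensor H K H' K' S T \<in> bounded_ops (hilbert_tensor H K) (hilbert_tensor H' K')"
    and "x \<in> H \<Longrightarrow> y \<in> K \<Longrightarrow> op_tensor H K H' K' S T (x \<otimes>\<^sub>H y) = S x \<otimes>\<^sub>H T y"
    unfolding op_tensor_def by blast+
qed

lemma op_tensor_eqI:
  assumes "hilbert_space H" "hilbert_space K" "S \<in> bounded_ops H H'" "T \<in> bounded_ops K K'"
    and "R \<in> bounded_ops (hilbert_tensor H K) L"
    and "\<And>x y. x \<in> H \<Longrightarrow> y \<in> K \<Longrightarrow> R (x \<otimes>\<^sub>H y) = S x \<otimes>\<^sub>H T y"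
  shows "R = op_tensor H K H' K' S T"
  by (rule bounded_ops_tensor_eqI[OF assms(5) op_tensor_bounded[OF assms(1-4)]])
     (simp add: assms(6) op_tensor_apply[OF assms(1-4)])

section \<open>Square-summable families and their functionals\<close>

definition sq_family :: "'h::chilbert_space set \<Rightarrow> ('j \<Rightarrow> 'h) \<Rightarrow> bool" where
  "sq_family H a \<longleftrightarrow> range a \<subseteq> H \<and> (\<lambda>j. (norm (a j))\<^sup>2) summable_on UNIV"

text \<open>With sequences as families these are the functionals \<open>T \<mapsto> \<Sum>n. \<langle>\<eta> n, T (\<xi> n)\<rangle>\<close> that generate the
  weak* topology.\<close>

definition vec_functional :: "('j \<Rightarrow> 'k::chilbert_space) \<Rightarrow> ('j \<Rightarrow> 'h::chilbert_space) \<Rightarrow> ('h \<Rightarrow> 'k) \<Rightarrow> complex" where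
  "vec_functional b a T = (\<Sum>\<^sub>\<infinity>j. cinner (b j) (T (a j)))"

lemma sq_family_mem: "sq_family H a \<Longrightarrow> a j \<in> H"
  by (auto simp: sq_family_def)

lemma sq_familyI:
  assumes "\<And>j. a j \<in> H" "\<And>F. finite F \<Longrightarrow> (\<Sum>j\<in>F. (norm (a j))\<^sup>2) \<le> C"
  shows "sq_family H a"
  unfolding sq_family_def
proof
  show "(\<lambda>j. (norm (a j))\<^sup>2) summable_on UNIV"
    by (rule nonneg_bdd_above_summable_on) (auto intro!: bdd_aboveI2 assms(2))
qed (use assms(1) in auto)

lemma square_summable_in_iff: "square_summable_in H \<xi> \<longleftrightarrow> sq_family H \<xi>"
proof -
  have "summable (\<lambda>n. (norm (\<xi> n))\<^sup>2) \<longleftrightarrow> (\<lambda>n. (norm (\<xi> n))\<^sup>2) summable_on UNIV"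
    by (simp add: summable_on_UNIV_nonneg_real_iff)
  then show ?thesis by (simp add: square_summable_in_def sq_family_def)
qed

lemma sq_family_mult_summable:
  assumes "sq_family H a" "sq_family K b"
  shows "(\<lambda>j. norm (b j) * norm (a j)) summable_on UNIV"
proof (rule summable_on_comparison_test)
  show "(\<lambda>j. (norm (b j))\<^sup>2 + (norm (a j))\<^sup>2) summable_on UNIV"
    using assms by (intro summable_on_add) (auto simp: sq_family_def)
  show "norm (b j) * norm (a j) \<le> (norm (b j))\<^sup>2 + (norm (a j))\<^sup>2" for j
  proof -
    have "2 * (norm (b j) * norm (a j)) \<le> (norm (b j))\<^sup>2 + (norm (a j))\<^sup>2"
      using sum_squares_bound[of "norm (b j)" "norm (a j)"] by (simp add: mult.assoc)
    moreover have "0 \<le> norm (b j) * norm (a j)" by simp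
    ultimately show ?thesis by linarith
  qed
qed simp

lemma cmod_cinner_le:
  assumes "\<And>x. norm (T x) \<le> M * norm x"
  shows "cmod (cinner y (T x)) \<le> M * (norm y * norm x)"
  using order_trans[OF cinner_cauchy_schwarz mult_left_mono[OF assms norm_ge_zero]]
  by (simp add: mult_ac)

lemma vec_functional_abs_summable:
  assumes a: "sq_family H a" and b: "sq_family K b" and T: "T \<in> bounded_ops H' K'"
  shows "(\<lambda>j. norm (cinner (b j) (T (a j)))) summable_on UNIV"
proof -
  obtain M where M: "\<And>x. norm (T x) \<le> M * norm x" using bounded_ops_bound[OF T] by metis
  show ?thesis
    by (rule summable_on_comparison_test[OF summable_on_cmult_right[OF sq_family_mult_summable[OF a b], of M]])
       (auto intro: cmod_cinner_le[OF M])
qed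

lemma vec_functional_summable:
  assumes "sq_family H a" "sq_family K b" "T \<in> bounded_ops H' K'"
  shows "(\<lambda>j. cinner (b j) (T (a j))) summable_on UNIV"
  by (rule abs_summable_summable[OF vec_functional_abs_summable[OF assms]])

lemma norm_vec_functional_le:
  assumes a: "sq_family H a" and b: "sq_family K b" and M: "\<And>x. norm (T x) \<le> M * norm x"
    and T: "T \<in> bounded_ops H' K'"
  shows "cmod (vec_functional b a T) \<le> M * (\<Sum>\<^sub>\<infinity>j. norm (b j) * norm (a j))"
proof -
  have "cmod (vec_functional b a T) \<le> (\<Sum>\<^sub>\<infinity>j. norm (cinner (b j) (T (a j))))"
    unfolding vec_functional_def by (rule norm_infsum_bound[OF vec_functional_abs_summable[OF a b T]])
  also have "\<dots> \<le> (\<Sum>\<^sub>\<infinity>j. M * (norm (b j) * norm (a j)))"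
    by (intro infsum_mono vec_functional_abs_summable[OF a b T] summable_on_cmult_right
        sq_family_mult_summable[OF a b] cmod_cinner_le[OF M])
  also have "\<dots> = M * (\<Sum>\<^sub>\<infinity>j. norm (b j) * norm (a j))" by (rule infsum_cmult_right')
  finally show ?thesis .
qed

lemma suminf_eq_vec_functional:
  fixes \<xi> :: "nat \<Rightarrow> 'h::chilbert_space" and \<eta> :: "nat \<Rightarrow> 'k::chilbert_space"
  assumes "sq_family H \<xi>" "sq_family K \<eta>" "T \<in> bounded_ops H' K'"
  shows "(\<Sum>n. cinner (\<eta> n) (T (\<xi> n))) = vec_functional \<eta> \<xi> T"
  using sums_unique[OF has_sum_imp_sums[OF has_sum_infsum[OF vec_functional_summable[OF assms]]]]
  by (simp add: vec_functional_def)

lemma clinear_vec_functional: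
  assumes "sq_family H a" "sq_family K b"
  shows "clinear_on (bounded_ops H' K') (vec_functional b a)"
  unfolding clinear_on_def vec_functional_def
  using vec_functional_summable[OF assms]
  by (auto simp: cinner_add_right scaleC_fun_def cinner_scaleC_right infsum_cmult_right' intro!: infsum_add)

lemma sq_family_image:
  assumes a: "sq_family H a" and R: "R \<in> bounded_ops H K"
  shows "sq_family K (\<lambda>j. R (a j))"
proof -
  obtain M where M: "\<And>x. norm (R x) \<le> M * norm x" using bounded_ops_bound[OF R] by metis
  have "(\<lambda>j. (norm (R (a j)))\<^sup>2) summable_on UNIV"
  proof (rule summable_on_comparison_test)
    show "(\<lambda>j. M\<^sup>2 * (norm (a j))\<^sup>2) summable_on UNIV"
      using a by (intro summable_on_cmult_right) (simp add: sq_family_def)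
    show "(norm (R (a j)))\<^sup>2 \<le> M\<^sup>2 * (norm (a j))\<^sup>2" for j
      using power_mono[OF M[of "a j"], of 2] by (simp add: power_mult_distrib)
  qed simp
  then show ?thesis using bounded_ops_mem[OF R sq_family_mem[OF a]] by (auto simp: sq_family_def)
qed

text \<open>The double sums below are checked row by row in this way.\<close>

lemma sq_family_prodI:
  fixes a :: "'i \<times> 'j \<Rightarrow> 'h::chilbert_space"
  assumes "\<And>p. a p \<in> H" and c: "c summable_on UNIV" "\<And>i. 0 \<le> c i"
    and le: "\<And>i F. finite F \<Longrightarrow> (\<Sum>j\<in>F. (norm (a (i, j)))\<^sup>2) \<le> c i"
  shows "sq_family H a"
proof (rule sq_familyI[OF assms(1)])
  fix F :: "('i \<times> 'j) set" assume F: "finite F"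
  have "(\<Sum>p\<in>F. (norm (a p))\<^sup>2) \<le> (\<Sum>p\<in>fst ` F \<times> snd ` F. (norm (a p))\<^sup>2)"
    using F by (intro sum_mono2) (auto intro: rev_image_eqI)
  also have "\<dots> = (\<Sum>i\<in>fst ` F. \<Sum>j\<in>snd ` F. (norm (a (i, j)))\<^sup>2)"
    by (simp add: sum.cartesian_product)
  also have "\<dots> \<le> (\<Sum>i\<in>fst ` F. c i)"
    using F by (intro sum_mono le) auto
  also have "\<dots> \<le> (\<Sum>\<^sub>\<infinity>i. c i)"
    using F by (intro finite_sum_le_infsum c) auto
  finally show "(\<Sum>p\<in>F. (norm (a p))\<^sup>2) \<le> (\<Sum>\<^sub>\<infinity>i. c i)" .
qed

text \<open>Renumbering along an injection, which turns families with countably many nonzero members into sequences.\<close>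

definition transport_family :: "'j set \<Rightarrow> ('j \<Rightarrow> 'i) \<Rightarrow> ('j \<Rightarrow> 'x::zero) \<Rightarrow> 'i \<Rightarrow> 'x" where
  "transport_family J f u = (\<lambda>n. if n \<in> f ` J then u (inv_into J f n) else 0)"

lemma transport_family_apply: "inj_on f J \<Longrightarrow> j \<in> J \<Longrightarrow> transport_family J f u (f j) = u j"
  and transport_family_outside: "n \<notin> f ` J \<Longrightarrow> transport_family J f u n = 0"
  by (simp_all add: transport_family_def)

lemma sq_family_transport:
  assumes inj: "inj_on f J" and L: "hilbert_space L" and u: "sq_family L u"
  shows "sq_family L (transport_family J f u)"
  unfolding sq_family_def
proof
  show "range (transport_family J f u) \<subseteq> L"
    using hilbert_space_zero[OF L] sq_family_mem[OF u] by (auto simp: transport_family_def)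
  have "(\<lambda>j. (norm (u j))\<^sup>2) summable_on J"
    by (rule summable_on_subset_banach[of _ UNIV]) (use u in \<open>auto simp: sq_family_def\<close>)
  then have "((\<lambda>n. (norm (transport_family J f u n))\<^sup>2) \<circ> f) summable_on J"
    by (rule summable_on_cong[THEN iffD1, rotated]) (simp add: transport_family_apply[OF inj])
  then have "(\<lambda>n. (norm (transport_family J f u n))\<^sup>2) summable_on f ` J"
    by (simp add: summable_on_reindex[OF inj])
  then show "(\<lambda>n. (norm (transport_family J f u n))\<^sup>2) summable_on UNIV"
    by (rule summable_on_cong_neutral[THEN iffD1, rotated -1]) (auto simp: transport_family_outside)
qed

text \<open>Only countably many members of a square-summable family are nonzero, so arbitrary index
  sets give no more functionals than sequences do. They save the renumbering of double sums.\<close>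

lemma vec_functional_as_sequence:
  assumes H: "hilbert_space H" and K: "hilbert_space K"
    and a: "sq_family H (a :: 'j \<Rightarrow> 'h::chilbert_space)" and b: "sq_family K (b :: 'j \<Rightarrow> 'k::chilbert_space)"
  shows "\<exists>(\<xi> :: nat \<Rightarrow> 'h) (\<eta> :: nat \<Rightarrow> 'k). sq_family H \<xi> \<and> sq_family K \<eta> \<and>
    (\<forall>T\<in>bounded_ops H K. vec_functional \<eta> \<xi> T = vec_functional b a T)"
proof -
  define J where "J = {j. a j \<noteq> 0}"
  have "countable {j\<in>UNIV. (norm (a j))\<^sup>2 \<noteq> 0}"
    by (rule summable_countable_real) (use a in \<open>simp add: sq_family_def\<close>)
  then have J: "countable J" by (simp add: J_def)
  define f where "f = to_nat_on J"
  have inj: "inj_on f J" unfolding f_def by (rule inj_on_to_nat_on[OF J])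
  note seq = transport_family_apply[OF inj] and seq0 = transport_family_outside[where f=f and J=J]
  let ?\<xi> = "transport_family J f a" and ?\<eta> = "transport_family J f b"
  have "vec_functional ?\<eta> ?\<xi> T = vec_functional b a T" if T: "T \<in> bounded_ops H K" for T
  proof -
    have T0: "T 0 = 0" by (rule clinear_on_zero[OF bounded_ops_clinear[OF T] hilbert_space_zero[OF H]])
    have "vec_functional ?\<eta> ?\<xi> T = (\<Sum>\<^sub>\<infinity>n\<in>f ` J. cinner (?\<eta> n) (T (?\<xi> n)))"
      unfolding vec_functional_def by (rule infsum_cong_neutral) (auto simp: seq0)
    also have "\<dots> = (\<Sum>\<^sub>\<infinity>j\<in>J. cinner (?\<eta> (f j)) (T (?\<xi> (f j))))"
      by (simp add: infsum_reindex[OF inj] o_def)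
    also have "\<dots> = (\<Sum>\<^sub>\<infinity>j\<in>J. cinner (b j) (T (a j)))"
      by (rule infsum_cong) (simp add: seq)
    also have "\<dots> = vec_functional b a T"
      unfolding vec_functional_def by (rule infsum_cong_neutral) (auto simp: J_def T0)
    finally show ?thesis .
  qed
  then show ?thesis using sq_family_transport[OF inj H a] sq_family_transport[OF inj K b] by blast
qed

section \<open>The weak* topology\<close>

lemma topspace_weak_star [simp]:
  assumes "hilbert_space H" "hilbert_space K"
  shows "topspace (weak_star H K) = bounded_ops H K"
proof
  show "topspace (weak_star H K) \<subseteq> bounded_ops H K"
    unfolding weak_star_def topology_generated_by_topspace by blast
  have "square_summable_in H (\<lambda>_. 0)" "square_summable_in K (\<lambda>_. 0)"
    using assms by (auto simp: square_summable_in_def hilbert_space_zero)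
  then have "bounded_ops H K \<in> {{T \<in> bounded_ops H K. (\<Sum>n. cinner (\<eta> n) (T (\<xi> n))) \<in> G} | \<xi> \<eta> G.
        square_summable_in H \<xi> \<and> square_summable_in K \<eta> \<and> open G}"
    using open_UNIV by (intro CollectI exI[of _ "\<lambda>_. 0"] exI[of _ UNIV]) auto
  then show "bounded_ops H K \<subseteq> topspace (weak_star H K)"
    unfolding weak_star_def topology_generated_by_topspace by blast
qed

lemma continuous_map_vec_functional:
  fixes H :: "'h::chilbert_space set" and K :: "'k::chilbert_space set"
  assumes "hilbert_space H" "hilbert_space K" "sq_family H a" "sq_family K b"
  shows "continuous_map (weak_star H K) euclidean (vec_functional b a)"
proof -
  obtain \<xi> :: "nat \<Rightarrow> 'h" and \<eta> :: "nat \<Rightarrow> 'k" where s: "sq_family H \<xi>" "sq_family K \<eta>"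
    "\<And>T. T \<in> bounded_ops H K \<Longrightarrow> vec_functional \<eta> \<xi> T = vec_functional b a T"
    using vec_functional_as_sequence[OF assms] by blast
  have "continuous_map (weak_star H K) euclidean (vec_functional \<eta> \<xi>)"
    unfolding continuous_map
  proof (intro conjI allI impI)
    fix G :: "complex set" assume "openin euclidean G"
    then have "open G" by simp
    have "{T \<in> bounded_ops H K. (\<Sum>n. cinner (\<eta> n) (T (\<xi> n))) \<in> G} = {T \<in> bounded_ops H K. vec_functional \<eta> \<xi> T \<in> G}"
      using suminf_eq_vec_functional[OF s(1,2)] by auto
    then have "openin (weak_star H K) {T \<in> bounded_ops H K. vec_functional \<eta> \<xi> T \<in> G}"
      unfolding weak_star_def using s(1,2) \<open>open G\<close>
      by (intro topology_generated_by_Basis) (auto simp: square_summable_in_iff)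
    then show "openin (weak_star H K) {T \<in> topspace (weak_star H K). vec_functional \<eta> \<xi> T \<in> G}" using assms by simp
  qed simp
  then show ?thesis by (rule continuous_map_eq) (simp add: s(3) assms)
qed

text \<open>The weak* topology is initial for its functionals, so continuity into it is tested on
  them. Together with the continuity of the functionals of all families this reduces every
  continuity proof to rewriting \<open>vec_functional \<eta> \<xi> (F T)\<close> as the functional of another family at \<open>T\<close>.\<close>

lemma continuous_map_into_weak_star:
  assumes H: "hilbert_space H" and K: "hilbert_space K"
    and F: "\<And>x. x \<in> topspace X \<Longrightarrow> F x \<in> bounded_ops H K"
    and c: "\<And>\<xi> \<eta>. sq_family H (\<xi> :: nat \<Rightarrow> _) \<Longrightarrow> sq_family K \<eta> \<Longrightarrow> continuous_map X euclidean (\<lambda>x. vec_functional \<eta> \<xi> (F x))"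
  shows "continuous_map X (weak_star H K) F"
  unfolding weak_star_def
proof (rule continuous_on_generated_topo)
  fix U assume "U \<in> {{T \<in> bounded_ops H K. (\<Sum>n. cinner (\<eta> n) (T (\<xi> n))) \<in> G} | \<xi> \<eta> G.
        square_summable_in H \<xi> \<and> square_summable_in K \<eta> \<and> open G}"
  then obtain \<xi> \<eta> G where U: "U = {T \<in> bounded_ops H K. (\<Sum>n. cinner (\<eta> n) (T (\<xi> n))) \<in> G}"
    and s: "sq_family H \<xi>" "sq_family K \<eta>" and G: "open G"
    unfolding square_summable_in_iff by blast
  have "F -` U \<inter> topspace X = {x \<in> topspace X. vec_functional \<eta> \<xi> (F x) \<in> G}"
    using F suminf_eq_vec_functional[OF s F] by (auto simp: U)
  moreover have "openin X \<dots>"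
    by (rule openin_continuous_map_preimage[OF c[OF s]]) (simp add: G)
  ultimately show "openin X (F -` U \<inter> topspace X)" by simp
next
  show "F ` topspace X \<subseteq> \<Union>{{T \<in> bounded_ops H K. (\<Sum>n. cinner (\<eta> n) (T (\<xi> n))) \<in> G} | \<xi> \<eta> G.
        square_summable_in H \<xi> \<and> square_summable_in K \<eta> \<and> open G}"
    using F topspace_weak_star[OF H K] unfolding weak_star_def topology_generated_by_topspace by auto
qed

text \<open>Separate continuity of addition is enough: \<open>V + V \<subseteq> V\<close> gives \<open>V\<^sup>c + V \<subseteq> V\<^sup>c\<close> for the
  closure \<open>V\<^sup>c\<close>, and this in turn gives \<open>V\<^sup>c + V\<^sup>c \<subseteq> V\<^sup>c\<close>.\<close>

lemma weak_star_closure_subspace: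
  fixes H :: "'h::chilbert_space set" and K :: "'k::chilbert_space set"
  assumes H: "hilbert_space H" and K: "hilbert_space K" and V: "cvec.subspace V" "V \<subseteq> bounded_ops H K"
  shows "cvec.subspace (weak_star H K closure_of V)" (is "cvec.subspace ?C")
proof -
  have sub: "cvec.subspace (bounded_ops H K)" by (rule subspace_bounded_ops[OF hilbert_space_subspace[OF K]])
  have C: "?C \<subseteq> bounded_ops H K" using closure_of_subset_topspace[of "weak_star H K" V] H K by simp
  have add: "continuous_map (weak_star H K) (weak_star H K) (\<lambda>T. T + S)" if S: "S \<in> bounded_ops H K" for S
  proof (rule continuous_map_into_weak_star[OF H K])
    fix \<xi> :: "nat \<Rightarrow> 'h" and \<eta> :: "nat \<Rightarrow> 'k" assume s: "sq_family H \<xi>" "sq_family K \<eta>"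
    have "continuous_map (weak_star H K) euclidean (\<lambda>T. vec_functional \<eta> \<xi> T + vec_functional \<eta> \<xi> S)"
      by (intro continuous_map_add continuous_map_vec_functional H K s) simp
    then show "continuous_map (weak_star H K) euclidean (\<lambda>T. vec_functional \<eta> \<xi> (T + S))"
      by (rule continuous_map_eq) (simp add: H K clinear_on_add[OF clinear_vec_functional[OF s]] S)
  qed (use H K in \<open>simp add: cvec.subspace_add[OF sub] S\<close>)
  have scale: "continuous_map (weak_star H K) (weak_star H K) (\<lambda>T. c *\<^sub>C T)" for c
  proof (rule continuous_map_into_weak_star[OF H K])
    fix \<xi> :: "nat \<Rightarrow> 'h" and \<eta> :: "nat \<Rightarrow> 'k" assume s: "sq_family H \<xi>" "sq_family K \<eta>"
    have "continuous_map (weak_star H K) euclidean (\<lambda>T. c * vec_functional \<eta> \<xi> T)"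
      using continuous_map_compose[OF continuous_map_vec_functional[OF H K s], of euclidean "\<lambda>z. c * z"]
      by (simp add: o_def continuous_on_mult_left)
    then show "continuous_map (weak_star H K) euclidean (\<lambda>T. vec_functional \<eta> \<xi> (c *\<^sub>C T))"
      by (rule continuous_map_eq) (simp add: H K clinear_on_scale[OF clinear_vec_functional[OF s]])
  qed (use H K in \<open>simp add: cvec.subspace_scale[OF sub]\<close>)
  have VC: "V \<subseteq> ?C" by (rule closure_of_subset) (use V H K in simp)
  have add1: "T + S \<in> ?C" if "T \<in> ?C" "S \<in> V" for T S
  proof -
    have "(\<lambda>T. T + S) ` ?C \<subseteq> weak_star H K closure_of ((\<lambda>T. T + S) ` V)"
      using that V by (intro continuous_map_image_closure_subset add) auto
    also have "\<dots> \<subseteq> ?C" using cvec.subspace_add[OF V(1)] that by (intro closure_of_mono) auto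
    finally show ?thesis using that by blast
  qed
  show ?thesis
  proof (rule cvec.subspaceI)
    show "0 \<in> ?C" using cvec.subspace_0[OF V(1)] VC by blast
  next
    fix T S assume TS: "T \<in> ?C" "S \<in> ?C"
    have "(\<lambda>S. S + T) ` ?C \<subseteq> weak_star H K closure_of ((\<lambda>S. S + T) ` V)"
      using TS C by (intro continuous_map_image_closure_subset add) auto
    also have "\<dots> \<subseteq> weak_star H K closure_of ?C"
      using add1[OF TS(1)] by (intro closure_of_mono) (auto simp: add.commute)
    finally show "T + S \<in> ?C" using TS(2) by (auto simp: add.commute)
  next
    fix c T assume T: "T \<in> ?C"
    have "(\<lambda>T. c *\<^sub>C T) ` ?C \<subseteq> weak_star H K closure_of ((\<lambda>T. c *\<^sub>C T) ` V)"
      by (rule continuous_map_image_closure_subset[OF scale])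
    also have "\<dots> \<subseteq> ?C" using cvec.subspace_scale[OF V(1)] by (intro closure_of_mono) auto
    finally show "c *\<^sub>C T \<in> ?C" using T by blast
  qed
qed

text \<open>The operators that \<open>F\<close> maps into \<open>W\<close> form a weak* closed subspace. Membership in a weak*
  closed tensor product is passed on in this way, from the behaviour of \<open>F\<close> on generators.\<close>

lemma weak_star_closed_span_induct:
  assumes F: "continuous_map (weak_star H K) (weak_star H' K') F" "clinear_on (bounded_ops H K) F"
    and G: "G \<subseteq> bounded_ops H K" and H: "hilbert_space H" and K: "hilbert_space K" and W: "weak_star_closed_subspace H' K' W"
    and g: "\<And>S. S \<in> G \<Longrightarrow> F S \<in> W" and T: "T \<in> weak_star H K closure_of cvec.span G"
  shows "F T \<in> W"
proof -
  have sub: "cvec.subspace (bounded_ops H K)" by (rule subspace_bounded_ops[OF hilbert_space_subspace[OF K]])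
  have W': "cvec.subspace W" "closedin (weak_star H' K') W"
    using W by (auto simp: weak_star_closed_subspace_def)
  let ?P = "{T \<in> bounded_ops H K. F T \<in> W}"
  have "cvec.subspace ?P"
    by (rule cvec.subspaceI)
       (auto simp: cvec.subspace_0[OF sub] cvec.subspace_add[OF sub] cvec.subspace_scale[OF sub]
         clinear_on_zero[OF F(2)] clinear_on_add[OF F(2)] clinear_on_scale[OF F(2)]
         cvec.subspace_0[OF W'(1)] cvec.subspace_add[OF W'(1)] cvec.subspace_scale[OF W'(1)])
  then have "cvec.span G \<subseteq> ?P" using G g by (intro cvec.span_minimal) auto
  moreover have "closedin (weak_star H K) ?P"
    using closedin_continuous_map_preimage[OF F(1) W'(2)] H K by simp
  ultimately have "weak_star H K closure_of cvec.span G \<subseteq> ?P" by (rule closure_of_minimal)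
  then show ?thesis using T by blast
qed

lemma clinear_sandwich:
  assumes K: "hilbert_space K" and P: "P \<in> bounded_ops K K'"
  shows "clinear_on (bounded_ops H K) (\<lambda>T. P \<circ> T \<circ> Q)"
proof -
  have mem: "T y \<in> K" if "T \<in> bounded_ops H K" for T y
    using that bounded_ops_mem bounded_ops_outside hilbert_space_zero[OF K] by metis
  show ?thesis
    using bounded_ops_clinear[OF P] mem
    by (auto simp: clinear_on_def fun_eq_iff scaleC_fun_def)
qed

text \<open>Both factors move into the vectors: \<open>\<langle>\<eta>, P T Q \<xi>\<rangle> = \<langle>P\<^sup>* \<eta>, T (Q \<xi>)\<rangle>\<close>.\<close>

lemma continuous_map_sandwich:
  fixes H' :: "'c::chilbert_space set" and K' :: "'d::chilbert_space set"
  assumes H: "hilbert_space H" and K: "hilbert_space K" and H': "hilbert_space H'" and K': "hilbert_space K'"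
    and P: "P \<in> bounded_ops K K'" and Q: "Q \<in> bounded_ops H' H"
  shows "continuous_map (weak_star H K) (weak_star H' K') (\<lambda>T. P \<circ> T \<circ> Q)"
proof (rule continuous_map_into_weak_star[OF H' K'])
  show "P \<circ> T \<circ> Q \<in> bounded_ops H' K'" if "T \<in> topspace (weak_star H K)" for T
    using that H K by (intro bounded_ops_comp[OF H] bounded_ops_comp[OF K] P Q) simp
  obtain P' where P': "P' \<in> bounded_ops K' K" "\<And>x y. x \<in> K \<Longrightarrow> y \<in> K' \<Longrightarrow> cinner (P' y) x = cinner y (P x)"
    using adjoint_exists[OF K K' P] by blast
  fix \<xi> :: "nat \<Rightarrow> 'c" and \<eta> :: "nat \<Rightarrow> 'd" assume s: "sq_family H' \<xi>" "sq_family K' \<eta>"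
  have "continuous_map (weak_star H K) euclidean (vec_functional (\<lambda>n. P' (\<eta> n)) (\<lambda>n. Q (\<xi> n)))"
    by (intro continuous_map_vec_functional H K sq_family_image[OF s(1) Q] sq_family_image[OF s(2) P'(1)])
  then show "continuous_map (weak_star H K) euclidean (\<lambda>T. vec_functional \<eta> \<xi> (P \<circ> T \<circ> Q))"
    by (rule continuous_map_eq)
       (auto simp: H K vec_functional_def P'(2) bounded_ops_mem bounded_ops_mem[OF Q] sq_family_mem[OF s(1)]
         sq_family_mem[OF s(2)] intro!: infsum_cong)
qed

section \<open>Amplification is weak* continuous\<close>

text \<open>The slice of \<open>\<zeta>\<close> at \<open>e\<close> is the coefficient of \<open>e\<close> when \<open>\<zeta>\<close> is expanded along the second
  leg. It is given by the adjoint of \<open>x \<mapsto> x \<otimes> e\<close>.\<close>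

lemma slice_vec_exists:
  assumes "hilbert_space H"
  shows "\<exists>L\<in>bounded_ops (UNIV :: ('h::chilbert_space \<times> 'k::chilbert_space) ell2 set) H.
    \<forall>\<zeta>. \<forall>x\<in>H. cinner (L \<zeta>) x = cinner \<zeta> (x \<otimes>\<^sub>H e)"
proof -
  define V where "V x = (if x \<in> H then x \<otimes>\<^sub>H e else 0)" for x
  have "V \<in> bounded_ops H UNIV"
    by (rule bounded_opsI[where M="norm e"])
       (use hilbert_space_subspace[OF assms] in \<open>auto simp: V_def clinear_on_def norm_tensor tensor_add_left
         tensor_scale_left cvec.subspace_add cvec.subspace_scale\<close>)
  from adjoint_exists[OF assms hilbert_space_UNIV this] show ?thesis by (auto simp: V_def)
qed

definition slice_vec :: "'h::chilbert_space set \<Rightarrow> 'k::chilbert_space \<Rightarrow> ('h \<times> 'k) ell2 \<Rightarrow> 'h" where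
  "slice_vec H e = (SOME L. L \<in> bounded_ops UNIV H \<and> (\<forall>\<zeta>. \<forall>x\<in>H. cinner (L \<zeta>) x = cinner \<zeta> (x \<otimes>\<^sub>H e)))"

lemma slice_vec_bounded: "hilbert_space H \<Longrightarrow> slice_vec H e \<in> bounded_ops UNIV H"
  and cinner_slice_vec: "hilbert_space H \<Longrightarrow> x \<in> H \<Longrightarrow> cinner (slice_vec H e \<zeta>) x = cinner \<zeta> (x \<otimes>\<^sub>H e)"
proof -
  assume H: "hilbert_space H"
  have "\<exists>L :: ('a \<times> 'b) ell2 \<Rightarrow> 'a. L \<in> bounded_ops UNIV H \<and> (\<forall>\<zeta>. \<forall>x\<in>H. cinner (L \<zeta>) x = cinner \<zeta> (x \<otimes>\<^sub>H e))"
    using slice_vec_exists[OF H] by blast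
  from someI_ex[OF this, folded slice_vec_def]
  show "slice_vec H e \<in> bounded_ops UNIV H"
    and "x \<in> H \<Longrightarrow> cinner (slice_vec H e \<zeta>) x = cinner \<zeta> (x \<otimes>\<^sub>H e)" by blast+
qed

lemma slice_vec_tensor:
  assumes H: "hilbert_space H" and x: "x \<in> H"
  shows "slice_vec H e (x \<otimes>\<^sub>H y) = cinner e y *\<^sub>C x"
proof (rule cinner_eqD[OF H])
  show "slice_vec H e (x \<otimes>\<^sub>H y) \<in> H" by (rule bounded_ops_mem[OF slice_vec_bounded[OF H]]) simp
  show "cinner e y *\<^sub>C x \<in> H" by (rule cvec.subspace_scale[OF hilbert_space_subspace[OF H] x])
  fix z assume z: "z \<in> H"
  have "cinner z (slice_vec H e (x \<otimes>\<^sub>H y)) = cnj (cinner (x \<otimes>\<^sub>H y) (z \<otimes>\<^sub>H e))"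
    by (simp add: cinner_slice_vec[OF H z, symmetric] cinner_commute[of z])
  also have "\<dots> = cinner z (cinner e y *\<^sub>C x)"
    by (simp add: cinner_tensor cinner_scaleC_right cinner_commute[of x z] cinner_commute[of y e])
  finally show "cinner z (slice_vec H e (x \<otimes>\<^sub>H y)) = cinner z (cinner e y *\<^sub>C x)" .
qed

text \<open>The tensor \<open>p = \<Sum>e\<in>F. L\<^sub>e \<zeta> \<otimes> e\<close> with the slices \<open>L\<^sub>e \<zeta>\<close> of \<open>\<zeta>\<close> is a projection of \<open>\<zeta>\<close>,
  since \<open>\<langle>\<zeta>, p\<rangle> = \<langle>p, p\<rangle>\<close>.\<close>

lemma slice_vec_bessel:
  assumes H: "hilbert_space H" and E: "orthonormal E" "finite F" "F \<subseteq> E"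
  shows "(\<Sum>e\<in>F. (norm (slice_vec H e \<zeta>))\<^sup>2) \<le> (norm \<zeta>)\<^sup>2"
proof -
  define p where "p = (\<Sum>e\<in>F. slice_vec H e \<zeta> \<otimes>\<^sub>H e)"
  define s where "s = (\<Sum>e\<in>F. (norm (slice_vec H e \<zeta>))\<^sup>2)"
  have mem: "slice_vec H e \<zeta> \<in> H" for e
    by (rule bounded_ops_mem[OF slice_vec_bounded[OF H]]) simp
  have "cinner p p = (\<Sum>e\<in>F. \<Sum>f\<in>F. cinner (slice_vec H e \<zeta>) (slice_vec H f \<zeta>) * cinner e f)"
    unfolding p_def by (simp add: cinner_sum_left cinner_sum_right cinner_tensor) (rule sum.swap)
  also have "\<dots> = (\<Sum>e\<in>F. \<Sum>f\<in>F. if e = f then cinner (slice_vec H e \<zeta>) (slice_vec H e \<zeta>) else 0)"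
    using E by (intro sum.cong refl) (auto simp: orthonormal_def subset_eq)
  also have "\<dots> = complex_of_real s"
    using E(2) by (simp add: s_def cinner_self)
  finally have pp: "(norm p)\<^sup>2 = s" by (simp only: cinner_self of_real_eq_iff)
  have "cinner \<zeta> p = (\<Sum>e\<in>F. cinner (slice_vec H e \<zeta>) (slice_vec H e \<zeta>))"
    unfolding p_def by (simp add: cinner_sum_right cinner_slice_vec[OF H mem])
  also have "\<dots> = complex_of_real s" by (simp add: s_def cinner_self)
  finally have "cmod (cinner \<zeta> p) = \<bar>s\<bar>" by (simp only: norm_of_real)
  then have "cmod (cinner \<zeta> p) = s" by (simp add: s_def sum_nonneg)
  then have "norm p * norm p \<le> norm \<zeta> * norm p"
    using cinner_cauchy_schwarz[of \<zeta> p] pp by (simp add: power2_eq_square)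
  then have "norm p \<le> norm \<zeta>" by (cases "norm p = 0") auto
  then have "(norm p)\<^sup>2 \<le> (norm \<zeta>)\<^sup>2" by (intro power_mono) auto
  then show ?thesis using pp by (simp add: s_def)
qed

text \<open>Outside \<open>E\<close> the family is 0, so that sums over the basis become sums over the whole type.\<close>

definition slice_family :: "'h::chilbert_space set \<Rightarrow> 'k::chilbert_space set \<Rightarrow> ('h \<times> 'k) ell2 \<Rightarrow> 'k \<Rightarrow> 'h" where
  "slice_family H E \<zeta> e = (if e \<in> E then slice_vec H e \<zeta> else 0)"

lemma slice_family_mem: "hilbert_space H \<Longrightarrow> slice_family H E \<zeta> e \<in> H"
  using bounded_ops_mem[OF slice_vec_bounded] by (auto simp: slice_family_def hilbert_space_zero)

lemma slice_family_bessel: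
  assumes H: "hilbert_space H" and E: "orthonormal E" and F: "finite F"
  shows "(\<Sum>e\<in>F. (norm (slice_family H E \<zeta> e))\<^sup>2) \<le> (norm \<zeta>)\<^sup>2"
proof -
  have "(\<Sum>e\<in>F. (norm (slice_family H E \<zeta> e))\<^sup>2) = (\<Sum>e\<in>F \<inter> E. (norm (slice_vec H e \<zeta>))\<^sup>2)"
    using F by (intro sum.mono_neutral_cong_right) (auto simp: slice_family_def)
  also have "\<dots> \<le> (norm \<zeta>)\<^sup>2" using F by (intro slice_vec_bessel[OF H E]) auto
  finally show ?thesis .
qed

lemma sq_family_slice: "hilbert_space H \<Longrightarrow> orthonormal E \<Longrightarrow> sq_family H (slice_family H E \<zeta>)"
  by (rule sq_familyI[where C="(norm \<zeta>)\<^sup>2"]) (auto intro: slice_family_mem slice_family_bessel)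

lemma slice_family_mult_le:
  assumes H: "hilbert_space H" and K: "hilbert_space K" and E: "orthonormal E"
  shows "(\<Sum>\<^sub>\<infinity>e. norm (slice_family K E \<eta> e) * norm (slice_family H E \<zeta> e)) \<le> norm \<eta> * norm \<zeta>"
proof (rule infsum_le_finite_sums[OF sq_family_mult_summable[OF sq_family_slice[OF H E] sq_family_slice[OF K E]]])
  fix F :: "'c set" assume F: "finite F"
  have l2: "L2_set (\<lambda>e. norm (slice_family L E \<xi> e)) F \<le> norm \<xi>" if "hilbert_space L" for L :: "'x::chilbert_space set" and \<xi>
    unfolding L2_set_def by (rule real_le_lsqrt) (auto intro: slice_family_bessel that E F)
  have "(\<Sum>e\<in>F. norm (slice_family K E \<eta> e) * norm (slice_family H E \<zeta> e))
      \<le> L2_set (\<lambda>e. norm (slice_family K E \<eta> e)) F * L2_set (\<lambda>e. norm (slice_family H E \<zeta> e)) F"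
    using L2_set_mult_ineq[of "\<lambda>e. norm (slice_family K E \<eta> e)" "\<lambda>e. norm (slice_family H E \<zeta> e)" F] by simp
  also have "\<dots> \<le> norm \<eta> * norm \<zeta>" by (intro mult_mono l2 H K) (auto simp: L2_set_nonneg)
  finally show "(\<Sum>e\<in>F. norm (slice_family K E \<eta> e) * norm (slice_family H E \<zeta> e)) \<le> norm \<eta> * norm \<zeta>" .
qed

lemma clinear_cinner_op: "T \<in> bounded_ops H K \<Longrightarrow> clinear_on H (\<lambda>x. cinner y (T x))"
  by (drule bounded_ops_clinear) (auto simp: clinear_on_def cinner_add_right cinner_scaleC_right)

lemma continuous_on_cinner_op:
  assumes "hilbert_space H" "T \<in> bounded_ops H K"
  shows "continuous_on H (\<lambda>x. cinner y (T x))"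
  using continuous_on_compose2[OF linear_continuous_on[OF bounded_linear_cinner_right, of UNIV y]
      bounded_ops_continuous_on[OF hilbert_space_subspace[OF assms(1)] assms(2)]] by simp

text \<open>In an orthonormal basis of the second leg \<open>A \<otimes> 1\<close> acts on every coefficient by \<open>A\<close>. For
  \<open>\<zeta> = x \<otimes> y\<close> the identity is the expansion of \<open>y\<close>; both sides are bounded linear in \<open>\<zeta>\<close>, which
  gives the general case. Its use is that it shows a functional of \<open>A \<otimes> 1\<close> as one of \<open>A\<close>.\<close>

lemma cinner_amplification:
  fixes E :: "'k::chilbert_space set"
  assumes H: "hilbert_space H" and H': "hilbert_space H'" and K: "hilbert_space K"
    and A: "A \<in> bounded_ops H H'"
    and E: "orthonormal E" "\<And>x. (\<And>e. e \<in> E \<Longrightarrow> cinner e x = 0) \<Longrightarrow> x = 0"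
    and \<zeta>: "\<zeta> \<in> hilbert_tensor H K"
  shows "vec_functional (slice_family H' E \<eta>) (slice_family H E \<zeta>) A = cinner \<eta> (op_tensor H K H' K A (id_op K) \<zeta>)"
proof -
  let ?b = "slice_family H' E \<eta>" and ?a = "slice_family H E"
  let ?A = "op_tensor H K H' K A (id_op K)"
  note htsub = hilbert_space_subspace[OF hilbert_space_tensor[of H K]]
  have Ab: "?A \<in> bounded_ops (hilbert_tensor H K) (hilbert_tensor H' K)"
    by (rule op_tensor_bounded[OF H K A id_op_bounded[OF K]])
  obtain M where M: "M \<ge> 0" "\<And>x. norm (A x) \<le> M * norm x" using bounded_ops_bound[OF A] by metis
  note summ = vec_functional_summable[OF sq_family_slice[OF H E(1)] sq_family_slice[OF H' E(1)] A]
  have L_mem: "slice_vec H e x \<in> H" for e and x :: "('a \<times> 'k) ell2"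
    by (rule bounded_ops_mem[OF slice_vec_bounded[OF H]]) simp
  have L_add: "slice_vec H e (x + y) = slice_vec H e x + slice_vec H e y"
    and L_scale: "slice_vec H e (c *\<^sub>C x) = c *\<^sub>C slice_vec H e x" for e c and x y :: "('a \<times> 'k) ell2"
    using bounded_ops_clinear[OF slice_vec_bounded[OF H, of e]] by (auto simp: clinear_on_def)
  have A0: "A 0 = 0" by (rule clinear_on_zero[OF bounded_ops_clinear[OF A] hilbert_space_zero[OF H]])
  have l1: "clinear_on (hilbert_tensor H K) (\<lambda>\<zeta>. vec_functional ?b (?a \<zeta>) A)"
    unfolding clinear_on_def
  proof (intro conjI ballI allI)
    fix x y :: "('a \<times> 'k) ell2"
    have "A (?a (x + y) e) = A (?a x e) + A (?a y e)" for e
      by (simp add: slice_family_def L_add clinear_on_add[OF bounded_ops_clinear[OF A] L_mem L_mem] A0)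
    then show "vec_functional ?b (?a (x + y)) A = vec_functional ?b (?a x) A + vec_functional ?b (?a y) A"
      by (simp add: vec_functional_def cinner_add_right infsum_add[OF summ summ])
  next
    fix c and x :: "('a \<times> 'k) ell2"
    have "A (?a (c *\<^sub>C x) e) = c *\<^sub>C A (?a x e)" for e
      by (simp add: slice_family_def L_scale clinear_on_scale[OF bounded_ops_clinear[OF A] L_mem] A0)
    then show "vec_functional ?b (?a (c *\<^sub>C x)) A = c *\<^sub>C vec_functional ?b (?a x) A"
      by (simp add: vec_functional_def cinner_scaleC_right infsum_cmult_right')
  qed
  have c1: "continuous_on (hilbert_tensor H K) (\<lambda>\<zeta>. vec_functional ?b (?a \<zeta>) A)"
  proof (rule bounded_clinear_continuous_on[OF htsub l1])
    fix x :: "('a \<times> 'k) ell2"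
    have "cmod (vec_functional ?b (?a x) A) \<le> M * (\<Sum>\<^sub>\<infinity>e. norm (?b e) * norm (?a x e))"
      by (rule norm_vec_functional_le[OF sq_family_slice[OF H E(1)] sq_family_slice[OF H' E(1)] M(2) A])
    also have "\<dots> \<le> M * (norm \<eta> * norm x)"
      by (intro mult_left_mono slice_family_mult_le H H' E M)
    finally show "cmod (vec_functional ?b (?a x) A) \<le> (M * norm \<eta>) * norm x" by (simp add: mult.assoc)
  qed
  note l2 = clinear_cinner_op[OF Ab, of \<eta>] and c2 = continuous_on_cinner_op[OF hilbert_space_tensor Ab, of \<eta>]
  have "vec_functional ?b (?a (x \<otimes>\<^sub>H y)) A = cinner \<eta> (?A (x \<otimes>\<^sub>H y))" if x: "x \<in> H" and y: "y \<in> K" for x y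
  proof -
    have Ax: "A x \<in> H'" by (rule bounded_ops_mem[OF A x])
    have bl: "bounded_linear (\<lambda>k. cinner \<eta> (A x \<otimes>\<^sub>H k))"
    proof (rule bounded_linear_intro[where K="norm \<eta> * norm (A x)"])
      show "norm (cinner \<eta> (A x \<otimes>\<^sub>H k)) \<le> norm k * (norm \<eta> * norm (A x))" for k
        using cinner_cauchy_schwarz[of \<eta> "A x \<otimes>\<^sub>H k"] by (simp add: norm_tensor mult_ac)
    qed (simp_all add: tensor_add_right cinner_add_right scaleR_scaleC tensor_scale_right
        cinner_scaleC_right scaleR_conv_of_real)
    have "((\<lambda>e. cinner \<eta> (A x \<otimes>\<^sub>H (cinner e y *\<^sub>C e))) has_sum cinner \<eta> (A x \<otimes>\<^sub>H y)) E"
      by (rule has_sum_bounded_linear[OF bl orthonormal_expansion[OF E]])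
    moreover have "cinner \<eta> (A x \<otimes>\<^sub>H (cinner e y *\<^sub>C e)) = cinner (?b e) (A (?a (x \<otimes>\<^sub>H y) e))" if "e \<in> E" for e
      using that by (simp add: slice_family_def slice_vec_tensor[OF H x] clinear_on_scale[OF bounded_ops_clinear[OF A] x]
          cinner_scaleC_right cinner_slice_vec[OF H' Ax] tensor_scale_right)
    ultimately have "((\<lambda>e. cinner (?b e) (A (?a (x \<otimes>\<^sub>H y) e))) has_sum cinner \<eta> (A x \<otimes>\<^sub>H y)) E"
      by (subst has_sum_cong[where g="\<lambda>e. cinner \<eta> (A x \<otimes>\<^sub>H (cinner e y *\<^sub>C e))"]) auto
    then have "((\<lambda>e. cinner (?b e) (A (?a (x \<otimes>\<^sub>H y) e))) has_sum cinner \<eta> (A x \<otimes>\<^sub>H y)) UNIV"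
      by (rule has_sum_cong_neutral[THEN iffD1, rotated -1]) (auto simp: slice_family_def)
    then have "vec_functional ?b (?a (x \<otimes>\<^sub>H y)) A = cinner \<eta> (A x \<otimes>\<^sub>H y)"
      unfolding vec_functional_def by (rule infsumI)
    then show ?thesis
      unfolding op_tensor_apply[OF H K A id_op_bounded[OF K] x y] by (simp add: id_op_def y)
  qed
  then show ?thesis by (rule hilbert_tensor_eqI[OF l1 c1 l2 c2 _ \<zeta>])
qed

text \<open>A functional \<open>\<Sum>n. \<langle>\<eta> n, (A \<otimes> 1) (\<xi> n)\<rangle>\<close> is the functional of the families of all slices of
  the \<open>\<xi> n\<close> and \<open>\<eta> n\<close>, indexed by \<open>n\<close> and the basis. Those are square summable by Bessel's
  inequality.\<close>

lemma continuous_map_amplification: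
  fixes H :: "'h::chilbert_space set" and H' :: "'g::chilbert_space set" and K :: "'k::chilbert_space set"
  assumes H: "hilbert_space H" and H': "hilbert_space H'" and K: "hilbert_space K"
  shows "continuous_map (weak_star H H') (weak_star (hilbert_tensor H K) (hilbert_tensor H' K))
    (\<lambda>A. op_tensor H K H' K A (id_op K))"
proof (rule continuous_map_into_weak_star[OF hilbert_space_tensor hilbert_space_tensor])
  show "op_tensor H K H' K A (id_op K) \<in> bounded_ops (hilbert_tensor H K) (hilbert_tensor H' K)"
    if "A \<in> topspace (weak_star H H')" for A
    using that H H' by (intro op_tensor_bounded H K id_op_bounded) simp
  fix \<xi> :: "nat \<Rightarrow> ('h \<times> 'k) ell2" and \<eta> :: "nat \<Rightarrow> ('g \<times> 'k) ell2"
  assume s: "sq_family (hilbert_tensor H K) \<xi>" "sq_family (hilbert_tensor H' K) \<eta>"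
  obtain E :: "'k set" where E: "orthonormal E"
    "\<And>x. (\<And>e. e \<in> E \<Longrightarrow> cinner e x = 0) \<Longrightarrow> x = 0"
    using maximal_orthonormal_exists by blast
  define a where "a = (\<lambda>(n, e). slice_family H E (\<xi> n) e)"
  define b where "b = (\<lambda>(n, e). slice_family H' E (\<eta> n) e)"
  have a: "sq_family H a"
    by (rule sq_family_prodI[where c="\<lambda>n. (norm (\<xi> n))\<^sup>2"])
       (use s in \<open>auto simp: a_def sq_family_def slice_family_mem[OF H] slice_family_bessel[OF H E(1)]\<close>)
  have b: "sq_family H' b"
    by (rule sq_family_prodI[where c="\<lambda>n. (norm (\<eta> n))\<^sup>2"])
       (use s in \<open>auto simp: b_def sq_family_def slice_family_mem[OF H'] slice_family_bessel[OF H' E(1)]\<close>)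
  have "vec_functional b a A = vec_functional \<eta> \<xi> (op_tensor H K H' K A (id_op K))" if A: "A \<in> bounded_ops H H'" for A
  proof -
    have "vec_functional b a A = (\<Sum>\<^sub>\<infinity>(n, e)\<in>UNIV \<times> UNIV. cinner (slice_family H' E (\<eta> n) e) (A (slice_family H E (\<xi> n) e)))"
      unfolding vec_functional_def by (intro infsum_cong_neutral) (auto simp: a_def b_def)
    also have "\<dots> = (\<Sum>\<^sub>\<infinity>n. vec_functional (slice_family H' E (\<eta> n)) (slice_family H E (\<xi> n)) A)"
      unfolding vec_functional_def using vec_functional_summable[OF a b A]
      by (intro infsum_Sigma'_banach[symmetric]) (simp add: a_def b_def case_prod_unfold)
    also have "\<dots> = vec_functional \<eta> \<xi> (op_tensor H K H' K A (id_op K))"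
      by (subst vec_functional_def[of \<eta> \<xi>]) (simp add: cinner_amplification[OF H H' K A E sq_family_mem[OF s(1)]])
    finally show ?thesis .
  qed
  then show "continuous_map (weak_star H H') euclidean (\<lambda>A. vec_functional \<eta> \<xi> (op_tensor H K H' K A (id_op K)))"
    by (intro continuous_map_eq[OF continuous_map_vec_functional[OF H H' a b]]) (simp add: H H')
qed

section \<open>Algebra of operator tensor products\<close>

lemma clinear_amplification:
  assumes H: "hilbert_space H" and H': "hilbert_space H'" and K: "hilbert_space K"
  shows "clinear_on (bounded_ops H H') (\<lambda>A. op_tensor H K H' K A (id_op K))"
  unfolding clinear_on_def
proof (intro conjI ballI allI)
  note sub = subspace_bounded_ops[OF hilbert_space_subspace[OF H']]
    and sub' = subspace_bounded_ops[OF hilbert_space_subspace[OF hilbert_space_tensor]]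
  fix A B assume AB: "A \<in> bounded_ops H H'" "B \<in> bounded_ops H H'"
  note id = id_op_bounded[OF K]
  show "op_tensor H K H' K (A + B) (id_op K) = op_tensor H K H' K A (id_op K) + op_tensor H K H' K B (id_op K)"
    by (rule op_tensor_eqI[OF H K cvec.subspace_add[OF sub AB] id, symmetric],
        rule cvec.subspace_add[OF sub' op_tensor_bounded[OF H K AB(1) id] op_tensor_bounded[OF H K AB(2) id]])
       (simp add: op_tensor_apply[OF H K AB(1) id] op_tensor_apply[OF H K AB(2) id] tensor_add_left)
  show "op_tensor H K H' K (c *\<^sub>C A) (id_op K) = c *\<^sub>C op_tensor H K H' K A (id_op K)" for c
    by (rule op_tensor_eqI[OF H K cvec.subspace_scale[OF sub AB(1)] id, symmetric],
        rule cvec.subspace_scale[OF sub' op_tensor_bounded[OF H K AB(1) id]])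
       (simp add: op_tensor_apply[OF H K AB(1) id] scaleC_fun_def tensor_scale_left)
qed

lemma op_tensor_comp:
  assumes H: "hilbert_space H" "hilbert_space H'" "hilbert_space K" "hilbert_space K'"
    and S: "S \<in> bounded_ops H H'" "S' \<in> bounded_ops H' H''"
    and T: "T \<in> bounded_ops K K'" "T' \<in> bounded_ops K' K''"
  shows "op_tensor H' K' H'' K'' S' T' \<circ> op_tensor H K H' K' S T = op_tensor H K H'' K'' (S' \<circ> S) (T' \<circ> T)"
proof (rule op_tensor_eqI)
  show "op_tensor H' K' H'' K'' S' T' \<circ> op_tensor H K H' K' S T \<in> bounded_ops (hilbert_tensor H K) (hilbert_tensor H'' K'')"
    by (intro bounded_ops_comp[OF hilbert_space_tensor[of H' K']] op_tensor_bounded assms)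
qed (simp_all add: assms bounded_ops_comp[OF H(2)] bounded_ops_comp[OF H(4)] op_tensor_apply
    bounded_ops_mem[OF S(1)] bounded_ops_mem[OF T(1)])

lemma op_tensor_id:
  assumes "hilbert_space H" "hilbert_space K"
  shows "op_tensor H K H K (id_op H) (id_op K) = id_op (hilbert_tensor H K)"
  by (rule op_tensor_eqI[OF assms id_op_bounded[OF assms(1)] id_op_bounded[OF assms(2)]
        id_op_bounded[OF hilbert_space_tensor], symmetric])
     (simp add: id_op_def tensor_mem)

section \<open>Slice operators\<close>

lemma sq_family_tensor_vec:
  assumes "sq_family H a" "x \<in> K"
  shows "sq_family (hilbert_tensor H K) (\<lambda>j. a j \<otimes>\<^sub>H x)"
  using assms
  by (auto simp: sq_family_def norm_tensor power_mult_distrib intro: tensor_mem intro!: summable_on_cmult_left)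

text \<open>The slice of \<open>T\<close> by the functional \<open>vec_functional b a\<close>, that is \<open>\<Sum>j. V\<^sub>j\<^sup>* T W\<^sub>j\<close> with
  \<open>W\<^sub>j x = a j \<otimes> x\<close> and \<open>V\<^sub>j y = b j \<otimes> y\<close>, described by its matrix coefficients. In contrast to
  the slice map of an abstract functional it is defined for every bounded operator on the tensor
  product.\<close>

definition slice_op :: "'k::chilbert_space set \<Rightarrow> 'k set \<Rightarrow> ('j \<Rightarrow> 'h::chilbert_space) \<Rightarrow> ('j \<Rightarrow> 'h) \<Rightarrow>
    (('h \<times> 'k) ell2 \<Rightarrow> ('h \<times> 'k) ell2) \<Rightarrow> 'k \<Rightarrow> 'k" where
  "slice_op K\<^sub>1 K\<^sub>2 b a T = (SOME R. R \<in> bounded_ops K\<^sub>1 K\<^sub>2 \<and>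
     (\<forall>x\<in>K\<^sub>1. \<forall>y\<in>K\<^sub>2. cinner y (R x) = vec_functional (\<lambda>j. b j \<otimes>\<^sub>H y) (\<lambda>j. a j \<otimes>\<^sub>H x) T))"

lemma bounded_ops_eq_by_cinner:
  assumes "hilbert_space K" "R \<in> bounded_ops H K" "S \<in> bounded_ops H K"
    and "\<And>x y. x \<in> H \<Longrightarrow> y \<in> K \<Longrightarrow> cinner y (R x) = cinner y (S x)"
  shows "R = S"
  by (rule bounded_ops_eqI[OF assms(2,3)])
     (rule cinner_eqD[OF assms(1)], auto intro: assms(4) bounded_ops_mem[OF assms(2)] bounded_ops_mem[OF assms(3)])

context
  fixes H :: "'h::chilbert_space set" and K\<^sub>1 K\<^sub>2 :: "'k::chilbert_space set"
  assumes H: "hilbert_space H" and K\<^sub>1: "hilbert_space K\<^sub>1" and K\<^sub>2: "hilbert_space K\<^sub>2"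
begin

lemma slice_op_exists:
  fixes a b :: "'j \<Rightarrow> 'h"
  assumes a: "sq_family H a" and b: "sq_family H b"
    and T: "T \<in> bounded_ops (hilbert_tensor H K\<^sub>1) (hilbert_tensor H K\<^sub>2)"
  shows "\<exists>R\<in>bounded_ops K\<^sub>1 K\<^sub>2. \<forall>x\<in>K\<^sub>1. \<forall>y\<in>K\<^sub>2.
    cinner y (R x) = vec_functional (\<lambda>j. b j \<otimes>\<^sub>H y) (\<lambda>j. a j \<otimes>\<^sub>H x) T"
proof -
  obtain M where M: "M \<ge> 0" "\<And>x. norm (T x) \<le> M * norm x" using bounded_ops_bound[OF T] by metis
  define C where "C = (\<Sum>\<^sub>\<infinity>j. norm (b j) * norm (a j))"
  have C: "0 \<le> C" unfolding C_def by (rule infsum_nonneg) simp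
  note fam = sq_family_tensor_vec[OF a, where K=K\<^sub>1] sq_family_tensor_vec[OF b, where K=K\<^sub>2]
  note summ = vec_functional_summable[OF fam T]
  have mem: "a j \<otimes>\<^sub>H x \<in> hilbert_tensor H K\<^sub>1" if "x \<in> K\<^sub>1" for j x
    by (intro tensor_mem sq_family_mem[OF a] that)
  show ?thesis
  proof (rule sesquilinear_form_operator[OF K\<^sub>1 K\<^sub>2, where M="M * C"])
    fix y assume y: "y \<in> K\<^sub>2"
    show "clinear_on K\<^sub>1 (\<lambda>x. vec_functional (\<lambda>j. b j \<otimes>\<^sub>H y) (\<lambda>j. a j \<otimes>\<^sub>H x) T)"
      unfolding clinear_on_def vec_functional_def
      by (auto simp: tensor_add_right tensor_scale_right clinear_on_add[OF bounded_ops_clinear[OF T]]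
          clinear_on_scale[OF bounded_ops_clinear[OF T]] mem cinner_add_right cinner_scaleC_right
          infsum_add[OF summ summ] y infsum_cmult_right')
  next
    fix x assume x: "x \<in> K\<^sub>1"
    show "clinear_on K\<^sub>2 (\<lambda>y. cnj (vec_functional (\<lambda>j. b j \<otimes>\<^sub>H y) (\<lambda>j. a j \<otimes>\<^sub>H x) T))"
      unfolding clinear_on_def vec_functional_def
      by (auto simp: tensor_add_right tensor_scale_right cinner_add_left cinner_scaleC_left
          infsum_add[OF summ summ] x infsum_cmult_right')
  next
    fix x y assume xy: "x \<in> K\<^sub>1" "y \<in> K\<^sub>2"
    have "cmod (vec_functional (\<lambda>j. b j \<otimes>\<^sub>H y) (\<lambda>j. a j \<otimes>\<^sub>H x) T)
        \<le> M * (\<Sum>\<^sub>\<infinity>j. norm (b j \<otimes>\<^sub>H y) * norm (a j \<otimes>\<^sub>H x))"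
      by (rule norm_vec_functional_le[OF fam(1)[OF xy(1)] fam(2)[OF xy(2)] M(2) T])
    also have "(\<Sum>\<^sub>\<infinity>j. norm (b j \<otimes>\<^sub>H y) * norm (a j \<otimes>\<^sub>H x)) = (\<Sum>\<^sub>\<infinity>j. norm (b j) * norm (a j) * (norm x * norm y))"
      by (rule infsum_cong) (simp add: norm_tensor mult_ac)
    also have "\<dots> = C * (norm x * norm y)" unfolding C_def by (rule infsum_cmult_left')
    finally show "cmod (vec_functional (\<lambda>j. b j \<otimes>\<^sub>H y) (\<lambda>j. a j \<otimes>\<^sub>H x) T) \<le> M * C * norm x * norm y"
      by (simp add: mult_ac)
  qed (simp add: M C)
qed

lemma slice_op_bounded:
    "sq_family H a \<Longrightarrow> sq_family H b \<Longrightarrow> T \<in> bounded_ops (hilbert_tensor H K\<^sub>1) (hilbert_tensor H K\<^sub>2) \<Longrightarrow>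
      slice_op K\<^sub>1 K\<^sub>2 b a T \<in> bounded_ops K\<^sub>1 K\<^sub>2"
  and cinner_slice_op:
    "sq_family H a \<Longrightarrow> sq_family H b \<Longrightarrow> T \<in> bounded_ops (hilbert_tensor H K\<^sub>1) (hilbert_tensor H K\<^sub>2) \<Longrightarrow>
      x \<in> K\<^sub>1 \<Longrightarrow> y \<in> K\<^sub>2 \<Longrightarrow>
      cinner y (slice_op K\<^sub>1 K\<^sub>2 b a T x) = vec_functional (\<lambda>j. b j \<otimes>\<^sub>H y) (\<lambda>j. a j \<otimes>\<^sub>H x) T"
proof -
  assume "sq_family H a" "sq_family H b" "T \<in> bounded_ops (hilbert_tensor H K\<^sub>1) (hilbert_tensor H K\<^sub>2)"
  then have "\<exists>R. R \<in> bounded_ops K\<^sub>1 K\<^sub>2 \<and> (\<forall>x\<in>K\<^sub>1. \<forall>y\<in>K\<^sub>2.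
      cinner y (R x) = vec_functional (\<lambda>j. b j \<otimes>\<^sub>H y) (\<lambda>j. a j \<otimes>\<^sub>H x) T)"
    using slice_op_exists by blast
  from someI_ex[OF this, folded slice_op_def]
  show "slice_op K\<^sub>1 K\<^sub>2 b a T \<in> bounded_ops K\<^sub>1 K\<^sub>2"
    and "x \<in> K\<^sub>1 \<Longrightarrow> y \<in> K\<^sub>2 \<Longrightarrow>
      cinner y (slice_op K\<^sub>1 K\<^sub>2 b a T x) = vec_functional (\<lambda>j. b j \<otimes>\<^sub>H y) (\<lambda>j. a j \<otimes>\<^sub>H x) T" by blast+
qed

lemma slice_op_clinear:
  assumes a: "sq_family H a" and b: "sq_family H b"
  shows "clinear_on (bounded_ops (hilbert_tensor H K\<^sub>1) (hilbert_tensor H K\<^sub>2)) (slice_op K\<^sub>1 K\<^sub>2 b a)"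
  unfolding clinear_on_def
proof (intro conjI ballI allI)
  note sub = subspace_bounded_ops[OF hilbert_space_subspace[OF K\<^sub>2], of K\<^sub>1]
    and sub' = subspace_bounded_ops[OF hilbert_space_subspace[OF hilbert_space_tensor]]
  note fam = sq_family_tensor_vec[OF a, where K=K\<^sub>1] sq_family_tensor_vec[OF b, where K=K\<^sub>2]
  fix S T assume ST: "S \<in> bounded_ops (hilbert_tensor H K\<^sub>1) (hilbert_tensor H K\<^sub>2)"
    "T \<in> bounded_ops (hilbert_tensor H K\<^sub>1) (hilbert_tensor H K\<^sub>2)"
  show "slice_op K\<^sub>1 K\<^sub>2 b a (S + T) = slice_op K\<^sub>1 K\<^sub>2 b a S + slice_op K\<^sub>1 K\<^sub>2 b a T"
    by (rule bounded_ops_eq_by_cinner[OF K\<^sub>2, where H=K\<^sub>1])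
       (simp_all add: slice_op_bounded[OF a b] ST cvec.subspace_add[OF sub] cvec.subspace_add[OF sub']
         cinner_slice_op[OF a b] cinner_add_right clinear_on_add[OF clinear_vec_functional[OF fam] ST])
  show "slice_op K\<^sub>1 K\<^sub>2 b a (c *\<^sub>C S) = c *\<^sub>C slice_op K\<^sub>1 K\<^sub>2 b a S" for c
  proof (rule bounded_ops_eq_by_cinner[OF K\<^sub>2])
    show "cinner y (slice_op K\<^sub>1 K\<^sub>2 b a (c *\<^sub>C S) x) = cinner y ((c *\<^sub>C slice_op K\<^sub>1 K\<^sub>2 b a S) x)"
      if xy: "x \<in> K\<^sub>1" "y \<in> K\<^sub>2" for x y
      using cinner_slice_op[OF a b cvec.subspace_scale[OF sub' ST(1)] xy, of c] cinner_slice_op[OF a b ST(1) xy]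
        clinear_on_scale[OF clinear_vec_functional[OF fam(1)[OF xy(1)] fam(2)[OF xy(2)]] ST(1), of c]
      by (simp add: scaleC_fun_def cinner_scaleC_right)
  qed (intro slice_op_bounded[OF a b] ST cvec.subspace_scale[OF sub] cvec.subspace_scale[OF sub'])+
qed

lemma slice_op_op_tensor:
  assumes a: "sq_family H a" and b: "sq_family H b" and A: "A \<in> bounded_ops H H" and B: "B \<in> bounded_ops K\<^sub>1 K\<^sub>2"
  shows "slice_op K\<^sub>1 K\<^sub>2 b a (op_tensor H K\<^sub>1 H K\<^sub>2 A B) = vec_functional b a A *\<^sub>C B"
proof (rule bounded_ops_eq_by_cinner[OF K\<^sub>2])
  note AB = op_tensor_bounded[OF H K\<^sub>1 A B]
  show "slice_op K\<^sub>1 K\<^sub>2 b a (op_tensor H K\<^sub>1 H K\<^sub>2 A B) \<in> bounded_ops K\<^sub>1 K\<^sub>2"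
    by (rule slice_op_bounded[OF a b AB])
  show "vec_functional b a A *\<^sub>C B \<in> bounded_ops K\<^sub>1 K\<^sub>2"
    by (rule cvec.subspace_scale[OF subspace_bounded_ops[OF hilbert_space_subspace[OF K\<^sub>2]] B])
  fix x y assume xy: "x \<in> K\<^sub>1" "y \<in> K\<^sub>2"
  have "cinner y (slice_op K\<^sub>1 K\<^sub>2 b a (op_tensor H K\<^sub>1 H K\<^sub>2 A B) x)
      = (\<Sum>\<^sub>\<infinity>j. cinner (b j) (A (a j)) * cinner y (B x))"
    by (simp add: cinner_slice_op[OF a b AB xy] vec_functional_def op_tensor_apply[OF H K\<^sub>1 A B sq_family_mem[OF a] xy(1)]
        cinner_tensor)
  also have "\<dots> = vec_functional b a A * cinner y (B x)" unfolding vec_functional_def by (rule infsum_cmult_left')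
  finally show "cinner y (slice_op K\<^sub>1 K\<^sub>2 b a (op_tensor H K\<^sub>1 H K\<^sub>2 A B) x) = cinner y ((vec_functional b a A *\<^sub>C B) x)"
    by (simp add: scaleC_fun_def cinner_scaleC_right)
qed

text \<open>A functional of the slice is a functional of \<open>T\<close>, for the products \<open>a j \<otimes> \<xi> n\<close> and
  \<open>b j \<otimes> \<eta> n\<close> of the two pairs of families.\<close>

lemma continuous_map_slice_op:
  fixes a b :: "'j \<Rightarrow> 'h"
  assumes a: "sq_family H a" and b: "sq_family H b"
  shows "continuous_map (weak_star (hilbert_tensor H K\<^sub>1) (hilbert_tensor H K\<^sub>2)) (weak_star K\<^sub>1 K\<^sub>2) (slice_op K\<^sub>1 K\<^sub>2 b a)"
proof (rule continuous_map_into_weak_star[OF K\<^sub>1 K\<^sub>2])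
  show "slice_op K\<^sub>1 K\<^sub>2 b a T \<in> bounded_ops K\<^sub>1 K\<^sub>2"
    if "T \<in> topspace (weak_star (hilbert_tensor H K\<^sub>1) (hilbert_tensor H K\<^sub>2))" for T
    using that by (simp add: hilbert_space_tensor slice_op_bounded[OF a b])
  fix \<xi> :: "nat \<Rightarrow> 'k" and \<eta> :: "nat \<Rightarrow> 'k"
  assume s: "sq_family K\<^sub>1 \<xi>" "sq_family K\<^sub>2 \<eta>"
  have prod: "sq_family (hilbert_tensor H K) (\<lambda>(n, j). c j \<otimes>\<^sub>H \<zeta> n)"
    if c: "sq_family H c" and \<zeta>: "sq_family K \<zeta>" for c :: "'j \<Rightarrow> 'h" and K and \<zeta> :: "nat \<Rightarrow> 'k"
  proof (rule sq_family_prodI[where c="\<lambda>n. (\<Sum>\<^sub>\<infinity>j. (norm (c j))\<^sup>2) * (norm (\<zeta> n))\<^sup>2"])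
    show "(\<lambda>n. (\<Sum>\<^sub>\<infinity>j. (norm (c j))\<^sup>2) * (norm (\<zeta> n))\<^sup>2) summable_on UNIV"
      using \<zeta> by (intro summable_on_cmult_right) (simp add: sq_family_def)
    show "0 \<le> (\<Sum>\<^sub>\<infinity>j. (norm (c j))\<^sup>2) * (norm (\<zeta> n))\<^sup>2" for n
      by (intro mult_nonneg_nonneg infsum_nonneg) auto
    show "(\<Sum>j\<in>F. (norm (case (n, j) of (n, j) \<Rightarrow> c j \<otimes>\<^sub>H \<zeta> n))\<^sup>2) \<le> (\<Sum>\<^sub>\<infinity>j. (norm (c j))\<^sup>2) * (norm (\<zeta> n))\<^sup>2"
      if F: "finite F" for n F
    proof -
      have "(\<Sum>j\<in>F. (norm (c j))\<^sup>2) \<le> (\<Sum>\<^sub>\<infinity>j. (norm (c j))\<^sup>2)"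
        using c F by (intro finite_sum_le_infsum) (auto simp: sq_family_def)
      then have "(\<Sum>j\<in>F. (norm (c j))\<^sup>2) * (norm (\<zeta> n))\<^sup>2 \<le> (\<Sum>\<^sub>\<infinity>j. (norm (c j))\<^sup>2) * (norm (\<zeta> n))\<^sup>2"
        by (rule mult_right_mono) simp
      then show ?thesis by (simp add: norm_tensor power_mult_distrib sum_distrib_right)
    qed
  qed (auto intro: tensor_mem sq_family_mem[OF c] sq_family_mem[OF \<zeta>])
  define a' where "a' = (\<lambda>(n, j). a j \<otimes>\<^sub>H \<xi> n)"
  define b' where "b' = (\<lambda>(n, j). b j \<otimes>\<^sub>H \<eta> n)"
  note fam = prod[OF a s(1), folded a'_def] prod[OF b s(2), folded b'_def]
  have "vec_functional b' a' T = vec_functional \<eta> \<xi> (slice_op K\<^sub>1 K\<^sub>2 b a T)"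
    if T: "T \<in> bounded_ops (hilbert_tensor H K\<^sub>1) (hilbert_tensor H K\<^sub>2)" for T
  proof -
    have "vec_functional b' a' T = (\<Sum>\<^sub>\<infinity>(n, j)\<in>UNIV \<times> UNIV. cinner (b j \<otimes>\<^sub>H \<eta> n) (T (a j \<otimes>\<^sub>H \<xi> n)))"
      unfolding vec_functional_def by (intro infsum_cong_neutral) (auto simp: a'_def b'_def)
    also have "\<dots> = (\<Sum>\<^sub>\<infinity>n. vec_functional (\<lambda>j. b j \<otimes>\<^sub>H \<eta> n) (\<lambda>j. a j \<otimes>\<^sub>H \<xi> n) T)"
      unfolding vec_functional_def using vec_functional_summable[OF fam T]
      by (intro infsum_Sigma'_banach[symmetric]) (simp add: a'_def b'_def case_prod_unfold)
    also have "\<dots> = vec_functional \<eta> \<xi> (slice_op K\<^sub>1 K\<^sub>2 b a T)"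
      by (subst vec_functional_def[of \<eta> \<xi>])
         (simp add: cinner_slice_op[OF a b T sq_family_mem[OF s(1)] sq_family_mem[OF s(2)]])
    finally show ?thesis .
  qed
  then show "continuous_map (weak_star (hilbert_tensor H K\<^sub>1) (hilbert_tensor H K\<^sub>2)) euclidean
      (\<lambda>T. vec_functional \<eta> \<xi> (slice_op K\<^sub>1 K\<^sub>2 b a T))"
    by (intro continuous_map_eq[OF continuous_map_vec_functional[OF hilbert_space_tensor hilbert_space_tensor fam]])
       (simp add: hilbert_space_tensor)
qed

end

lemma cinner_amplification_adjoint:
  assumes H: "hilbert_space H" and H': "hilbert_space H'" and K: "hilbert_space K"
    and P: "P \<in> bounded_ops H H'" and P': "P' \<in> bounded_ops H' H"
      "\<And>x y. x \<in> H \<Longrightarrow> y \<in> H' \<Longrightarrow> cinner (P' y) x = cinner y (P x)"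
    and y: "y \<in> H'" and k: "k \<in> K" and z: "z \<in> hilbert_tensor H K"
  shows "cinner (y \<otimes>\<^sub>H k) (op_tensor H K H' K P (id_op K) z) = cinner (P' y \<otimes>\<^sub>H k) z"
proof (rule hilbert_tensor_eqI[OF _ _ _ _ _ z])
  note Pb = op_tensor_bounded[OF H K P id_op_bounded[OF K]]
  show "clinear_on (hilbert_tensor H K) (\<lambda>z. cinner (y \<otimes>\<^sub>H k) (op_tensor H K H' K P (id_op K) z))"
    by (rule clinear_cinner_op[OF Pb])
  show "continuous_on (hilbert_tensor H K) (\<lambda>z. cinner (y \<otimes>\<^sub>H k) (op_tensor H K H' K P (id_op K) z))"
    by (rule continuous_on_cinner_op[OF hilbert_space_tensor Pb])
  show "clinear_on (hilbert_tensor H K) (\<lambda>z. cinner (P' y \<otimes>\<^sub>H k) z)"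
    by (auto simp: clinear_on_def cinner_add_right cinner_scaleC_right)
  show "continuous_on (hilbert_tensor H K) (\<lambda>z. cinner (P' y \<otimes>\<^sub>H k) z)"
    by (rule linear_continuous_on[OF bounded_linear_cinner_right])
  show "cinner (y \<otimes>\<^sub>H k) (op_tensor H K H' K P (id_op K) (x \<otimes>\<^sub>H l)) = cinner (P' y \<otimes>\<^sub>H k) (x \<otimes>\<^sub>H l)"
    if "x \<in> H" "l \<in> K" for x l
    unfolding op_tensor_apply[OF H K P id_op_bounded[OF K] that]
    using that y by (simp add: cinner_tensor P'(2) id_op_def)
qed

text \<open>As \<open>Q\<close> and the adjoint of \<open>P\<close> move into the vectors, slicing \<open>(P \<otimes> 1) T (Q \<otimes> 1)\<close> by \<open>\<omega>\<close> is
  slicing \<open>T\<close> by \<open>A \<mapsto> \<omega> (P A Q)\<close>. Information on the slices of an operator is carried from one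
  algebra to another by this identity.\<close>

lemma slice_op_sandwich:
  assumes H: "hilbert_space H" and H': "hilbert_space H'" and K\<^sub>1: "hilbert_space K\<^sub>1" and K\<^sub>2: "hilbert_space K\<^sub>2"
    and P: "P \<in> bounded_ops H H'" and P': "P' \<in> bounded_ops H' H"
      "\<And>x y. x \<in> H \<Longrightarrow> y \<in> H' \<Longrightarrow> cinner (P' y) x = cinner y (P x)"
    and Q: "Q \<in> bounded_ops H' H"
    and a: "sq_family H' a" and b: "sq_family H' b"
    and T: "T \<in> bounded_ops (hilbert_tensor H K\<^sub>1) (hilbert_tensor H K\<^sub>2)"
  shows "slice_op K\<^sub>1 K\<^sub>2 b a (op_tensor H K\<^sub>2 H' K\<^sub>2 P (id_op K\<^sub>2) \<circ> T \<circ> op_tensor H' K\<^sub>1 H K\<^sub>1 Q (id_op K\<^sub>1))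
    = slice_op K\<^sub>1 K\<^sub>2 (\<lambda>j. P' (b j)) (\<lambda>j. Q (a j)) T"
proof (rule bounded_ops_eq_by_cinner[OF K\<^sub>2])
  let ?T = "op_tensor H K\<^sub>2 H' K\<^sub>2 P (id_op K\<^sub>2) \<circ> T \<circ> op_tensor H' K\<^sub>1 H K\<^sub>1 Q (id_op K\<^sub>1)"
  have Tb: "?T \<in> bounded_ops (hilbert_tensor H' K\<^sub>1) (hilbert_tensor H' K\<^sub>2)"
    by (intro bounded_ops_comp[OF hilbert_space_tensor[of H K\<^sub>1]] bounded_ops_comp[OF hilbert_space_tensor[of H K\<^sub>2]]
        op_tensor_bounded T P Q id_op_bounded H H' K\<^sub>1 K\<^sub>2)
  note fam = sq_family_image[OF a Q] sq_family_image[OF b P'(1)]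
  show "slice_op K\<^sub>1 K\<^sub>2 b a ?T \<in> bounded_ops K\<^sub>1 K\<^sub>2"
    by (rule slice_op_bounded[OF H' K\<^sub>1 K\<^sub>2 a b Tb])
  show "slice_op K\<^sub>1 K\<^sub>2 (\<lambda>j. P' (b j)) (\<lambda>j. Q (a j)) T \<in> bounded_ops K\<^sub>1 K\<^sub>2"
    by (rule slice_op_bounded[OF H K\<^sub>1 K\<^sub>2 fam T])
  fix x y assume xy: "x \<in> K\<^sub>1" "y \<in> K\<^sub>2"
  have "cinner (b j \<otimes>\<^sub>H y) (?T (a j \<otimes>\<^sub>H x)) = cinner (P' (b j) \<otimes>\<^sub>H y) (T (Q (a j) \<otimes>\<^sub>H x))" for j
  proof -
    have "?T (a j \<otimes>\<^sub>H x) = op_tensor H K\<^sub>2 H' K\<^sub>2 P (id_op K\<^sub>2) (T (Q (a j) \<otimes>\<^sub>H x))"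
      using op_tensor_apply[OF H' K\<^sub>1 Q id_op_bounded[OF K\<^sub>1] sq_family_mem[OF a] xy(1), of j] xy
      by (simp add: id_op_def)
    also have "cinner (b j \<otimes>\<^sub>H y) \<dots> = cinner (P' (b j) \<otimes>\<^sub>H y) (T (Q (a j) \<otimes>\<^sub>H x))"
      by (intro cinner_amplification_adjoint[OF H H' K\<^sub>2 P P' sq_family_mem[OF b] xy(2)]
          bounded_ops_mem[OF T] tensor_mem bounded_ops_mem[OF Q] sq_family_mem[OF a] xy)
    finally show ?thesis .
  qed
  then show "cinner y (slice_op K\<^sub>1 K\<^sub>2 b a ?T x) = cinner y (slice_op K\<^sub>1 K\<^sub>2 (\<lambda>j. P' (b j)) (\<lambda>j. Q (a j)) T x)"
    by (simp add: cinner_slice_op[OF H' K\<^sub>1 K\<^sub>2 a b Tb xy] cinner_slice_op[OF H K\<^sub>1 K\<^sub>2 fam T xy] vec_functional_def del: comp_apply)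
qed

section \<open>Weak* continuous functionals on a subspace\<close>

text \<open>By induction on the number of functionals the claim is known on the kernel of the last
  one, and a vector outside this kernel determines the missing coefficient.\<close>

lemma functional_in_span_of_finite_family:
  fixes f :: "'i \<Rightarrow> 'v::complex_vector \<Rightarrow> complex"
  assumes "finite I" "cvec.subspace V" "\<And>i. i \<in> I \<Longrightarrow> clinear_on V (f i)" "clinear_on V \<omega>"
    and "\<And>v. v \<in> V \<Longrightarrow> (\<And>i. i \<in> I \<Longrightarrow> f i v = 0) \<Longrightarrow> \<omega> v = 0"
  shows "\<exists>c. \<forall>v\<in>V. \<omega> v = (\<Sum>i\<in>I. c i * f i v)"
  using assms
proof (induction I arbitrary: V rule: finite_induct)
  case (insert i I)
  note V = insert.prems(1) and f = insert.prems(2) and \<omega> = insert.prems(3)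
  have fi: "clinear_on V (f i)" using f by blast
  define V' where "V' = {v \<in> V. f i v = 0}"
  have "cvec.subspace V'"
    unfolding V'_def
    by (rule cvec.subspaceI)
       (auto simp: cvec.subspace_0[OF V] cvec.subspace_add[OF V] cvec.subspace_scale[OF V]
         clinear_on_zero[OF fi] clinear_on_add[OF fi] clinear_on_scale[OF fi])
  moreover have "clinear_on V' g" if "clinear_on V g" for g :: "'v \<Rightarrow> complex"
    using that by (auto simp: V'_def clinear_on_def)
  ultimately have "\<exists>c. \<forall>v\<in>V'. \<omega> v = (\<Sum>j\<in>I. c j * f j v)"
  proof (intro insert.IH)
    show "\<omega> v = 0" if "v \<in> V'" "\<And>j. j \<in> I \<Longrightarrow> f j v = 0" for v
      by (rule insert.prems(4)) (use that in \<open>auto simp: V'_def\<close>)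
  qed (use f \<omega> in auto)
  then obtain c where c: "\<And>v. v \<in> V' \<Longrightarrow> \<omega> v = (\<Sum>j\<in>I. c j * f j v)" by blast
  show ?case
  proof (cases "\<forall>v\<in>V. f i v = 0")
    case True
    then have "\<omega> v = (\<Sum>j\<in>insert i I. c j * f j v)" if "v \<in> V" for v
      using c[of v] that insert.hyps by (simp add: V'_def)
    then show ?thesis by blast
  next
    case False
    then obtain w where w: "w \<in> V" "f i w \<noteq> 0" by blast
    \<comment> \<open>Then \<open>v - f i v u\<close> is in the kernel of \<open>f i\<close> for every \<open>v\<close>, and \<open>d\<close> accounts for \<open>\<omega> u\<close>.\<close>
    define u where "u = (1 / f i w) *\<^sub>C w"
    have u: "u \<in> V" "f i u = 1"
      using w by (simp_all add: u_def cvec.subspace_scale[OF V] clinear_on_scale[OF fi])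
    define d where "d = \<omega> u - (\<Sum>j\<in>I. c j * f j u)"
    have "\<omega> v = (\<Sum>j\<in>insert i I. (if j = i then d else c j) * f j v)" if v: "v \<in> V" for v
    proof -
      let ?z = "v - f i v *\<^sub>C u"
      have fu: "f i v *\<^sub>C u \<in> V" by (rule cvec.subspace_scale[OF V u(1)])
      have dz: "g ?z = g v - f i v * g u" if g: "clinear_on V g" for g :: "'v \<Rightarrow> complex"
        using clinear_on_diff[OF V g v fu] clinear_on_scale[OF g u(1), of "f i v"] by simp
      have "?z \<in> V'" using cvec.subspace_diff[OF V v fu] dz[OF fi] u by (simp add: V'_def)
      then have "\<omega> v - f i v * \<omega> u = (\<Sum>j\<in>I. c j * (f j v - f i v * f j u))"
        using c[of ?z] dz[OF \<omega>] dz[OF f] by simp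
      also have "\<dots> = (\<Sum>j\<in>I. c j * f j v) - f i v * (\<Sum>j\<in>I. c j * f j u)"
        by (simp add: algebra_simps sum_subtractf sum_distrib_left)
      finally have "\<omega> v = d * f i v + (\<Sum>j\<in>I. c j * f j v)" by (simp add: d_def algebra_simps)
      also have "(\<Sum>j\<in>I. c j * f j v) = (\<Sum>j\<in>I. (if j = i then d else c j) * f j v)"
        using insert.hyps by (intro sum.cong) auto
      finally show ?thesis using insert.hyps by simp
    qed
    then show ?thesis by (intro exI[of _ "\<lambda>j. if j = i then d else c j"] ballI)
  qed
qed simp

lemma generate_topology_on_finite_subbase:
  assumes "generate_topology_on S U" "x \<in> U"
  shows "\<exists>F. finite F \<and> F \<subseteq> S \<and> (\<forall>s\<in>F. x \<in> s) \<and> \<Inter>F \<subseteq> U"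
  using assms
proof (induction rule: generate_topology_on.induct)
  case (Int a b)
  then obtain F G where "finite F" "F \<subseteq> S" "\<forall>s\<in>F. x \<in> s" "\<Inter>F \<subseteq> a"
    "finite G" "G \<subseteq> S" "\<forall>s\<in>G. x \<in> s" "\<Inter>G \<subseteq> b" by auto
  then show ?case by (intro exI[of _ "F \<union> G"]) auto
next
  case (UN K)
  then show ?case by (meson Union_iff Sup_upper order_trans)
next
  case (Basis s)
  then show ?case by (intro exI[of _ "{s}"]) auto
qed simp

lemma vec_functional_finite_combination:
  fixes \<xi> :: "'i \<Rightarrow> nat \<Rightarrow> 'h::chilbert_space" and \<eta> :: "'i \<Rightarrow> nat \<Rightarrow> 'k::chilbert_space"
  assumes H: "hilbert_space H" and K: "hilbert_space K" and I: "finite I"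
    and s: "\<And>i. i \<in> I \<Longrightarrow> sq_family H (\<xi> i)" "\<And>i. i \<in> I \<Longrightarrow> sq_family K (\<eta> i)"
  shows "\<exists>(a :: 'i \<times> nat \<Rightarrow> 'h) b. sq_family H a \<and> sq_family K b \<and>
    (\<forall>T\<in>bounded_ops H K. vec_functional b a T = (\<Sum>i\<in>I. c i * vec_functional (\<eta> i) (\<xi> i) T))"
proof -
  define a where "a = (\<lambda>(i, n). if i \<in> I then c i *\<^sub>C \<xi> i n else 0)"
  define b where "b = (\<lambda>(i, n). if i \<in> I then \<eta> i n else 0)"
  have fin: "(\<lambda>i. if i \<in> I then g i else 0) summable_on UNIV" for g :: "'i \<Rightarrow> real"
    by (rule summable_on_cong_neutral[THEN iffD1, rotated -1, OF summable_on_finite[OF I, of g]]) auto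
  have le: "(\<Sum>n\<in>F. (norm (u n))\<^sup>2) \<le> (\<Sum>\<^sub>\<infinity>n. (norm (u n))\<^sup>2)"
    if "sq_family L u" "finite F" for L and u :: "nat \<Rightarrow> 'x::chilbert_space" and F
    using that by (intro finite_sum_le_infsum) (auto simp: sq_family_def)
  have a: "sq_family H a"
  proof (rule sq_family_prodI[where c="\<lambda>i. if i \<in> I then (cmod (c i))\<^sup>2 * (\<Sum>\<^sub>\<infinity>n. (norm (\<xi> i n))\<^sup>2) else 0"])
    show "a p \<in> H" for p
      by (auto simp: a_def hilbert_space_zero[OF H] sq_family_mem[OF s(1)]
          cvec.subspace_scale[OF hilbert_space_subspace[OF H]] split: prod.split)
    show "(\<Sum>n\<in>F. (norm (a (i, n)))\<^sup>2) \<le> (if i \<in> I then (cmod (c i))\<^sup>2 * (\<Sum>\<^sub>\<infinity>n. (norm (\<xi> i n))\<^sup>2) else 0)"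
      if "finite F" for i F
      using le[OF s(1) that] by (simp add: a_def norm_scaleC power_mult_distrib mult_left_mono flip: sum_distrib_left)
  qed (auto simp: fin infsum_nonneg)
  have b: "sq_family K b"
  proof (rule sq_family_prodI[where c="\<lambda>i. if i \<in> I then (\<Sum>\<^sub>\<infinity>n. (norm (\<eta> i n))\<^sup>2) else 0"])
    show "b p \<in> K" for p
      by (auto simp: b_def hilbert_space_zero[OF K] sq_family_mem[OF s(2)] split: prod.split)
    show "(\<Sum>n\<in>F. (norm (b (i, n)))\<^sup>2) \<le> (if i \<in> I then (\<Sum>\<^sub>\<infinity>n. (norm (\<eta> i n))\<^sup>2) else 0)"
      if "finite F" for i F
      using le[OF s(2) that] by (simp add: b_def)
  qed (auto simp: fin infsum_nonneg)
  have "vec_functional b a T = (\<Sum>i\<in>I. c i * vec_functional (\<eta> i) (\<xi> i) T)" if T: "T \<in> bounded_ops H K" for T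
  proof -
    have "vec_functional b a T = (\<Sum>\<^sub>\<infinity>(i, n)\<in>UNIV \<times> UNIV. cinner (b (i, n)) (T (a (i, n))))"
      unfolding vec_functional_def by (intro infsum_cong_neutral) auto
    also have "\<dots> = (\<Sum>\<^sub>\<infinity>i. \<Sum>\<^sub>\<infinity>n. cinner (b (i, n)) (T (a (i, n))))"
      using vec_functional_summable[OF a b T] by (intro infsum_Sigma'_banach[symmetric]) (simp add: case_prod_unfold)
    also have "\<dots> = (\<Sum>\<^sub>\<infinity>i\<in>I. c i * vec_functional (\<eta> i) (\<xi> i) T)"
    proof (rule infsum_cong_neutral)
      fix i assume "i \<in> UNIV \<inter> I"
      then have i: "i \<in> I" by simp
      have "(\<Sum>\<^sub>\<infinity>n. cinner (b (i, n)) (T (a (i, n)))) = (\<Sum>\<^sub>\<infinity>n. c i * cinner (\<eta> i n) (T (\<xi> i n)))"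
        by (rule infsum_cong) (simp add: a_def b_def i cinner_scaleC_right
            clinear_on_scale[OF bounded_ops_clinear[OF T] sq_family_mem[OF s(1)[OF i]]])
      also have "\<dots> = c i * vec_functional (\<eta> i) (\<xi> i) T" unfolding vec_functional_def by (rule infsum_cmult_right')
      finally show "(\<Sum>\<^sub>\<infinity>n. cinner (b (i, n)) (T (a (i, n)))) = c i * vec_functional (\<eta> i) (\<xi> i) T" .
    qed (auto simp: b_def)
    finally show ?thesis using I by simp
  qed
  then show ?thesis using a b by blast
qed

text \<open>A neighbourhood of 0 in \<open>V\<close> on which \<open>\<omega>\<close> is bounded by 1 contains one that is given by
  finitely many of the generating functionals. By scaling, \<open>\<omega>\<close> vanishes on their common kernel, so
  it is a linear combination of them. Such a combination is again the functional of a pair of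
  families.\<close>

lemma predual_representation:
  fixes H :: "'h::chilbert_space set"
  assumes H: "hilbert_space H" and V: "cvec.subspace V" "V \<subseteq> bounded_ops H H" and \<omega>: "\<omega> \<in> predual H V"
  shows "\<exists>(a :: nat \<Rightarrow> 'h) b. sq_family H a \<and> sq_family H b \<and> (\<forall>T\<in>V. \<omega> T = vec_functional b a T)"
proof -
  let ?S = "{{T \<in> bounded_ops H H. (\<Sum>n. cinner (\<eta> n) (T (\<xi> n))) \<in> G} | \<xi> \<eta> G.
        square_summable_in H \<xi> \<and> square_summable_in H \<eta> \<and> open G}"
  have lin: "clinear_on V \<omega>" and cont: "continuous_map (subtopology (weak_star H H) V) euclidean \<omega>"
    using \<omega> by (auto simp: predual_def)
  have V0: "0 \<in> V" by (rule cvec.subspace_0[OF V(1)])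
  have "openin (subtopology (weak_star H H) V) {T \<in> topspace (subtopology (weak_star H H) V). \<omega> T \<in> ball 0 1}"
    by (rule openin_continuous_map_preimage[OF cont]) simp
  then obtain O' where O': "openin (weak_star H H) O'" "{T \<in> V. \<omega> T \<in> ball 0 1} = O' \<inter> V"
    using V H by (auto simp: openin_subtopology topspace_subtopology Int_absorb1)
  have "0 \<in> O'" using O'(2) V0 clinear_on_zero[OF lin V0] by force
  then obtain F where F: "finite F" "F \<subseteq> ?S" "\<And>s. s \<in> F \<Longrightarrow> 0 \<in> s" "\<Inter>F \<subseteq> O'"
    using generate_topology_on_finite_subbase[of ?S O' 0] O'(1)
    unfolding weak_star_def openin_topology_generated_by_iff by blast
  have "\<forall>s\<in>F. \<exists>\<xi> \<eta> G. s = {T \<in> bounded_ops H H. (\<Sum>n. cinner (\<eta> n) (T (\<xi> n))) \<in> G} \<and>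
      sq_family H \<xi> \<and> sq_family H \<eta>"
    using F(2) unfolding square_summable_in_iff by blast
  from bchoice[OF this] obtain \<xi> where "\<forall>s\<in>F. \<exists>\<eta> G.
      s = {T \<in> bounded_ops H H. (\<Sum>n. cinner (\<eta> n) (T (\<xi> s n))) \<in> G} \<and> sq_family H (\<xi> s) \<and> sq_family H \<eta>" ..
  from bchoice[OF this] obtain \<eta> where "\<forall>s\<in>F. \<exists>G.
      s = {T \<in> bounded_ops H H. (\<Sum>n. cinner (\<eta> s n) (T (\<xi> s n))) \<in> G} \<and> sq_family H (\<xi> s) \<and> sq_family H (\<eta> s)" ..
  from bchoice[OF this] obtain G where all: "\<forall>s\<in>F.
      s = {T \<in> bounded_ops H H. (\<Sum>n. cinner (\<eta> s n) (T (\<xi> s n))) \<in> G s} \<and> sq_family H (\<xi> s) \<and> sq_family H (\<eta> s)" ..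
  have s: "s = {T \<in> bounded_ops H H. (\<Sum>n. cinner (\<eta> s n) (T (\<xi> s n))) \<in> G s}" if "s \<in> F" for s
    using all that by blast
  have fam: "sq_family H (\<xi> s)" "sq_family H (\<eta> s)" if "s \<in> F" for s
    using all that by blast+
  have G0: "0 \<in> G s" if "s \<in> F" for s
  proof -
    have "0 \<in> {T \<in> bounded_ops H H. (\<Sum>n. cinner (\<eta> s n) (T (\<xi> s n))) \<in> G s}"
      using F(3)[OF that] s[OF that] by simp
    then show ?thesis by simp
  qed
  have vfl: "clinear_on V (vec_functional (\<eta> s) (\<xi> s))" if "s \<in> F" for s
    using clinear_vec_functional[OF fam[OF that], of H H] V(2) by (auto simp: clinear_on_def subset_iff)
  have "\<omega> T = 0" if T: "T \<in> V" and z: "\<And>s. s \<in> F \<Longrightarrow> vec_functional (\<eta> s) (\<xi> s) T = 0" for T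
  proof (rule ccontr)
    assume "\<omega> T \<noteq> 0"
    \<comment> \<open>Multiples of \<open>T\<close> stay in the neighbourhood, also the one where \<open>\<omega>\<close> takes the value 1.\<close>
    define c where "c = 1 / \<omega> T"
    have cT: "c *\<^sub>C T \<in> V" by (rule cvec.subspace_scale[OF V(1) T])
    then have cTb: "c *\<^sub>C T \<in> bounded_ops H H" using V(2) by blast
    have "c *\<^sub>C T \<in> s" if "s \<in> F" for s
    proof -
      have "(\<Sum>n. cinner (\<eta> s n) ((c *\<^sub>C T) (\<xi> s n))) = 0"
        using suminf_eq_vec_functional[OF fam[OF that] cTb] clinear_on_scale[OF vfl[OF that] T, of c] z[OF that] by simp
      then show ?thesis using cTb G0[OF that] by (subst s[OF that]) simp
    qed
    then have "c *\<^sub>C T \<in> O' \<inter> V" using F(4) cT by blast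
    then have "cmod (\<omega> (c *\<^sub>C T)) < 1" unfolding O'(2)[symmetric] by simp
    then show False using \<open>\<omega> T \<noteq> 0\<close> by (simp add: clinear_on_scale[OF lin T] c_def)
  qed
  then obtain c where c: "\<And>T. T \<in> V \<Longrightarrow> \<omega> T = (\<Sum>s\<in>F. c s * vec_functional (\<eta> s) (\<xi> s) T)"
    using functional_in_span_of_finite_family[where f="\<lambda>s. vec_functional (\<eta> s) (\<xi> s)", OF F(1) V(1) vfl lin] by blast
  obtain a :: "('h \<Rightarrow> 'h) set \<times> nat \<Rightarrow> 'h" and b where ab: "sq_family H a" "sq_family H b"
    "\<And>T. T \<in> bounded_ops H H \<Longrightarrow> vec_functional b a T = (\<Sum>s\<in>F. c s * vec_functional (\<eta> s) (\<xi> s) T)"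
    using vec_functional_finite_combination[where \<xi>=\<xi> and \<eta>=\<eta> and c=c, OF H H F(1) fam] by blast
  obtain a' :: "nat \<Rightarrow> 'h" and b' where ab': "sq_family H a'" "sq_family H b'"
    "\<And>T. T \<in> bounded_ops H H \<Longrightarrow> vec_functional b' a' T = vec_functional b a T"
    using vec_functional_as_sequence[OF H H ab(1,2)] by blast
  have "\<omega> T = vec_functional b' a' T" if "T \<in> V" for T
    using that V(2) c ab(3) ab'(3) by (simp add: subset_iff)
  then show ?thesis using ab' by blast
qed

lemma vec_functional_mem_predual:
  assumes H: "hilbert_space H" and V: "V \<subseteq> bounded_ops H H" and ab: "sq_family H a" "sq_family H b"
  shows "vec_functional b a \<in> predual H V"
proof -
  have "clinear_on V (vec_functional b a)"
    using clinear_vec_functional[OF ab, of H H] V unfolding clinear_on_def by blast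
  then show ?thesis
    unfolding predual_def using continuous_map_from_subtopology[OF continuous_map_vec_functional[OF H H ab]] by blast
qed

section \<open>Weak* closed tensor products and Fubini products\<close>

lemma weak_star_tensor_generators:
  assumes "hilbert_space H" "hilbert_space K\<^sub>1" "\<V> \<subseteq> bounded_ops H H" "\<U> \<subseteq> bounded_ops K\<^sub>1 K\<^sub>2"
  shows "{op_tensor H K\<^sub>1 H K\<^sub>2 S T | S T. S \<in> \<V> \<and> T \<in> \<U>} \<subseteq> bounded_ops (hilbert_tensor H K\<^sub>1) (hilbert_tensor H K\<^sub>2)"
  using assms by (auto intro!: op_tensor_bounded)

lemma weak_star_tensor_closed_subspace:
  assumes "hilbert_space H" "hilbert_space K\<^sub>1" "\<V> \<subseteq> bounded_ops H H" "\<U> \<subseteq> bounded_ops K\<^sub>1 K\<^sub>2"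
  shows "weak_star_closed_subspace (hilbert_tensor H K\<^sub>1) (hilbert_tensor H K\<^sub>2) (weak_star_tensor H K\<^sub>1 K\<^sub>2 \<V> \<U>)"
  unfolding weak_star_closed_subspace_def weak_star_tensor_def
  by (intro conjI weak_star_closure_subspace hilbert_space_tensor cvec.subspace_span cvec.span_minimal
      weak_star_tensor_generators assms subspace_bounded_ops hilbert_space_subspace closedin_closure_of)

lemma weak_star_tensor_bounded:
  "weak_star_tensor H K\<^sub>1 K\<^sub>2 \<V> \<U> \<subseteq> bounded_ops (hilbert_tensor H K\<^sub>1) (hilbert_tensor H K\<^sub>2)"
  unfolding weak_star_tensor_def
  using closure_of_subset_topspace[of "weak_star (hilbert_tensor H K\<^sub>1) (hilbert_tensor H K\<^sub>2)"]
  by (simp add: hilbert_space_tensor)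

lemma op_tensor_mem_weak_star_tensor:
  assumes "hilbert_space H" "hilbert_space K\<^sub>1" "\<V> \<subseteq> bounded_ops H H" "\<U> \<subseteq> bounded_ops K\<^sub>1 K\<^sub>2"
    and "S \<in> \<V>" "T \<in> \<U>"
  shows "op_tensor H K\<^sub>1 H K\<^sub>2 S T \<in> weak_star_tensor H K\<^sub>1 K\<^sub>2 \<V> \<U>"
proof -
  let ?G = "{op_tensor H K\<^sub>1 H K\<^sub>2 S T | S T. S \<in> \<V> \<and> T \<in> \<U>}"
  have "cvec.span ?G \<subseteq> bounded_ops (hilbert_tensor H K\<^sub>1) (hilbert_tensor H K\<^sub>2)"
    by (intro cvec.span_minimal weak_star_tensor_generators assms subspace_bounded_ops
        hilbert_space_subspace hilbert_space_tensor)
  then have "cvec.span ?G \<subseteq> weak_star_tensor H K\<^sub>1 K\<^sub>2 \<V> \<U>"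
    unfolding weak_star_tensor_def by (intro closure_of_subset) (simp add: hilbert_space_tensor)
  moreover have "op_tensor H K\<^sub>1 H K\<^sub>2 S T \<in> cvec.span ?G"
    using assms(5,6) by (intro cvec.span_base) blast
  ultimately show ?thesis by blast
qed

text \<open>The explicit slice operator has the properties that are required of the slice map, so some
  map has them; and two maps with these properties agree, since their matrix coefficients are
  continuous and agree on the generators of the weak* closed tensor product.\<close>

lemma slice_map_eq_slice_op:
  fixes H :: "'h::chilbert_space set" and K\<^sub>1 K\<^sub>2 :: "'k::chilbert_space set"
  assumes H: "hilbert_space H" and K\<^sub>1: "hilbert_space K\<^sub>1" and K\<^sub>2: "hilbert_space K\<^sub>2"
    and V: "\<V> \<subseteq> bounded_ops H H"
    and a: "sq_family H a" and b: "sq_family H b" and \<omega>: "\<And>A. A \<in> \<V> \<Longrightarrow> \<omega> A = vec_functional b a A"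
    and T: "T \<in> weak_star_tensor H K\<^sub>1 K\<^sub>2 \<V> (bounded_ops K\<^sub>1 K\<^sub>2)"
  shows "slice_map H K\<^sub>1 K\<^sub>2 \<V> \<omega> T = slice_op K\<^sub>1 K\<^sub>2 b a T"
proof -
  let ?D = "weak_star_tensor H K\<^sub>1 K\<^sub>2 \<V> (bounded_ops K\<^sub>1 K\<^sub>2)"
  let ?W = "weak_star (hilbert_tensor H K\<^sub>1) (hilbert_tensor H K\<^sub>2)"
  let ?G = "{op_tensor H K\<^sub>1 H K\<^sub>2 S T | S T. S \<in> \<V> \<and> T \<in> bounded_ops K\<^sub>1 K\<^sub>2}"
  let ?P = "\<lambda>R. clinear_on ?D R \<and> continuous_map (subtopology ?W ?D) (weak_star K\<^sub>1 K\<^sub>2) R \<and>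
    (\<forall>A\<in>\<V>. \<forall>B\<in>bounded_ops K\<^sub>1 K\<^sub>2. R (op_tensor H K\<^sub>1 H K\<^sub>2 A B) = \<omega> A *\<^sub>C B)"
  note Db = weak_star_tensor_bounded[of H K\<^sub>1 K\<^sub>2 \<V> "bounded_ops K\<^sub>1 K\<^sub>2"]
  have D: "cvec.subspace ?D" "closedin ?W ?D"
    using weak_star_tensor_closed_subspace[OF H K\<^sub>1 V subset_refl, of K\<^sub>2]
    by (auto simp: weak_star_closed_subspace_def)
  have lin: "clinear_on ?D (slice_op K\<^sub>1 K\<^sub>2 b a)"
    using slice_op_clinear[OF H K\<^sub>1 K\<^sub>2 a b] Db unfolding clinear_on_def by blast
  note cont = continuous_map_from_subtopology[OF continuous_map_slice_op[OF H K\<^sub>1 K\<^sub>2 a b], of ?D]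
  have "?P (slice_op K\<^sub>1 K\<^sub>2 b a)"
    using lin cont V \<omega> by (auto simp: slice_op_op_tensor[OF H K\<^sub>1 K\<^sub>2 a b] subset_iff)
  then have P: "?P (slice_map H K\<^sub>1 K\<^sub>2 \<V> \<omega>)"
    unfolding slice_map_def Let_def by (rule someI[where P="?P"])
  define R where "R = slice_map H K\<^sub>1 K\<^sub>2 \<V> \<omega>"
  have R: "clinear_on ?D R" "continuous_map (subtopology ?W ?D) (weak_star K\<^sub>1 K\<^sub>2) R"
    "\<And>A B. A \<in> \<V> \<Longrightarrow> B \<in> bounded_ops K\<^sub>1 K\<^sub>2 \<Longrightarrow> R (op_tensor H K\<^sub>1 H K\<^sub>2 A B) = \<omega> A *\<^sub>C B"
    using P by (auto simp: R_def)
  have topD: "topspace (subtopology ?W ?D) = ?D"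
    using Db by (simp add: hilbert_space_tensor Int_absorb1)
  have Rb: "R S \<in> bounded_ops K\<^sub>1 K\<^sub>2" if "S \<in> ?D" for S
    using continuous_map_image_subset_topspace[OF R(2), unfolded topD topspace_weak_star[OF K\<^sub>1 K\<^sub>2]] that by blast
  have "cinner y (R T x) = cinner y (slice_op K\<^sub>1 K\<^sub>2 b a T x)" if xy: "x \<in> K\<^sub>1" "y \<in> K\<^sub>2" for x y
  proof -
    \<comment> \<open>A matrix coefficient is the functional of a family with a single member.\<close>
    let ?f = "vec_functional (\<lambda>_::unit. y) (\<lambda>_. x)"
    have f: "?f S = cinner y (S x)" for S by (simp add: vec_functional_def UNIV_unit)
    have fam: "sq_family K\<^sub>1 (\<lambda>_::unit. x)" "sq_family K\<^sub>2 (\<lambda>_::unit. y)"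
      using xy by (auto simp: sq_family_def)
    let ?g = "\<lambda>S. ?f (R S) - ?f (slice_op K\<^sub>1 K\<^sub>2 b a S)"
    let ?Z = "{S \<in> topspace (subtopology ?W ?D). ?g S \<in> {0}}"
    have "continuous_map (subtopology ?W ?D) euclidean ?g"
      using continuous_map_compose[OF R(2) continuous_map_vec_functional[OF K\<^sub>1 K\<^sub>2 fam]]
        continuous_map_compose[OF cont continuous_map_vec_functional[OF K\<^sub>1 K\<^sub>2 fam]]
      by (intro continuous_map_diff) (simp_all add: o_def)
    then have "closedin (subtopology ?W ?D) ?Z" by (rule closedin_continuous_map_preimage) simp
    then have "closedin ?W ?Z" by (rule closedin_trans_full[OF _ D(2)])
    moreover have "cvec.span ?G \<subseteq> ?Z"
    proof (rule cvec.span_minimal)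
      show "?G \<subseteq> ?Z"
        unfolding topD
        using op_tensor_mem_weak_star_tensor[OF H K\<^sub>1 V subset_refl, of _ _ K\<^sub>2] R(3) V \<omega>
        by (auto simp: slice_op_op_tensor[OF H K\<^sub>1 K\<^sub>2 a b] subset_iff)
      show "cvec.subspace ?Z"
        unfolding topD f
        by (rule cvec.subspaceI)
           (auto simp: cvec.subspace_0[OF D(1)] cvec.subspace_add[OF D(1)] cvec.subspace_scale[OF D(1)]
             clinear_on_zero[OF R(1)] clinear_on_add[OF R(1)] clinear_on_scale[OF R(1)]
             clinear_on_zero[OF lin] clinear_on_add[OF lin] clinear_on_scale[OF lin]
             cinner_add_right cinner_scaleC_right scaleC_fun_apply)
    qed
    ultimately have "?W closure_of cvec.span ?G \<subseteq> ?Z" by (rule closure_of_minimal[rotated])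
    then have "T \<in> ?Z" using T unfolding weak_star_tensor_def[of H K\<^sub>1 K\<^sub>2 \<V>] by blast
    then show ?thesis by (simp add: f)
  qed
  then show ?thesis
    unfolding R_def[symmetric]
    using bounded_ops_eq_by_cinner[OF K\<^sub>2 Rb[OF T] slice_op_bounded[OF H K\<^sub>1 K\<^sub>2 a b]] T Db by blast
qed

text \<open>Every weak* continuous functional is that of a pair of sequences, and slicing by such a
  functional is explicit.\<close>

lemma fubini_product_iff:
  fixes H :: "'h::chilbert_space set"
  assumes H: "hilbert_space H" and K\<^sub>1: "hilbert_space K\<^sub>1" and K\<^sub>2: "hilbert_space K\<^sub>2"
    and V: "cvec.subspace \<V>" "\<V> \<subseteq> bounded_ops H H"
  shows "T \<in> fubini_product H K\<^sub>1 K\<^sub>2 \<V> \<U> \<longleftrightarrow>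
    T \<in> weak_star_tensor H K\<^sub>1 K\<^sub>2 \<V> (bounded_ops K\<^sub>1 K\<^sub>2) \<and>
    (\<forall>(a :: nat \<Rightarrow> 'h) b. sq_family H a \<longrightarrow> sq_family H b \<longrightarrow> slice_op K\<^sub>1 K\<^sub>2 b a T \<in> \<U>)"
proof -
  have "(\<forall>\<omega>\<in>predual H \<V>. slice_map H K\<^sub>1 K\<^sub>2 \<V> \<omega> T \<in> \<U>) \<longleftrightarrow>
    (\<forall>(a :: nat \<Rightarrow> 'h) b. sq_family H a \<longrightarrow> sq_family H b \<longrightarrow> slice_op K\<^sub>1 K\<^sub>2 b a T \<in> \<U>)"
    if T: "T \<in> weak_star_tensor H K\<^sub>1 K\<^sub>2 \<V> (bounded_ops K\<^sub>1 K\<^sub>2)"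
  proof (intro iffI allI ballI impI)
    fix a b :: "nat \<Rightarrow> 'h"
    assume *: "\<forall>\<omega>\<in>predual H \<V>. slice_map H K\<^sub>1 K\<^sub>2 \<V> \<omega> T \<in> \<U>" and ab: "sq_family H a" "sq_family H b"
    have "slice_map H K\<^sub>1 K\<^sub>2 \<V> (vec_functional b a) T = slice_op K\<^sub>1 K\<^sub>2 b a T"
      by (rule slice_map_eq_slice_op[OF H K\<^sub>1 K\<^sub>2 V(2) ab refl T])
    then show "slice_op K\<^sub>1 K\<^sub>2 b a T \<in> \<U>"
      using * vec_functional_mem_predual[OF H V(2) ab] by metis
  next
    fix \<omega> assume *: "\<forall>(a :: nat \<Rightarrow> 'h) b. sq_family H a \<longrightarrow> sq_family H b \<longrightarrow> slice_op K\<^sub>1 K\<^sub>2 b a T \<in> \<U>"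
      and \<omega>: "\<omega> \<in> predual H \<V>"
    obtain a b :: "nat \<Rightarrow> 'h" where ab: "sq_family H a" "sq_family H b" "\<And>A. A \<in> \<V> \<Longrightarrow> \<omega> A = vec_functional b a A"
      using predual_representation[OF H V \<omega>] by blast
    show "slice_map H K\<^sub>1 K\<^sub>2 \<V> \<omega> T \<in> \<U>"
      using slice_map_eq_slice_op[OF H K\<^sub>1 K\<^sub>2 V(2) ab T] * ab(1,2) by simp
  qed
  then show ?thesis by (auto simp: fubini_product_def)
qed

lemma weak_star_tensor_subset_fubini_product:
  assumes H: "hilbert_space H" and K\<^sub>1: "hilbert_space K\<^sub>1" and K\<^sub>2: "hilbert_space K\<^sub>2"
    and V: "cvec.subspace \<V>" "\<V> \<subseteq> bounded_ops H H"
    and U: "weak_star_closed_subspace K\<^sub>1 K\<^sub>2 \<U>"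
  shows "weak_star_tensor H K\<^sub>1 K\<^sub>2 \<V> \<U> \<subseteq> fubini_product H K\<^sub>1 K\<^sub>2 \<V> \<U>"
proof
  fix T assume T: "T \<in> weak_star_tensor H K\<^sub>1 K\<^sub>2 \<V> \<U>"
  have Us: "cvec.subspace \<U>" and Ub: "\<U> \<subseteq> bounded_ops K\<^sub>1 K\<^sub>2"
    using U closedin_subset[of "weak_star K\<^sub>1 K\<^sub>2" \<U>] by (auto simp: weak_star_closed_subspace_def K\<^sub>1 K\<^sub>2)
  have "weak_star_tensor H K\<^sub>1 K\<^sub>2 \<V> \<U> \<subseteq> weak_star_tensor H K\<^sub>1 K\<^sub>2 \<V> (bounded_ops K\<^sub>1 K\<^sub>2)"
    unfolding weak_star_tensor_def using Ub by (intro closure_of_mono cvec.span_mono) blast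
  moreover have "slice_op K\<^sub>1 K\<^sub>2 b a T \<in> \<U>" if ab: "sq_family H a" "sq_family H b" for a b :: "nat \<Rightarrow> _"
  proof (rule weak_star_closed_span_induct[OF continuous_map_slice_op[OF H K\<^sub>1 K\<^sub>2 ab] slice_op_clinear[OF H K\<^sub>1 K\<^sub>2 ab]
        weak_star_tensor_generators[OF H K\<^sub>1 V(2) Ub] hilbert_space_tensor hilbert_space_tensor U _
        T[unfolded weak_star_tensor_def]])
    fix S assume "S \<in> {op_tensor H K\<^sub>1 H K\<^sub>2 S T | S T. S \<in> \<V> \<and> T \<in> \<U>}"
    then obtain A B where S: "S = op_tensor H K\<^sub>1 H K\<^sub>2 A B" "A \<in> \<V>" "B \<in> \<U>" by blast
    then have "slice_op K\<^sub>1 K\<^sub>2 b a S = vec_functional b a A *\<^sub>C B"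
      using slice_op_op_tensor[OF H K\<^sub>1 K\<^sub>2 ab, of A B] V(2) Ub by (simp add: subset_iff)
    then show "slice_op K\<^sub>1 K\<^sub>2 b a S \<in> \<U>" using cvec.subspace_scale[OF Us S(3)] by simp
  qed
  ultimately show "T \<in> fubini_product H K\<^sub>1 K\<^sub>2 \<V> \<U>"
    using T by (auto simp: fubini_product_iff[OF H K\<^sub>1 K\<^sub>2 V])
qed

section \<open>Transport along spatial embeddings\<close>

text \<open>On generators this is \<open>(P \<otimes> 1) (A \<otimes> B) (Q \<otimes> 1) = P A Q \<otimes> B\<close>.\<close>

lemma weak_star_tensor_sandwich:
  assumes H: "hilbert_space H" and H': "hilbert_space H'" and K\<^sub>1: "hilbert_space K\<^sub>1" and K\<^sub>2: "hilbert_space K\<^sub>2"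
    and V: "\<V> \<subseteq> bounded_ops H H" and V': "\<V>' \<subseteq> bounded_ops H' H'" and U: "\<U> \<subseteq> bounded_ops K\<^sub>1 K\<^sub>2"
    and P: "P \<in> bounded_ops H H'" and Q: "Q \<in> bounded_ops H' H"
    and PQ: "\<And>S. S \<in> \<V> \<Longrightarrow> P \<circ> S \<circ> Q \<in> \<V>'"
    and T: "T \<in> weak_star_tensor H K\<^sub>1 K\<^sub>2 \<V> \<U>"
  shows "op_tensor H K\<^sub>2 H' K\<^sub>2 P (id_op K\<^sub>2) \<circ> T \<circ> op_tensor H' K\<^sub>1 H K\<^sub>1 Q (id_op K\<^sub>1)
    \<in> weak_star_tensor H' K\<^sub>1 K\<^sub>2 \<V>' \<U>" (is "?P \<circ> T \<circ> ?Q \<in> _")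
proof -
  note ht = hilbert_space_tensor
  have Pb: "?P \<in> bounded_ops (hilbert_tensor H K\<^sub>2) (hilbert_tensor H' K\<^sub>2)"
    by (rule op_tensor_bounded[OF H K\<^sub>2 P id_op_bounded[OF K\<^sub>2]])
  have Qb: "?Q \<in> bounded_ops (hilbert_tensor H' K\<^sub>1) (hilbert_tensor H K\<^sub>1)"
    by (rule op_tensor_bounded[OF H' K\<^sub>1 Q id_op_bounded[OF K\<^sub>1]])
  show ?thesis
  proof (rule weak_star_closed_span_induct[OF continuous_map_sandwich[OF ht ht ht ht Pb Qb] clinear_sandwich[OF ht Pb]
        weak_star_tensor_generators[OF H K\<^sub>1 V U] ht ht weak_star_tensor_closed_subspace[OF H' K\<^sub>1 V' U] _
        T[unfolded weak_star_tensor_def]])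
    fix S assume "S \<in> {op_tensor H K\<^sub>1 H K\<^sub>2 S T | S T. S \<in> \<V> \<and> T \<in> \<U>}"
    then obtain A B where S: "S = op_tensor H K\<^sub>1 H K\<^sub>2 A B" and A: "A \<in> \<V>" and B: "B \<in> \<U>" by blast
    have A': "A \<in> bounded_ops H H" and B': "B \<in> bounded_ops K\<^sub>1 K\<^sub>2" using A B V U by auto
    have "?P \<circ> S \<circ> ?Q = op_tensor H' K\<^sub>1 H' K\<^sub>2 (P \<circ> A \<circ> Q) (id_op K\<^sub>2 \<circ> B \<circ> id_op K\<^sub>1)"
      unfolding S
      by (simp only: op_tensor_comp[OF H H K\<^sub>1 K\<^sub>2 A' P B' id_op_bounded[OF K\<^sub>2]]
          op_tensor_comp[OF H' H K\<^sub>1 K\<^sub>1 Q bounded_ops_comp[OF H P A'] id_op_bounded[OF K\<^sub>1]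
            bounded_ops_comp[OF K\<^sub>2 id_op_bounded[OF K\<^sub>2] B']])
    also have "id_op K\<^sub>2 \<circ> B \<circ> id_op K\<^sub>1 = B"
      by (simp only: id_op_comp[OF B'] comp_id_op[OF K\<^sub>1 B'])
    finally show "?P \<circ> S \<circ> ?Q \<in> weak_star_tensor H' K\<^sub>1 K\<^sub>2 \<V>' \<U>"
      by (simp only: op_tensor_mem_weak_star_tensor[OF H' K\<^sub>1 V' U PQ[OF A] B])
  qed
qed

lemma product_span_induct:
  fixes H :: "'h::chilbert_space set" and K :: "'k::chilbert_space set" and L :: "'l::chilbert_space set"
  assumes H: "hilbert_space H" and L: "hilbert_space L" and K: "hilbert_space K"
    and XY: "\<X> \<subseteq> bounded_ops L K" "\<Y> \<subseteq> bounded_ops H L"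
    and F: "continuous_map (weak_star H K) (weak_star H' K') F" "clinear_on (bounded_ops H K) F"
    and W: "weak_star_closed_subspace H' K' W"
    and g: "\<And>X Y. X \<in> \<X> \<Longrightarrow> Y \<in> \<Y> \<Longrightarrow> F (X \<circ> Y) \<in> W"
    and T: "T \<in> product_span H K \<X> \<Y>"
  shows "F T \<in> W"
proof (rule weak_star_closed_span_induct[OF F _ H K W])
  let ?G = "{X \<circ> Y | X Y. X \<in> \<X> \<and> Y \<in> \<Y>}"
  show "?G \<subseteq> bounded_ops H K" using XY by (auto intro!: bounded_ops_comp[OF L])
  show "F S \<in> W" if "S \<in> ?G" for S using that g by blast
  have "{(\<Sum>i<k. X i \<circ> Y i) | (k::nat) X Y. (\<forall>i<k. X i \<in> \<X> \<and> Y i \<in> \<Y>)} \<subseteq> cvec.span ?G"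
    by (clarify, rule cvec.span_sum, rule cvec.span_base) blast
  then have "product_span H K \<X> \<Y> \<subseteq> weak_star H K closure_of cvec.span ?G"
    unfolding product_span_def by (rule closure_of_mono)
  then show "T \<in> weak_star H K closure_of cvec.span ?G" using T by blast
qed

lemma comp_mem_product_span:
  assumes H: "hilbert_space H" and L: "hilbert_space L" and K: "hilbert_space K"
    and XY: "\<X> \<subseteq> bounded_ops L K" "\<Y> \<subseteq> bounded_ops H L" and X: "X \<in> \<X>" and Y: "Y \<in> \<Y>"
  shows "X \<circ> Y \<in> product_span H K \<X> \<Y>"
proof -
  let ?S = "{(\<Sum>i<k. X i \<circ> Y i) | (k::nat) X Y. (\<forall>i<k. X i \<in> \<X> \<and> Y i \<in> \<Y>)}"
  have "?S \<subseteq> bounded_ops H K"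
    using XY by (auto intro!: cvec.subspace_sum[OF subspace_bounded_ops[OF hilbert_space_subspace[OF K]]] bounded_ops_comp[OF L])
  then have "?S \<subseteq> product_span H K \<X> \<Y>"
    unfolding product_span_def by (intro closure_of_subset) (simp add: H K)
  moreover have "X \<circ> Y \<in> ?S"
    using X Y by (intro CollectI exI[of _ 1] exI[of _ "\<lambda>_. X"] exI[of _ "\<lambda>_. Y"]) auto
  ultimately show ?thesis by blast
qed

lemma clinear_on_comp:
  assumes "clinear_on S f" "clinear_on S' g" "\<And>x. x \<in> S \<Longrightarrow> f x \<in> S'"
  shows "clinear_on S (\<lambda>x. g (f x))"
  using assms by (auto simp: clinear_on_def)

text \<open>For \<open>T\<close> in the Fubini product of \<open>\<A>\<close> and \<open>\<U>\<close>, the operator \<open>(X \<otimes> 1) T (Y \<otimes> 1)\<close> is in the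
  Fubini product of \<open>\<B>\<close> and \<open>\<U>\<close>, hence in \<open>\<B> \<otimes> \<U>\<close>. Multiplying it by \<open>Y' \<otimes> 1\<close> and \<open>X' \<otimes> 1\<close> returns
  to \<open>\<A> \<otimes> \<U>\<close>. Finally \<open>Y' X\<close> and \<open>Y X'\<close> are replaced by the identity, one at a time.\<close>

theorem property_S_sigma_spatially_embedded:
  fixes H\<^sub>1 :: "'a::chilbert_space set" and H\<^sub>2 :: "'b::chilbert_space set"
    and \<A> :: "('a \<Rightarrow> 'a) set" and \<B> :: "('b \<Rightarrow> 'b) set"
  assumes H\<^sub>1: "hilbert_space H\<^sub>1" and H\<^sub>2: "hilbert_space H\<^sub>2"
    and \<A>: "weak_star_closed_unital_algebra H\<^sub>1 \<A>" and \<B>: "weak_star_closed_unital_algebra H\<^sub>2 \<B>"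
    and emb: "spatially_embedded H\<^sub>1 \<A> H\<^sub>2 \<B>"
    and S: "property_S_sigma TYPE('k::chilbert_space) H\<^sub>2 \<B>"
  shows "property_S_sigma TYPE('k) H\<^sub>1 \<A>"
proof -
  obtain \<X> \<Y> where bX: "bimodule H\<^sub>1 H\<^sub>2 \<B> \<A> \<X>" and bY: "bimodule H\<^sub>2 H\<^sub>1 \<A> \<B> \<Y>"
    and XY: "product_span H\<^sub>2 H\<^sub>2 \<X> \<Y> \<subseteq> \<B>" and YX: "product_span H\<^sub>1 H\<^sub>1 \<Y> \<X> = \<A>"
    using emb unfolding spatially_embedded_def by blast
  have X: "\<X> \<subseteq> bounded_ops H\<^sub>1 H\<^sub>2" and Y: "\<Y> \<subseteq> bounded_ops H\<^sub>2 H\<^sub>1"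
    using bX bY by (auto simp: bimodule_def)
  have As: "cvec.subspace \<A>" and Ab: "\<A> \<subseteq> bounded_ops H\<^sub>1 H\<^sub>1" and idA: "id_op H\<^sub>1 \<in> \<A>"
    using \<A> closedin_subset[of "weak_star H\<^sub>1 H\<^sub>1" \<A>]
    by (auto simp: weak_star_closed_unital_algebra_def weak_star_closed_subspace_def H\<^sub>1)
  have Bs: "cvec.subspace \<B>" and Bb: "\<B> \<subseteq> bounded_ops H\<^sub>2 H\<^sub>2" and idB: "id_op H\<^sub>2 \<in> \<B>"
    using \<B> closedin_subset[of "weak_star H\<^sub>2 H\<^sub>2" \<B>]
    by (auto simp: weak_star_closed_unital_algebra_def weak_star_closed_subspace_def H\<^sub>2)
  have XAY: "x \<circ> A \<circ> y \<in> \<B>" if x: "x \<in> \<X>" and A: "A \<in> \<A>" and y: "y \<in> \<Y>" for x A y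
  proof -
    have "id_op H\<^sub>2 \<circ> x \<circ> A \<in> \<X>" using bX idB x A by (auto simp: bimodule_def)
    then have "x \<circ> A \<in> \<X>" using id_op_comp[OF subsetD[OF X x]] by (simp only:)
    from comp_mem_product_span[OF H\<^sub>2 H\<^sub>1 H\<^sub>2 X Y this y] XY show ?thesis by blast
  qed
  have YBX: "y \<circ> B \<circ> x \<in> \<A>" if y: "y \<in> \<Y>" and B: "B \<in> \<B>" and x: "x \<in> \<X>" for x B y
  proof -
    have "id_op H\<^sub>1 \<circ> y \<circ> B \<in> \<Y>" using bY idA y B by (auto simp: bimodule_def)
    then have "y \<circ> B \<in> \<Y>" using id_op_comp[OF subsetD[OF Y y]] by (simp only:)
    from comp_mem_product_span[OF H\<^sub>1 H\<^sub>2 H\<^sub>1 Y X this x] YX show ?thesis by blast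
  qed
  show ?thesis
    unfolding property_S_sigma_def
  proof (intro allI impI)
    fix K\<^sub>1 K\<^sub>2 :: "'k set" and \<U>
    assume K\<^sub>1: "hilbert_space K\<^sub>1" and K\<^sub>2: "hilbert_space K\<^sub>2" and U: "weak_star_closed_subspace K\<^sub>1 K\<^sub>2 \<U>"
    have Ub: "\<U> \<subseteq> bounded_ops K\<^sub>1 K\<^sub>2"
      using U closedin_subset[of "weak_star K\<^sub>1 K\<^sub>2" \<U>] by (auto simp: weak_star_closed_subspace_def K\<^sub>1 K\<^sub>2)
    have FB: "fubini_product H\<^sub>2 K\<^sub>1 K\<^sub>2 \<B> \<U> = weak_star_tensor H\<^sub>2 K\<^sub>1 K\<^sub>2 \<B> \<U>"
      using S K\<^sub>1 K\<^sub>2 U unfolding property_S_sigma_def by blast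
    let ?W = "weak_star_tensor H\<^sub>1 K\<^sub>1 K\<^sub>2 \<A> \<U>"
    have W: "weak_star_closed_subspace (hilbert_tensor H\<^sub>1 K\<^sub>1) (hilbert_tensor H\<^sub>1 K\<^sub>2) ?W"
      by (rule weak_star_tensor_closed_subspace[OF H\<^sub>1 K\<^sub>1 Ab Ub])
    have "T \<in> ?W" if T: "T \<in> fubini_product H\<^sub>1 K\<^sub>1 K\<^sub>2 \<A> \<U>" for T
    proof -
      note ht = hilbert_space_tensor and id = id_op_bounded
      let ?L = "\<lambda>R. op_tensor H\<^sub>1 K\<^sub>2 H\<^sub>1 K\<^sub>2 R (id_op K\<^sub>2)" and ?R = "\<lambda>R. op_tensor H\<^sub>1 K\<^sub>1 H\<^sub>1 K\<^sub>1 R (id_op K\<^sub>1)"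
      have TD: "T \<in> weak_star_tensor H\<^sub>1 K\<^sub>1 K\<^sub>2 \<A> (bounded_ops K\<^sub>1 K\<^sub>2)"
        and TU: "\<And>(a :: nat \<Rightarrow> 'a) b. sq_family H\<^sub>1 a \<Longrightarrow> sq_family H\<^sub>1 b \<Longrightarrow> slice_op K\<^sub>1 K\<^sub>2 b a T \<in> \<U>"
        using T by (auto simp: fubini_product_iff[OF H\<^sub>1 K\<^sub>1 K\<^sub>2 As Ab])
      have Tb: "T \<in> bounded_ops (hilbert_tensor H\<^sub>1 K\<^sub>1) (hilbert_tensor H\<^sub>1 K\<^sub>2)"
        using TD weak_star_tensor_bounded by blast
      have four: "?L (y' \<circ> x) \<circ> T \<circ> ?R (y \<circ> x') \<in> ?W"
        if m: "x \<in> \<X>" "x' \<in> \<X>" "y \<in> \<Y>" "y' \<in> \<Y>" for x x' y y'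
      proof -
        have xb: "x \<in> bounded_ops H\<^sub>1 H\<^sub>2" "x' \<in> bounded_ops H\<^sub>1 H\<^sub>2" and yb: "y \<in> bounded_ops H\<^sub>2 H\<^sub>1" "y' \<in> bounded_ops H\<^sub>2 H\<^sub>1"
          using m X Y by auto
        let ?x = "op_tensor H\<^sub>1 K\<^sub>2 H\<^sub>2 K\<^sub>2 x (id_op K\<^sub>2)" and ?y = "op_tensor H\<^sub>2 K\<^sub>1 H\<^sub>1 K\<^sub>1 y (id_op K\<^sub>1)"
          and ?x' = "op_tensor H\<^sub>1 K\<^sub>1 H\<^sub>2 K\<^sub>1 x' (id_op K\<^sub>1)" and ?y' = "op_tensor H\<^sub>2 K\<^sub>2 H\<^sub>1 K\<^sub>2 y' (id_op K\<^sub>2)"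
        let ?M = "?x \<circ> T \<circ> ?y"
        have "?M \<in> weak_star_tensor H\<^sub>2 K\<^sub>1 K\<^sub>2 \<B> (bounded_ops K\<^sub>1 K\<^sub>2)"
          by (rule weak_star_tensor_sandwich[OF H\<^sub>1 H\<^sub>2 K\<^sub>1 K\<^sub>2 Ab Bb subset_refl xb(1) yb(1) XAY[OF m(1) _ m(3)] TD])
        moreover have "slice_op K\<^sub>1 K\<^sub>2 b a ?M \<in> \<U>" if ab: "sq_family H\<^sub>2 a" "sq_family H\<^sub>2 b" for a b :: "nat \<Rightarrow> 'b"
        proof -
          obtain P where P: "P \<in> bounded_ops H\<^sub>2 H\<^sub>1" "\<And>u v. u \<in> H\<^sub>1 \<Longrightarrow> v \<in> H\<^sub>2 \<Longrightarrow> cinner (P v) u = cinner v (x u)"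
            using adjoint_exists[OF H\<^sub>1 H\<^sub>2 xb(1)] by blast
          have "slice_op K\<^sub>1 K\<^sub>2 b a ?M = slice_op K\<^sub>1 K\<^sub>2 (\<lambda>j. P (b j)) (\<lambda>j. y (a j)) T"
            by (rule slice_op_sandwich[OF H\<^sub>1 H\<^sub>2 K\<^sub>1 K\<^sub>2 xb(1) P yb(1) ab Tb])
          then show ?thesis using TU[OF sq_family_image[OF ab(1) yb(1)] sq_family_image[OF ab(2) P(1)]] by (simp only:)
        qed
        ultimately have M: "?M \<in> weak_star_tensor H\<^sub>2 K\<^sub>1 K\<^sub>2 \<B> \<U>"
          unfolding FB[symmetric] fubini_product_iff[OF H\<^sub>2 K\<^sub>1 K\<^sub>2 Bs Bb] by blast
        have "?y' \<circ> ?M \<circ> ?x' \<in> ?W"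
          by (rule weak_star_tensor_sandwich[OF H\<^sub>2 H\<^sub>1 K\<^sub>1 K\<^sub>2 Bb Ab Ub yb(2) xb(2) YBX[OF m(4) _ m(2)] M])
        moreover have "?y' \<circ> ?x = ?L (y' \<circ> x)"
          using op_tensor_comp[OF H\<^sub>1 H\<^sub>2 K\<^sub>2 K\<^sub>2 xb(1) yb(2) id[OF K\<^sub>2] id[OF K\<^sub>2]]
          by (simp only: id_op_comp[OF id[OF K\<^sub>2]])
        moreover have "?y \<circ> ?x' = ?R (y \<circ> x')"
          using op_tensor_comp[OF H\<^sub>1 H\<^sub>2 K\<^sub>1 K\<^sub>1 xb(2) yb(1) id[OF K\<^sub>1] id[OF K\<^sub>1]]
          by (simp only: id_op_comp[OF id[OF K\<^sub>1]])
        ultimately show ?thesis by (metis comp_assoc)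
      qed
      have idL: "?L (id_op H\<^sub>1) = id_op (hilbert_tensor H\<^sub>1 K\<^sub>2)" by (rule op_tensor_id[OF H\<^sub>1 K\<^sub>2])
      have idR: "?R (id_op H\<^sub>1) = id_op (hilbert_tensor H\<^sub>1 K\<^sub>1)" by (rule op_tensor_id[OF H\<^sub>1 K\<^sub>1])
      have Lb: "?L A \<in> bounded_ops (hilbert_tensor H\<^sub>1 K\<^sub>2) (hilbert_tensor H\<^sub>1 K\<^sub>2)" if "A \<in> bounded_ops H\<^sub>1 H\<^sub>1" for A
        by (rule op_tensor_bounded[OF H\<^sub>1 K\<^sub>2 that id[OF K\<^sub>2]])
      have Rb: "?R A \<in> bounded_ops (hilbert_tensor H\<^sub>1 K\<^sub>1) (hilbert_tensor H\<^sub>1 K\<^sub>1)" if "A \<in> bounded_ops H\<^sub>1 H\<^sub>1" for A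
        by (rule op_tensor_bounded[OF H\<^sub>1 K\<^sub>1 that id[OF K\<^sub>1]])
      have id_in: "id_op H\<^sub>1 \<in> product_span H\<^sub>1 H\<^sub>1 \<Y> \<X>" using idA YX by simp
      have "T \<circ> ?R (y \<circ> x') \<in> ?W" if m: "x' \<in> \<X>" "y \<in> \<Y>" for x' y
      proof -
        have yx: "y \<circ> x' \<in> bounded_ops H\<^sub>1 H\<^sub>1" using m X Y by (intro bounded_ops_comp[OF H\<^sub>2]) auto
        let ?Q = "T \<circ> ?R (y \<circ> x')"
        have Qb: "?Q \<in> bounded_ops (hilbert_tensor H\<^sub>1 K\<^sub>1) (hilbert_tensor H\<^sub>1 K\<^sub>2)"
          by (rule bounded_ops_comp[OF ht Tb Rb[OF yx]])
        \<comment> \<open>The factor \<open>id_op\<close> only gives the map the form of a two-sided multiplication.\<close>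
        let ?F = "\<lambda>A. id_op (hilbert_tensor H\<^sub>1 K\<^sub>2) \<circ> ?L A \<circ> ?Q"
        have F: "?F A = ?L A \<circ> ?Q" if "A \<in> bounded_ops H\<^sub>1 H\<^sub>1" for A
          by (simp only: id_op_comp[OF Lb[OF that]])
        have "?F (id_op H\<^sub>1) \<in> ?W"
        proof (rule product_span_induct[OF H\<^sub>1 H\<^sub>2 H\<^sub>1 Y X _ _ W _ id_in])
          show "continuous_map (weak_star H\<^sub>1 H\<^sub>1) (weak_star (hilbert_tensor H\<^sub>1 K\<^sub>1) (hilbert_tensor H\<^sub>1 K\<^sub>2)) ?F"
            using continuous_map_compose[OF continuous_map_amplification[OF H\<^sub>1 H\<^sub>1 K\<^sub>2]
                continuous_map_sandwich[OF ht ht ht ht id[OF ht] Qb]] by (simp only: o_def[of "\<lambda>T. id_op _ \<circ> T \<circ> _"])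
          show "clinear_on (bounded_ops H\<^sub>1 H\<^sub>1) ?F"
            by (rule clinear_on_comp[OF clinear_amplification[OF H\<^sub>1 H\<^sub>1 K\<^sub>2] clinear_sandwich[OF ht id[OF ht]] Lb])
          fix y' x assume *: "y' \<in> \<Y>" "x \<in> \<X>"
          then have b: "y' \<circ> x \<in> bounded_ops H\<^sub>1 H\<^sub>1" using X Y by (intro bounded_ops_comp[OF H\<^sub>2]) auto
          show "?F (y' \<circ> x) \<in> ?W"
            unfolding F[OF b] using four[OF *(2) m *(1)] by (simp only: comp_assoc)
        qed
        then show ?thesis
          unfolding idL id_op_comp[OF id[OF ht]] id_op_comp[OF Qb] .
      qed
      note half = this
      let ?F = "\<lambda>A. T \<circ> ?R A \<circ> id_op (hilbert_tensor H\<^sub>1 K\<^sub>1)"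
      have F: "?F A = T \<circ> ?R A" if "A \<in> bounded_ops H\<^sub>1 H\<^sub>1" for A
        by (rule comp_id_op[OF ht bounded_ops_comp[OF ht Tb Rb[OF that]]])
      have "?F (id_op H\<^sub>1) \<in> ?W"
      proof (rule product_span_induct[OF H\<^sub>1 H\<^sub>2 H\<^sub>1 Y X _ _ W _ id_in])
        show "continuous_map (weak_star H\<^sub>1 H\<^sub>1) (weak_star (hilbert_tensor H\<^sub>1 K\<^sub>1) (hilbert_tensor H\<^sub>1 K\<^sub>2)) ?F"
          using continuous_map_compose[OF continuous_map_amplification[OF H\<^sub>1 H\<^sub>1 K\<^sub>1]
              continuous_map_sandwich[OF ht ht ht ht Tb id[OF ht]]] by (simp only: o_def[of "\<lambda>S. T \<circ> S \<circ> _"])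
        show "clinear_on (bounded_ops H\<^sub>1 H\<^sub>1) ?F"
          by (rule clinear_on_comp[OF clinear_amplification[OF H\<^sub>1 H\<^sub>1 K\<^sub>1] clinear_sandwich[OF ht Tb] Rb])
        fix y x assume *: "y \<in> \<Y>" "x \<in> \<X>"
        then have b: "y \<circ> x \<in> bounded_ops H\<^sub>1 H\<^sub>1" using X Y by (intro bounded_ops_comp[OF H\<^sub>2]) auto
        show "?F (y \<circ> x) \<in> ?W"
          unfolding F[OF b] by (rule half[OF *(2,1)])
      qed
      then show ?thesis
        unfolding idR comp_id_op[OF ht Tb] .
    qed
    then show "fubini_product H\<^sub>1 K\<^sub>1 K\<^sub>2 \<A> \<U> = ?W"
      using weak_star_tensor_subset_fubini_product[OF H\<^sub>1 K\<^sub>1 K\<^sub>2 As Ab U] by blast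
  qed
qed

theorem corollary6p2:
  fixes H\<^sub>1 :: "'a::chilbert_space set" and H\<^sub>2 :: "'b::chilbert_space set"
    and \<A> :: "('a \<Rightarrow> 'a) set" and \<B> :: "('b \<Rightarrow> 'b) set"
  assumes "hilbert_space H\<^sub>1" and "hilbert_space H\<^sub>2"
    and "weak_star_closed_unital_algebra H\<^sub>1 \<A>"
    and "weak_star_closed_unital_algebra H\<^sub>2 \<B>"
  shows "(spatially_embedded H\<^sub>1 \<A> H\<^sub>2 \<B> \<longrightarrow>
            property_S_sigma TYPE('k::chilbert_space) H\<^sub>2 \<B> \<longrightarrow>
            property_S_sigma TYPE('k) H\<^sub>1 \<A>) \<and>
         (spatially_Morita_equivalent H\<^sub>1 \<A> H\<^sub>2 \<B> \<longrightarrow>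
            (property_S_sigma TYPE('k) H\<^sub>1 \<A> \<longleftrightarrow> property_S_sigma TYPE('k) H\<^sub>2 \<B>))"
proof (intro conjI impI)
  show "property_S_sigma TYPE('k) H\<^sub>1 \<A>"
    if "spatially_embedded H\<^sub>1 \<A> H\<^sub>2 \<B>" "property_S_sigma TYPE('k) H\<^sub>2 \<B>"
    by (rule property_S_sigma_spatially_embedded[OF assms that])
next
  assume "spatially_Morita_equivalent H\<^sub>1 \<A> H\<^sub>2 \<B>"
  then have "spatially_embedded H\<^sub>1 \<A> H\<^sub>2 \<B>" "spatially_embedded H\<^sub>2 \<B> H\<^sub>1 \<A>"
    unfolding spatially_Morita_equivalent_def spatially_embedded_def by blast+
  then show "property_S_sigma TYPE('k) H\<^sub>1 \<A> \<longleftrightarrow> property_S_sigma TYPE('k) H\<^sub>2 \<B>"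
    using property_S_sigma_spatially_embedded[OF assms] property_S_sigma_spatially_embedded[OF assms(2,1,4,3)]
    by blast
qed

end
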